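(* Let $\mathcal{A}$ be a finite-dimensional weak Hopf algebra over $\mathbb{C}$ such that $\mathcal{A}^*$ is semisimple and spherical, let $k\in\mathcal{A}^*$ be a spherical element of $\mathcal{A}^*$ and $\xi_a\in\mathbb{C}$ with $\psi_a(k)=\xi_a\psi_a(g)$ for all $a$. Define $\Omega\in\mathcal{A}$ by $$f(\Omega)=\sum_{a\in\mathrm{Irr}(\mathcal{A}^* )}\frac{1}{\sum_{x:\,l_x=l_a}d_x^2}\cdot\frac{d_a}{\xi_a}\,\mathrm{Tr}\,\psi_a(f)\qquad(f\in\mathcal{A}^* ).$$ Then $\Omega$ is non-degenerate and cocommutative, $\Omega^2=\Omega$, and there exists a linear map $T:\mathcal{A}\to\mathcal{A}$ such that for all $x\in\mathcal{A}$: $(1\otimes x)\Delta(\Omega)=(T(x)\otimes1)\Delta(\Omega)$ and $\Delta(T(x))=\sum k^{-1}(x_{(2)})T(x_{(3)})\otimes T(x_{(1)})$ (i.e. $\Delta\circ T=(T\otimes k^{-1}\otimes T)\circ\Delta^2_{\mathrm{op}}$). Moreover $$\sum T(\Omega_{(1)})\,k^{-1}(\Omega_{(2)})=S(\Omega)=\Omega .$$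
   Context: Weak Hopf algebra: a finite-dimensional unital algebra $\mathcal{A}$ with coassociative counital coproduct $\Delta$ (Sweedler notation), counit $\epsilon$, $\Delta(xy)=\Delta(x)\Delta(y)$, $\Delta^2(1)=(1\otimes\Delta(1))(\Delta(1)\otimes1)=(\Delta(1)\otimes1)(1\otimes\Delta(1))$, $\epsilon(xyz)=\sum\epsilon(xy_{(1)})\epsilon(y_{(2)}z)=\sum\epsilon(xy_{(2)})\epsilon(y_{(1)}z)$, and antipode $S$ with $\sum S(x_{(1)})x_{(2)}=\sum 1_{(1)}\epsilon(x1_{(2)})$, $\sum x_{(1)}S(x_{(2)})=\sum\epsilon(1_{(1)}x)1_{(2)}$, $\sum S(x_{(1)})x_{(2)}S(x_{(3)})=S(x)$. $\Delta^2_{\mathrm{op}}(x)=\sum x_{(3)}\otimes x_{(2)}\otimes x_{(1)}$. The dual $\mathcal{A}^*$ is a weak Hopf algebra with product $(fg)(x)=\sum f(x_{(1)})g(x_{(2)})$, unit $\epsilon$, coproduct $\Delta(f)(x\otimes y)=f(xy)$, antipode $S(f)=f\circ S$. Non-degenerate: $\{(f\otimes\mathrm{Id})\Delta(x)\}=\{(\mathrm{Id}\otimes f)\Delta(x)\}=\mathcal{A}$. For $a\in\mathrm{Irr}(\mathcal{A}^* )$ fix irreps $\psi_a:\mathcal{A}^*\to\mathrm{End}(W_a)$. $N_{ab}^c$ = multiplicity of $\psi_c$ in $f\mapsto(\psi_a\otimes\psi_b)(\Delta f)$ restricted to the range of $(\psi_a\otimes\psi_b)(\Delta\epsilon)$;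 fusion tensors $V^{c\mu}_{ab},W^{c\mu}_{ab}$ with $(\psi_a\otimes\psi_b)(\Delta f)=\sum_{c,\mu}V^{c\mu}_{ab}\psi_c(f)W^{c\mu}_{ab}$, $W^{c\mu}_{ab}V^{d\nu}_{ab}=\delta_{cd}\delta_{\mu\nu}\mathrm{id}$. Vacuum: $b_a$ with $f(1)=\sum_a\mathrm{Tr}(b_a\psi_a(f))$, $E=\{a:b_a\ne0\}$, $b_e=v_eu_e$ rank one ($v_e\in W_e,u_e\in W_e^*$); unique $l_a,r_a\in E$ with $N_{ea}^b=\delta_{e,l_a}\delta_{ab}$, $N_{ae}^b=\delta_{e,r_a}\delta_{ab}$. Conjugation: $\bar a$ = class of $f\mapsto\psi_a(Sf)^T$ on $W_a^*$; invertible $Z_a:W_{\bar a}\to W_a^*$ with $\psi_a(Sf)^T=Z_a\psi_{\bar a}(f)Z_a^{-1}$; $w_c\neq0$ defined by $\zeta_c\otimes\theta_c=w_c(u_{r_c}\circ W^{r_c}_{\bar cc})\otimes(V^{r_c}_{\bar cc}v_{r_c})$ where $\zeta_c(\xi\otimes\eta)=(Z_c\xi)(\eta)$ and $(\varphi\otimes\mathrm{id})\theta_c=Z_{\bar c}^{-1}(\varphi)$; $d_a^2=w_aw_{\bar a}$, $d_a=d_{\bar a}$; $g\in\mathcal{A}^*$ with $\psi_a(g)=\frac{d_a}{w_{\bar a}}(Z_a^{-1})^TZ_{\bar a}$. Spherical: $k\in\mathcal{A}^*$ is pivotal if it is invertible, group-like ($\Delta(k)=(k\otimes k)\Delta(\epsilon)=\Delta(\epsilon)(k\otimes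 k)$) and $S^2(f)=kfk^{-1}$ for all $f$. $\mathcal{A}^*$ is spherical with spherical element $k$ if $u_e(v_e)\neq0$ for all $e\in E$ (this is the counit of $\mathcal{A}^*$ evaluated on the central projector onto block $e$), and $k$ is pivotal with $\frac{\mathrm{Tr}\,\psi_a(k)}{u_{l_a}(v_{l_a})}=\frac{\mathrm{Tr}\,\psi_a(k^{-1})}{u_{r_a}(v_{r_a})}$ for all $a\in\mathrm{Irr}(\mathcal{A}^* )$. *)

theory Defs
  imports "Jordan_Normal_Form.Matrix"
begin

text \<open>The weak Hopf algebra A is C^'i for a finite basis type 'i; an element of A is a
coordinate function 'i => complex (x = sum_i x i e_i).  A tensor in A (x) A is a function
on 'i * 'i, a tensor in A (x) A (x) A a function on 'i * 'i * 'i.  The structure maps are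
given by structure constants:
  e_i e_j = sum_k mu i j k e_k,   1 = sum_i un i e_i,
  Delta(e_i) = sum_(a,b) de i a b e_a (x) e_b,  eps(e_i) = ep i,  S(e_i) = sum_j an i j e_j.
An element f of the dual A* is also a function 'i => complex, namely f i = f(e_i).\<close>

record 'i wha =
  mu :: "'i \<Rightarrow> 'i \<Rightarrow> 'i \<Rightarrow> complex"
  un :: "'i \<Rightarrow> complex"
  de :: "'i \<Rightarrow> 'i \<Rightarrow> 'i \<Rightarrow> complex"
  ep :: "'i \<Rightarrow> complex"
  an :: "'i \<Rightarrow> 'i \<Rightarrow> complex"

definition bas :: "'i \<Rightarrow> 'i \<Rightarrow> complex" where
  "bas i = (\<lambda>j. if j = i then 1 else 0)"

definition tn :: "('i \<Rightarrow> complex) \<Rightarrow> ('i \<Rightarrow> complex) \<Rightarrow> ('i \<times> 'i \<Rightarrow> complex)" where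
  "tn x y = (\<lambda>(a, b). x a * y b)"

definition mul :: "('i::finite) wha \<Rightarrow> ('i \<Rightarrow> complex) \<Rightarrow> ('i \<Rightarrow> complex) \<Rightarrow> ('i \<Rightarrow> complex)" where
  "mul H x y = (\<lambda>k. \<Sum>i\<in>UNIV. \<Sum>j\<in>UNIV. x i * y j * mu H i j k)"

definition cop :: "('i::finite) wha \<Rightarrow> ('i \<Rightarrow> complex) \<Rightarrow> ('i \<times> 'i \<Rightarrow> complex)" where
  "cop H x = (\<lambda>(a, b). \<Sum>i\<in>UNIV. x i * de H i a b)"

definition cou :: "('i::finite) wha \<Rightarrow> ('i \<Rightarrow> complex) \<Rightarrow> complex" where
  "cou H x = (\<Sum>i\<in>UNIV. x i * ep H i)"

definition ant :: "('i::finite) wha \<Rightarrow> ('i \<Rightarrow> complex) \<Rightarrow> ('i \<Rightarrow> complex)" where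
  "ant H x = (\<lambda>j. \<Sum>i\<in>UNIV. x i * an H i j)"

definition cop_l :: "('i::finite) wha \<Rightarrow> ('i \<times> 'i \<Rightarrow> complex) \<Rightarrow> ('i \<times> 'i \<times> 'i \<Rightarrow> complex)" where
  "cop_l H X = (\<lambda>(a, b, c). \<Sum>i\<in>UNIV. X (i, c) * de H i a b)"

definition cop_r :: "('i::finite) wha \<Rightarrow> ('i \<times> 'i \<Rightarrow> complex) \<Rightarrow> ('i \<times> 'i \<times> 'i \<Rightarrow> complex)" where
  "cop_r H X = (\<lambda>(a, b, c). \<Sum>j\<in>UNIV. X (a, j) * de H j b c)"

definition cop2 :: "('i::finite) wha \<Rightarrow> ('i \<Rightarrow> complex) \<Rightarrow> ('i \<times> 'i \<times> 'i \<Rightarrow> complex)" where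
  "cop2 H x = cop_l H (cop H x)"

definition mul2 :: "('i::finite) wha \<Rightarrow> ('i \<times> 'i \<Rightarrow> complex) \<Rightarrow> ('i \<times> 'i \<Rightarrow> complex) \<Rightarrow> ('i \<times> 'i \<Rightarrow> complex)" where
  "mul2 H X Y = (\<lambda>(k, l). \<Sum>i\<in>UNIV. \<Sum>j\<in>UNIV. \<Sum>i'\<in>UNIV. \<Sum>j'\<in>UNIV.
      X (i, j) * Y (i', j') * mu H i i' k * mu H j j' l)"

definition mul3 :: "('i::finite) wha \<Rightarrow> ('i \<times> 'i \<times> 'i \<Rightarrow> complex) \<Rightarrow> ('i \<times> 'i \<times> 'i \<Rightarrow> complex)
     \<Rightarrow> ('i \<times> 'i \<times> 'i \<Rightarrow> complex)" where
  "mul3 H X Y = (\<lambda>(k, l, m). \<Sum>i\<in>UNIV. \<Sum>j\<in>UNIV. \<Sum>h\<in>UNIV. \<Sum>i'\<in>UNIV. \<Sum>j'\<in>UNIV. \<Sum>h'\<in>UNIV.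
      X (i, j, h) * Y (i', j', h') * mu H i i' k * mu H j j' l * mu H h h' m)"

definition tn_1X :: "('i \<Rightarrow> complex) \<Rightarrow> ('i \<times> 'i \<Rightarrow> complex) \<Rightarrow> ('i \<times> 'i \<times> 'i \<Rightarrow> complex)" where
  "tn_1X x Y = (\<lambda>(a, b, c). x a * Y (b, c))"

definition tn_X1 :: "('i \<times> 'i \<Rightarrow> complex) \<Rightarrow> ('i \<Rightarrow> complex) \<Rightarrow> ('i \<times> 'i \<times> 'i \<Rightarrow> complex)" where
  "tn_X1 X y = (\<lambda>(a, b, c). X (a, b) * y c)"

definition weak_hopf_algebra :: "('i::finite) wha \<Rightarrow> bool" where
  "weak_hopf_algebra H \<longleftrightarrow>
     (\<forall>x y z. mul H (mul H x y) z = mul H x (mul H y z)) \<and>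
     (\<forall>x. mul H (un H) x = x \<and> mul H x (un H) = x) \<and>
     (\<forall>x. cop_l H (cop H x) = cop_r H (cop H x)) \<and>
     (\<forall>x. (\<lambda>b. \<Sum>a\<in>UNIV. ep H a * cop H x (a, b)) = x \<and>
          (\<lambda>a. \<Sum>b\<in>UNIV. cop H x (a, b) * ep H b) = x) \<and>
     (\<forall>x y. cop H (mul H x y) = mul2 H (cop H x) (cop H y)) \<and>
     (cop2 H (un H) = mul3 H (tn_1X (un H) (cop H (un H))) (tn_X1 (cop H (un H)) (un H)) \<and>
      cop2 H (un H) = mul3 H (tn_X1 (cop H (un H)) (un H)) (tn_1X (un H) (cop H (un H)))) \<and>
     (\<forall>x y z. cou H (mul H (mul H x y) z) =
          (\<Sum>i\<in>UNIV. \<Sum>j\<in>UNIV. cop H y (i, j) * cou H (mul H x (bas i)) * cou H (mul H (bas j) z)) \<and>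
        cou H (mul H (mul H x y) z) =
          (\<Sum>i\<in>UNIV. \<Sum>j\<in>UNIV. cop H y (i, j) * cou H (mul H x (bas j)) * cou H (mul H (bas i) z))) \<and>
     (\<forall>x. (\<lambda>k. \<Sum>i\<in>UNIV. \<Sum>j\<in>UNIV. cop H x (i, j) * mul H (ant H (bas i)) (bas j) k) =
          (\<lambda>k. \<Sum>i\<in>UNIV. \<Sum>j\<in>UNIV. cop H (un H) (i, j) * cou H (mul H x (bas j)) * bas i k)) \<and>
     (\<forall>x. (\<lambda>k. \<Sum>i\<in>UNIV. \<Sum>j\<in>UNIV. cop H x (i, j) * mul H (bas i) (ant H (bas j)) k) =
          (\<lambda>k. \<Sum>i\<in>UNIV. \<Sum>j\<in>UNIV. cop H (un H) (i, j) * cou H (mul H (bas i) x) * bas j k)) \<and>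
     (\<forall>x. (\<lambda>k. \<Sum>i\<in>UNIV. \<Sum>j\<in>UNIV. \<Sum>h\<in>UNIV. cop2 H x (i, j, h) *
              mul H (mul H (ant H (bas i)) (bas j)) (ant H (bas h)) k) = ant H x)"

text \<open>(f g)(x) = sum f(x_(1)) g(x_(2)); unit eps; S(f) = f o S;
 Delta(f)(x (x) y) = f(x y), an element of A* (x) A* viewed as a functional on A (x) A.\<close>

definition dmul :: "('i::finite) wha \<Rightarrow> ('i \<Rightarrow> complex) \<Rightarrow> ('i \<Rightarrow> complex) \<Rightarrow> ('i \<Rightarrow> complex)" where
  "dmul H f g = (\<lambda>i. \<Sum>a\<in>UNIV. \<Sum>b\<in>UNIV. de H i a b * f a * g b)"

definition dant :: "('i::finite) wha \<Rightarrow> ('i \<Rightarrow> complex) \<Rightarrow> ('i \<Rightarrow> complex)" where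
  "dant H f = (\<lambda>i. \<Sum>j\<in>UNIV. an H i j * f j)"

definition dcop :: "('i::finite) wha \<Rightarrow> ('i \<Rightarrow> complex) \<Rightarrow> ('i \<times> 'i \<Rightarrow> complex)" where
  "dcop H f = (\<lambda>(i, j). \<Sum>k\<in>UNIV. mu H i j k * f k)"

definition dmul2 :: "('i::finite) wha \<Rightarrow> ('i \<times> 'i \<Rightarrow> complex) \<Rightarrow> ('i \<times> 'i \<Rightarrow> complex) \<Rightarrow> ('i \<times> 'i \<Rightarrow> complex)" where
  "dmul2 H F G = (\<lambda>(i, j). \<Sum>a\<in>UNIV. \<Sum>b\<in>UNIV. \<Sum>c\<in>UNIV. \<Sum>d\<in>UNIV.
      de H i a b * de H j c d * F (a, c) * G (b, d))"

definition dinvertible :: "('i::finite) wha \<Rightarrow> ('i \<Rightarrow> complex) \<Rightarrow> bool" where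
  "dinvertible H k \<longleftrightarrow> (\<exists>h. dmul H k h = ep H \<and> dmul H h k = ep H)"

definition dinv :: "('i::finite) wha \<Rightarrow> ('i \<Rightarrow> complex) \<Rightarrow> ('i \<Rightarrow> complex)" where
  "dinv H k = (THE h. dmul H k h = ep H \<and> dmul H h k = ep H)"

definition ev :: "('i::finite \<Rightarrow> complex) \<Rightarrow> ('i \<Rightarrow> complex) \<Rightarrow> complex" where
  "ev f x = (\<Sum>i\<in>UNIV. f i * x i)"

definition alg_ideal :: "(('i \<Rightarrow> complex) \<Rightarrow> ('i \<Rightarrow> complex) \<Rightarrow> ('i \<Rightarrow> complex)) \<Rightarrow> ('i \<Rightarrow> complex) set \<Rightarrow> bool" where
  "alg_ideal m I \<longleftrightarrow> (\<lambda>_. 0) \<in> I \<and> (\<forall>x\<in>I. \<forall>y\<in>I. (\<lambda>i. x i + y i) \<in> I) \<and>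
     (\<forall>c. \<forall>x\<in>I. (\<lambda>i. c * x i) \<in> I) \<and> (\<forall>x\<in>I. \<forall>y. m x y \<in> I \<and> m y x \<in> I)"

fun prodl :: "(('i \<Rightarrow> complex) \<Rightarrow> ('i \<Rightarrow> complex) \<Rightarrow> ('i \<Rightarrow> complex)) \<Rightarrow> ('i \<Rightarrow> complex) \<Rightarrow> ('i \<Rightarrow> complex) list \<Rightarrow> ('i \<Rightarrow> complex)" where
  "prodl m u [] = u"
| "prodl m u (x # xs) = m x (prodl m u xs)"

definition nilpotent_ideal :: "(('i \<Rightarrow> complex) \<Rightarrow> ('i \<Rightarrow> complex) \<Rightarrow> ('i \<Rightarrow> complex)) \<Rightarrow> ('i \<Rightarrow> complex) \<Rightarrow> ('i \<Rightarrow> complex) set \<Rightarrow> bool" where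
  "nilpotent_ideal m u I \<longleftrightarrow> (\<exists>n>0. \<forall>xs. length xs = n \<and> set xs \<subseteq> I \<longrightarrow> prodl m u xs = (\<lambda>_. 0))"

definition semisimple_alg :: "(('i \<Rightarrow> complex) \<Rightarrow> ('i \<Rightarrow> complex) \<Rightarrow> ('i \<Rightarrow> complex)) \<Rightarrow> ('i \<Rightarrow> complex) \<Rightarrow> bool" where
  "semisimple_alg m u \<longleftrightarrow> (\<forall>I. alg_ideal m I \<and> nilpotent_ideal m u I \<longrightarrow> I = {\<lambda>_. 0})"

definition dual_semisimple :: "('i::finite) wha \<Rightarrow> bool" where
  "dual_semisimple H \<longleftrightarrow> semisimple_alg (dmul H) (ep H)"

definition mtrace :: "complex mat \<Rightarrow> complex" where
  "mtrace A = (\<Sum>i<dim_row A. A $$ (i, i))"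

definition minv :: "complex mat \<Rightarrow> complex mat" where
  "minv A = (THE B. B \<in> carrier_mat (dim_col A) (dim_row A) \<and> A * B = 1\<^sub>m (dim_row A) \<and> B * A = 1\<^sub>m (dim_col A))"

text \<open>Kronecker product; index (p, q) of W_a (x) W_b is p * dim W_b + q.\<close>
definition kron :: "complex mat \<Rightarrow> complex mat \<Rightarrow> complex mat" where
  "kron A B = mat (dim_row A * dim_row B) (dim_col A * dim_col B)
     (\<lambda>(r, s). A $$ (r div dim_row B, s div dim_col B) * B $$ (r mod dim_row B, s mod dim_col B))"

definition outer :: "complex vec \<Rightarrow> complex vec \<Rightarrow> complex mat" where
  "outer v u = mat (dim_vec v) (dim_vec u) (\<lambda>(r, s). v $ r * u $ s)"

definition is_rep :: "('i::finite) wha \<Rightarrow> nat \<Rightarrow> (('i \<Rightarrow> complex) \<Rightarrow> complex mat) \<Rightarrow> bool" where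
  "is_rep H n \<rho> \<longleftrightarrow> (\<forall>f. \<rho> f \<in> carrier_mat n n) \<and>
     (\<forall>f g. \<rho> (\<lambda>i. f i + g i) = \<rho> f + \<rho> g) \<and>
     (\<forall>c f. \<rho> (\<lambda>i. c * f i) = c \<cdot>\<^sub>m \<rho> f) \<and>
     (\<forall>f g. \<rho> (dmul H f g) = \<rho> f * \<rho> g) \<and>
     \<rho> (ep H) = 1\<^sub>m n"

definition irreducible_rep :: "nat \<Rightarrow> (('i \<Rightarrow> complex) \<Rightarrow> complex mat) \<Rightarrow> bool" where
  "irreducible_rep n \<rho> \<longleftrightarrow> n > 0 \<and>
     (\<forall>U \<subseteq> carrier_vec n.
        (0\<^sub>v n \<in> U \<and> (\<forall>x\<in>U. \<forall>y\<in>U. x + y \<in> U) \<and> (\<forall>c. \<forall>x\<in>U. c \<cdot>\<^sub>v x \<in> U) \<and>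
         (\<forall>f. \<forall>x\<in>U. \<rho> f *\<^sub>v x \<in> U))
        \<longrightarrow> U = {0\<^sub>v n} \<or> U = carrier_vec n)"

definition iso_rep :: "nat \<Rightarrow> (('i \<Rightarrow> complex) \<Rightarrow> complex mat) \<Rightarrow> nat \<Rightarrow> (('i \<Rightarrow> complex) \<Rightarrow> complex mat) \<Rightarrow> bool" where
  "iso_rep n \<rho> m \<sigma> \<longleftrightarrow> n = m \<and> (\<exists>P \<in> carrier_mat n n. invertible_mat P \<and> (\<forall>f. \<rho> f * P = P * \<sigma> f))"

text \<open>psi_a (a :: 'r) is a complete family of pairwise non-isomorphic irreducible
 representations of A*, psi_a acting on W_a = C^(nd a); so 'r plays the role of Irr(A*).\<close>
definition irreps :: "('i::finite) wha \<Rightarrow> ('r \<Rightarrow> nat) \<Rightarrow> ('r \<Rightarrow> ('i \<Rightarrow> complex) \<Rightarrow> complex mat) \<Rightarrow> bool" where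
  "irreps H nd \<psi> \<longleftrightarrow>
     (\<forall>a. is_rep H (nd a) (\<psi> a) \<and> irreducible_rep (nd a) (\<psi> a)) \<and>
     (\<forall>a b. iso_rep (nd a) (\<psi> a) (nd b) (\<psi> b) \<longrightarrow> a = b) \<and>
     (\<forall>n \<rho>. is_rep H n \<rho> \<and> irreducible_rep n \<rho> \<longrightarrow> (\<exists>a. iso_rep n \<rho> (nd a) (\<psi> a)))"

definition tens_rep :: "('i::finite) wha \<Rightarrow> ('r \<Rightarrow> nat) \<Rightarrow> ('r \<Rightarrow> ('i \<Rightarrow> complex) \<Rightarrow> complex mat)
     \<Rightarrow> 'r \<Rightarrow> 'r \<Rightarrow> ('i \<Rightarrow> complex) \<Rightarrow> complex mat" where
  "tens_rep H nd \<psi> a b f = mat (nd a * nd b) (nd a * nd b)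
     (\<lambda>(r, s). \<Sum>i\<in>UNIV. \<Sum>j\<in>UNIV. dcop H f (i, j) * kron (\<psi> a (bas i)) (\<psi> b (bas j)) $$ (r, s))"

definition fusion :: "('i::finite) wha \<Rightarrow> ('r::finite \<Rightarrow> nat) \<Rightarrow> ('r \<Rightarrow> ('i \<Rightarrow> complex) \<Rightarrow> complex mat)
     \<Rightarrow> ('r \<Rightarrow> 'r \<Rightarrow> 'r \<Rightarrow> nat) \<Rightarrow> ('r \<Rightarrow> 'r \<Rightarrow> 'r \<Rightarrow> nat \<Rightarrow> complex mat) \<Rightarrow> ('r \<Rightarrow> 'r \<Rightarrow> 'r \<Rightarrow> nat \<Rightarrow> complex mat) \<Rightarrow> bool" where
  "fusion H nd \<psi> N V W \<longleftrightarrow> (\<forall>a b.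
     (\<forall>c \<mu>. \<mu> < N a b c \<longrightarrow> V a b c \<mu> \<in> carrier_mat (nd a * nd b) (nd c) \<and>
                            W a b c \<mu> \<in> carrier_mat (nd c) (nd a * nd b)) \<and>
     (\<forall>f. tens_rep H nd \<psi> a b f = mat (nd a * nd b) (nd a * nd b)
          (\<lambda>(r, s). \<Sum>c\<in>UNIV. \<Sum>\<mu><N a b c. (V a b c \<mu> * \<psi> c f * W a b c \<mu>) $$ (r, s))) \<and>
     (\<forall>c \<mu> d \<nu>. \<mu> < N a b c \<longrightarrow> \<nu> < N a b d \<longrightarrow>
          W a b c \<mu> * V a b d \<nu> = (if c = d \<and> \<mu> = \<nu> then 1\<^sub>m (nd c) else 0\<^sub>m (nd c) (nd d))))"

definition vacuum :: "('i::finite) wha \<Rightarrow> ('r::finite \<Rightarrow> nat) \<Rightarrow> ('r \<Rightarrow> ('i \<Rightarrow> complex) \<Rightarrow> complex mat)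
     \<Rightarrow> ('r \<Rightarrow> complex mat) \<Rightarrow> bool" where
  "vacuum H nd \<psi> b \<longleftrightarrow> (\<forall>a. b a \<in> carrier_mat (nd a) (nd a)) \<and>
     (\<forall>f. ev f (un H) = (\<Sum>a\<in>UNIV. mtrace (b a * \<psi> a f)))"

definition vacE :: "('r \<Rightarrow> nat) \<Rightarrow> ('r \<Rightarrow> complex mat) \<Rightarrow> 'r set" where
  "vacE nd b = {a. b a \<noteq> 0\<^sub>m (nd a) (nd a)}"

definition vac_vectors :: "('r \<Rightarrow> nat) \<Rightarrow> ('r \<Rightarrow> complex mat) \<Rightarrow> ('r \<Rightarrow> complex vec) \<Rightarrow> ('r \<Rightarrow> complex vec) \<Rightarrow> bool" where
  "vac_vectors nd b u v \<longleftrightarrow> (\<forall>e \<in> vacE nd b. v e \<in> carrier_vec (nd e) \<and> u e \<in> carrier_vec (nd e) \<and>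
     b e = outer (v e) (u e))"

definition left_right :: "('r \<Rightarrow> nat) \<Rightarrow> ('r \<Rightarrow> complex mat) \<Rightarrow> ('r \<Rightarrow> 'r \<Rightarrow> 'r \<Rightarrow> nat) \<Rightarrow> ('r \<Rightarrow> 'r) \<Rightarrow> ('r \<Rightarrow> 'r) \<Rightarrow> bool" where
  "left_right nd b N l r \<longleftrightarrow> (\<forall>a. l a \<in> vacE nd b \<and> r a \<in> vacE nd b \<and>
     (\<forall>e \<in> vacE nd b. \<forall>c. N e a c = (if e = l a \<and> a = c then 1 else 0) \<and>
                          N a e c = (if e = r a \<and> a = c then 1 else 0)))"

text \<open>Conjugation: psi_a(S f)^T = Z_a psi_(bar a)(f) Z_a^(-1), Z_a : W_(bar a) -> W_a^* invertible
 (matrices w.r.t. the standard basis of W_(bar a) and the dual basis of W_a^*).\<close>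
definition conjugation :: "('i::finite) wha \<Rightarrow> ('r \<Rightarrow> nat) \<Rightarrow> ('r \<Rightarrow> ('i \<Rightarrow> complex) \<Rightarrow> complex mat)
     \<Rightarrow> ('r \<Rightarrow> 'r) \<Rightarrow> ('r \<Rightarrow> complex mat) \<Rightarrow> bool" where
  "conjugation H nd \<psi> cb Z \<longleftrightarrow> (\<forall>a. Z a \<in> carrier_mat (nd a) (nd (cb a)) \<and> invertible_mat (Z a) \<and>
     (\<forall>f. transpose_mat (\<psi> a (dant H f)) = Z a * \<psi> (cb a) f * minv (Z a)))"

text \<open>w_c: zeta_c (x) theta_c = w_c (u_(r_c) o W^(r_c)_(bar c c)) (x) (V^(r_c)_(bar c c) v_(r_c)),
 where zeta_c(xi (x) eta) = (Z_c xi)(eta) and (phi (x) id) theta_c = Z_(bar c)^(-1)(phi).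
 Tensors in W_(bar c) (x) W_c are indexed by t = p * nd c + q.  (Here N_(bar c c)^(r_c) = 1, so
 the multiplicity index is 0.)\<close>
definition wdata :: "('r \<Rightarrow> nat) \<Rightarrow> ('r \<Rightarrow> 'r) \<Rightarrow> ('r \<Rightarrow> complex mat) \<Rightarrow> ('r \<Rightarrow> 'r)
     \<Rightarrow> ('r \<Rightarrow> 'r \<Rightarrow> 'r \<Rightarrow> nat \<Rightarrow> complex mat) \<Rightarrow> ('r \<Rightarrow> 'r \<Rightarrow> 'r \<Rightarrow> nat \<Rightarrow> complex mat)
     \<Rightarrow> ('r \<Rightarrow> complex vec) \<Rightarrow> ('r \<Rightarrow> complex vec) \<Rightarrow> ('r \<Rightarrow> complex) \<Rightarrow> bool" where
  "wdata nd cb Z r V W u v w \<longleftrightarrow> (\<forall>c. w c \<noteq> 0 \<and>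
     (let n = nd c; M = nd (cb c) * nd c;
          zeta = (\<lambda>t. Z c $$ (t mod n, t div n));
          theta = (\<lambda>t. minv (Z (cb c)) $$ (t mod n, t div n));
          uW = transpose_mat (W (cb c) c (r c) 0) *\<^sub>v u (r c);
          Vv = V (cb c) c (r c) 0 *\<^sub>v v (r c)
      in \<forall>t<M. \<forall>t'<M. zeta t * theta t' = w c * (uW $ t) * (Vv $ t')))"

definition ddata :: "('r \<Rightarrow> 'r) \<Rightarrow> ('r \<Rightarrow> complex) \<Rightarrow> ('r \<Rightarrow> complex) \<Rightarrow> bool" where
  "ddata cb w d \<longleftrightarrow> (\<forall>a. (d a)\<^sup>2 = w a * w (cb a) \<and> d a = d (cb a))"

definition gdata :: "('r \<Rightarrow> ('i \<Rightarrow> complex) \<Rightarrow> complex mat) \<Rightarrow> ('r \<Rightarrow> 'r) \<Rightarrow> ('r \<Rightarrow> complex mat)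
     \<Rightarrow> ('r \<Rightarrow> complex) \<Rightarrow> ('r \<Rightarrow> complex) \<Rightarrow> ('i \<Rightarrow> complex) \<Rightarrow> bool" where
  "gdata \<psi> cb Z w d g \<longleftrightarrow> (\<forall>a. \<psi> a g = (d a / w (cb a)) \<cdot>\<^sub>m (transpose_mat (minv (Z a)) * Z (cb a)))"

definition group_like :: "('i::finite) wha \<Rightarrow> ('i \<Rightarrow> complex) \<Rightarrow> bool" where
  "group_like H k \<longleftrightarrow> dcop H k = dmul2 H (tn k k) (dcop H (ep H)) \<and>
                      dcop H k = dmul2 H (dcop H (ep H)) (tn k k)"

definition pivotal :: "('i::finite) wha \<Rightarrow> ('i \<Rightarrow> complex) \<Rightarrow> bool" where
  "pivotal H k \<longleftrightarrow> dinvertible H k \<and> group_like H k \<and>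
     (\<forall>f. dant H (dant H f) = dmul H (dmul H k f) (dinv H k))"

definition spherical_element :: "('i::finite) wha \<Rightarrow> ('r \<Rightarrow> nat) \<Rightarrow> ('r \<Rightarrow> ('i \<Rightarrow> complex) \<Rightarrow> complex mat)
     \<Rightarrow> ('r \<Rightarrow> complex mat) \<Rightarrow> ('r \<Rightarrow> complex vec) \<Rightarrow> ('r \<Rightarrow> complex vec) \<Rightarrow> ('r \<Rightarrow> 'r) \<Rightarrow> ('r \<Rightarrow> 'r)
     \<Rightarrow> ('i \<Rightarrow> complex) \<Rightarrow> bool" where
  "spherical_element H nd \<psi> b u v l r k \<longleftrightarrow>
     (\<forall>e \<in> vacE nd b. u e \<bullet> v e \<noteq> 0) \<and> pivotal H k \<and>
     (\<forall>a. mtrace (\<psi> a k) / (u (l a) \<bullet> v (l a)) = mtrace (\<psi> a (dinv H k)) / (u (r a) \<bullet> v (r a)))"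

definition nondegenerate :: "('i::finite) wha \<Rightarrow> ('i \<Rightarrow> complex) \<Rightarrow> bool" where
  "nondegenerate H x \<longleftrightarrow>
     range (\<lambda>f. (\<lambda>b. \<Sum>a\<in>UNIV. f a * cop H x (a, b))) = UNIV \<and>
     range (\<lambda>f. (\<lambda>a. \<Sum>b\<in>UNIV. cop H x (a, b) * f b)) = UNIV"

definition cocommutative :: "('i::finite) wha \<Rightarrow> ('i \<Rightarrow> complex) \<Rightarrow> bool" where
  "cocommutative H x \<longleftrightarrow> cop H x = (\<lambda>(a, b). cop H x (b, a))"

definition clinear :: "(('i \<Rightarrow> complex) \<Rightarrow> ('i \<Rightarrow> complex)) \<Rightarrow> bool" where
  "clinear T \<longleftrightarrow> (\<forall>x y. T (\<lambda>i. x i + y i) = (\<lambda>i. T x i + T y i)) \<and>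
                  (\<forall>c x. T (\<lambda>i. c * x i) = (\<lambda>i. c * T x i))"

definition Omega_el :: "('r::finite \<Rightarrow> ('i \<Rightarrow> complex) \<Rightarrow> complex mat) \<Rightarrow> ('r \<Rightarrow> 'r) \<Rightarrow> ('r \<Rightarrow> complex)
     \<Rightarrow> ('r \<Rightarrow> complex) \<Rightarrow> ('i \<Rightarrow> complex)" where
  "Omega_el \<psi> l d \<xi> = (\<lambda>i. \<Sum>a\<in>UNIV. (1 / (\<Sum>x\<in>{x. l x = l a}. (d x)\<^sup>2)) * (d a / \<xi> a) * mtrace (\<psi> a (bas i)))"

end

theory Submission
  imports Defs "HOL-Library.Function_Algebras" "Jordan_Normal_Form.Spectral_Radius"
begin

text \<open>Write $B = A^*$ and $p_a = \mathrm{Tr}\,\psi_a(k) / u_{l_a}(v_{l_a})$. Contracting the tensors that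
define $w_a$ gives $p_a = \xi_a d_a = d_a / \xi_a$, so $\Omega$ is the combination of the characters
of $B$ with coefficients $p_a / \sum_{l_x = l_a} p_x^2$.

The functional $f \mapsto \mathrm{Tr}(x \mapsto f S^2(x) h)$ on $B$ is a left integral of $A$ for every $h$ in
the source subalgebra of $B$. Since $S^2$ is conjugation by $k$, it equals
$\sum_a \mathrm{Tr}\,\psi_a(fk)\, \mathrm{Tr}\,\psi_a(k^{-1}h)$; hence every functional
$\sum_a \gamma_{r_a} p_a \mathrm{Tr}\,\psi_a(fk)$ is a left integral. Multiplying it by characters yields
$\sum_c N_{ac}^b p_c = p_a p_b$ for $l_a = l_b$, and the trace of $\Delta(k)$ yields
$\sum_b N_{ac}^b p_b = p_a p_c$ for $r_a = l_c$. As the fusion matrices are real, pairing the vector $p$ with its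
conjugate shows that all $p_a$ are real and that $\sum_{l_x = e} p_x^2$ is positive and takes
the same value at $e = l_a$ and $e = r_a$. So $f \mapsto f(\Omega)$, composed with right multiplication by
$k$, is one of these integrals, normalised to be the counit on the target subalgebra. Idempotence and the
pulling-through identity with $T(x)(f) = x(S(f)k)$ are the standard properties of such an integral.\<close>

section \<open>Multilinear functionals and Sweedler sums\<close>

text \<open>The trace construction yields integrals weighted by an arbitrary function of r_a, while
  Omega is normalised by sums indexed by l_a; equality of these sums at l_a and r_a reconciles the
  two. That they are nonzero is a real obstacle: the p_a are complex numbers, so a sum of their
  squares could vanish until they are known to be real. The two forms of p_a come from the two
  traces in the sphericity condition. Contracting the tensors of bar a computes the trace of k as
  xi_a d_a u(v) at l_a; contracting those of a computes the trace of the inverse of k as (d_a /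
  xi_a) u(v) at r_a. Multiplying the two gives p_a^2 = d_a^2, which turns the denominators of Omega
  into sums of p_x^2. Semisimplicity is given as the absence of nonzero nilpotent ideals, so the
  block coordinates of B must be extracted from it: the irreducible representations are jointly
  faithful and their matrix coefficients are independent. The Hopf theory takes place in B as an
  abstract weak Hopf algebra; A reappears when functionals on B are read as elements of A.\<close>

definition lin :: "(('i::finite \<Rightarrow> complex) \<Rightarrow> complex) \<Rightarrow> bool" where
  "lin F \<longleftrightarrow> (\<forall>x. F x = (\<Sum>i\<in>UNIV. x i * F (bas i)))"

definition vlin :: "(('i::finite \<Rightarrow> complex) \<Rightarrow> ('j::finite \<Rightarrow> complex)) \<Rightarrow> bool" where
  "vlin g \<longleftrightarrow> (\<forall>j. lin (\<lambda>x. g x j))"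

definition bilin :: "(('i::finite \<Rightarrow> complex) \<Rightarrow> ('j::finite \<Rightarrow> complex) \<Rightarrow> complex) \<Rightarrow> bool" where
  "bilin F \<longleftrightarrow> (\<forall>y. lin (\<lambda>x. F x y)) \<and> (\<forall>x. lin (\<lambda>y. F x y))"

definition trilin :: "(('i::finite \<Rightarrow> complex) \<Rightarrow> ('i \<Rightarrow> complex) \<Rightarrow> ('i \<Rightarrow> complex) \<Rightarrow> complex) \<Rightarrow> bool" where
  "trilin F \<longleftrightarrow> (\<forall>y z. lin (\<lambda>x. F x y z)) \<and> (\<forall>x z. lin (\<lambda>y. F x y z)) \<and> (\<forall>x y. lin (\<lambda>z. F x y z))"

lemma linD: "lin F \<Longrightarrow> F x = (\<Sum>i\<in>UNIV. x i * F (bas i))"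
  unfolding lin_def by blast

lemma sum_bas [simp]: "(\<Sum>j\<in>UNIV. bas (i::'i::finite) j * f j) = f i"
  "(\<Sum>j\<in>UNIV. f j * bas i j) = f i"
  by (simp_all add: bas_def if_distrib[of "\<lambda>z. z * _"] if_distrib[of "\<lambda>z. _ * z"] sum.delta' cong: if_cong)

lemma sum_bas' [simp]: "(\<Sum>j\<in>UNIV. f j * bas j (i::'i::finite)) = f i"
  "(\<Sum>j\<in>UNIV. bas j i * f j) = f i"
  by (simp_all add: bas_def if_distrib[of "\<lambda>z. z * _"] if_distrib[of "\<lambda>z. _ * z"] sum.delta cong: if_cong)

lemma lin_coord: "lin (\<lambda>x. x i)"
  by (simp add: lin_def)

lemma lin_comp: "lin F \<Longrightarrow> vlin g \<Longrightarrow> lin (\<lambda>x. F (g x))"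
proof -
  assume F: "lin F" and g: "vlin g"
  show ?thesis unfolding lin_def
  proof
    fix x
    have "F (g x) = (\<Sum>i\<in>UNIV. (\<Sum>j\<in>UNIV. x j * g (bas j) i) * F (bas i))"
      unfolding linD[OF F, of "g x"] using linD g unfolding vlin_def by (intro sum.cong refl arg_cong[where f="\<lambda>z. z * _"]) blast
    also have "\<dots> = (\<Sum>j\<in>UNIV. x j * (\<Sum>i\<in>UNIV. g (bas j) i * F (bas i)))"
      by (simp add: sum_distrib_left sum_distrib_right mult.assoc) (rule sum.swap)
    finally show "F (g x) = (\<Sum>j\<in>UNIV. x j * F (g (bas j)))"
      by (simp flip: linD[OF F])
  qed
qed

lemma lin_add: "lin F \<Longrightarrow> F (\<lambda>i. x i + y i) = F x + F y"
  by (simp add: linD[of F "\<lambda>i. x i + y i"] linD[of F x] linD[of F y] sum.distrib distrib_right)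

lemma lin_scale: "lin F \<Longrightarrow> F (\<lambda>i. c * x i) = c * F x"
  by (simp add: linD[of F "\<lambda>i. c * x i"] linD[of F x] sum_distrib_left mult.assoc)

lemma lin_zero: "lin F \<Longrightarrow> F (\<lambda>_. 0) = 0"
  by (simp add: linD[of F "\<lambda>_. 0"])

lemma lin_sum: "lin F \<Longrightarrow> F (\<lambda>i. \<Sum>k\<in>K. x k i) = (\<Sum>k\<in>K. F (x k))"
proof -
  assume F: "lin F"
  have "F (\<lambda>i. \<Sum>k\<in>K. x k i) = (\<Sum>i\<in>UNIV. \<Sum>k\<in>K. x k i * F (bas i))"
    by (subst linD[OF F]) (simp add: sum_distrib_right)
  also have "\<dots> = (\<Sum>k\<in>K. F (x k))"
    by (subst sum.swap) (simp flip: linD[OF F])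
  finally show ?thesis .
qed

text \<open>Converse to \<open>lin_add\<close> and \<open>lin_scale\<close>: the basis expansion
  chosen as definition is ordinary linearity.\<close>

lemma linI:
  assumes "\<And>x y. F (\<lambda>i. x i + y i) = F x + F y" "\<And>c x. F (\<lambda>i. c * x i) = c * F x"
  shows "lin (F :: ('i::finite \<Rightarrow> complex) \<Rightarrow> complex)"
proof -
  have z: "F (\<lambda>i. 0) = 0" using assms(2)[of 0] by simp
  have s: "F (\<lambda>i. \<Sum>k\<in>K. x k * bas k i) = (\<Sum>k\<in>K. x k * F (bas k))" if "finite K" for K :: "'i set" and x
    using that by (induction K) (simp_all add: z assms)
  show ?thesis unfolding lin_def
  proof
    fix x
    have "F x = F (\<lambda>i. \<Sum>k\<in>UNIV. x k * bas k i)" by simp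
    also have "\<dots> = (\<Sum>k\<in>UNIV. x k * F (bas k))" by (rule s) simp
    finally show "F x = (\<Sum>k\<in>UNIV. x k * F (bas k))" .
  qed
qed

lemma lin_mult_left: "lin F \<Longrightarrow> lin (\<lambda>x. c * F x)"
  by (rule linI) (simp_all add: lin_add[of F] lin_scale[of F] algebra_simps)
lemma lin_mult_right: "lin F \<Longrightarrow> lin (\<lambda>x. F x * c)"
  by (rule linI) (simp_all add: lin_add[of F] lin_scale[of F] algebra_simps)
lemma lin_setsum: "(\<And>k. lin (\<lambda>x. F k x)) \<Longrightarrow> lin (\<lambda>x. \<Sum>k\<in>K. F k x)"
  by (rule linI) (simp_all add: lin_add[of "F _"] lin_scale[of "F _"] sum.distrib sum_distrib_left)
lemma lin_plus: "lin F \<Longrightarrow> lin G \<Longrightarrow> lin (\<lambda>x. F x + G x)"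
  by (rule linI) (simp_all add: lin_add[of F] lin_scale[of F] lin_add[of G] lin_scale[of G] algebra_simps)
lemma lin_id: "vlin (\<lambda>x. x)"
  by (simp add: vlin_def lin_coord)
lemma lin_const0: "lin (\<lambda>x. 0)"
  by (simp add: lin_def)

lemma vlinI: "(\<And>j. lin (\<lambda>x. g x j)) \<Longrightarrow> vlin g"
  by (simp add: vlin_def)

lemma bilinI: "(\<And>y. lin (\<lambda>x. F x y)) \<Longrightarrow> (\<And>x. lin (\<lambda>y. F x y)) \<Longrightarrow> bilin F"
  by (simp add: bilin_def)

lemma trilinI: "(\<And>y z. lin (\<lambda>x. F x y z)) \<Longrightarrow> (\<And>x z. lin (\<lambda>y. F x y z)) \<Longrightarrow>
    (\<And>x y. lin (\<lambda>z. F x y z)) \<Longrightarrow> trilin F"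
  by (simp add: trilin_def)

lemma lin_coord_comp: "vlin g \<Longrightarrow> lin (\<lambda>x. g x i)"
  by (simp add: vlin_def)

lemma bilin_comp: "bilin F \<Longrightarrow> vlin g \<Longrightarrow> lin (\<lambda>x. F (g x) y)"
  "bilin F \<Longrightarrow> vlin h \<Longrightarrow> lin (\<lambda>y. F x (h y))"
  unfolding bilin_def by (auto intro: lin_comp[of "\<lambda>x. F x y"] lin_comp[of "\<lambda>y. F x y"])

text \<open>Coordinates are among the linear functionals. This converts scalar Sweedler identities
  into equations between elements.\<close>

lemma lin_eqI:
  assumes "\<And>F. lin F \<Longrightarrow> F x = F y"
  shows "x = (y :: 'i::finite \<Rightarrow> complex)"
  using assms[OF lin_coord] by (rule ext)

text \<open>The Sweedler sum of $F(x_{(1)}, x_{(2)})$ for the coproduct $D$. Only scalar-valued $F$ occur: an identity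
between tensors is stated by applying an arbitrary multilinear functional to both sides.\<close>

definition swd :: "(('i::finite \<Rightarrow> complex) \<Rightarrow> 'i \<times> 'i \<Rightarrow> complex) \<Rightarrow> ('i \<Rightarrow> complex) \<Rightarrow>
   (('i \<Rightarrow> complex) \<Rightarrow> ('i \<Rightarrow> complex) \<Rightarrow> complex) \<Rightarrow> complex" where
  "swd D x F = (\<Sum>p\<in>UNIV. \<Sum>q\<in>UNIV. D x (p, q) * F (bas p) (bas q))"

lemma swd_cong: "(\<And>a b. F a b = G a b) \<Longrightarrow> swd D x F = swd D x G"
  by (simp add: swd_def)
lemma swd_mult_left: "swd D x (\<lambda>a b. c * F a b) = c * swd D x F"
  by (simp add: swd_def sum_distrib_left mult.left_commute)
lemma swd_mult_right: "swd D x (\<lambda>a b. F a b * c) = swd D x F * c"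
  by (simp add: swd_def sum_distrib_right mult.assoc)
lemma swd_sum: "swd D x (\<lambda>a b. \<Sum>k\<in>K. F k a b) = (\<Sum>k\<in>K. swd D x (F k))"
  unfolding swd_def sum_distrib_left by (simp add: sum.swap[of _ K])
lemma lin_swd: "(\<And>a b. lin (\<lambda>x. G x a b)) \<Longrightarrow> lin (\<lambda>x. swd D y (\<lambda>a b. G x a b))"
  unfolding swd_def by (intro lin_setsum lin_mult_left)

section \<open>Weak Hopf algebras\<close>

text \<open>Coassociativity holds for arbitrary $F$ because a Sweedler sum evaluates $F$ on basis vectors only; all
other axioms need linearity.\<close>

locale weak_hopf =
  fixes m :: "('i::finite \<Rightarrow> complex) \<Rightarrow> ('i \<Rightarrow> complex) \<Rightarrow> ('i \<Rightarrow> complex)" (infixl "\<odot>" 75)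
    and one :: "'i \<Rightarrow> complex"
    and D :: "('i \<Rightarrow> complex) \<Rightarrow> ('i \<times> 'i \<Rightarrow> complex)"
    and cu :: "('i \<Rightarrow> complex) \<Rightarrow> complex"
    and S :: "('i \<Rightarrow> complex) \<Rightarrow> ('i \<Rightarrow> complex)"
    and sw
  defines "sw \<equiv> swd D"
  assumes m_lin1: "vlin (\<lambda>x. x \<odot> y)" and m_lin2: "vlin (\<lambda>y. x \<odot> y)"
    and D_lin: "lin (\<lambda>x. D x pq)" and cu_lin: "lin cu" and S_lin: "vlin S"
    and m_assoc: "x \<odot> y \<odot> z = x \<odot> (y \<odot> z)"
    and one_left: "one \<odot> x = x" and one_right: "x \<odot> one = x"
    and coassoc: "sw x (\<lambda>a b. sw a (\<lambda>c d. F c d b)) = sw x (\<lambda>a b. sw b (\<lambda>c d. F a c d))"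
    and counit_left: "lin G \<Longrightarrow> sw x (\<lambda>a b. cu a * G b) = G x"
    and counit_right: "lin G \<Longrightarrow> sw x (\<lambda>a b. G a * cu b) = G x"
    and sw_m: "bilin K \<Longrightarrow> sw (x \<odot> y) K = sw x (\<lambda>a b. sw y (\<lambda>c d. K (a \<odot> c) (b \<odot> d)))"
    and sw_one1: "trilin F \<Longrightarrow> sw one (\<lambda>a b. sw b (\<lambda>c d. F a c d)) = sw one (\<lambda>a b. sw one (\<lambda>c d. F a (c \<odot> b) d))"
    and sw_one2: "trilin F \<Longrightarrow> sw one (\<lambda>a b. sw b (\<lambda>c d. F a c d)) = sw one (\<lambda>a b. sw one (\<lambda>c d. F a (b \<odot> c) d))"
    and cu3: "cu (x \<odot> y \<odot> z) = sw y (\<lambda>a b. cu (x \<odot> a) * cu (b \<odot> z))"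
    and cu3': "cu (x \<odot> y \<odot> z) = sw y (\<lambda>a b. cu (x \<odot> b) * cu (a \<odot> z))"
    and antipode_s: "lin G \<Longrightarrow> sw x (\<lambda>a b. G (S a \<odot> b)) = sw one (\<lambda>a b. G a * cu (x \<odot> b))"
    and antipode_t: "lin G \<Longrightarrow> sw x (\<lambda>a b. G (a \<odot> S b)) = sw one (\<lambda>a b. cu (a \<odot> x) * G b)"
    and antipode_S: "lin G \<Longrightarrow> sw x (\<lambda>a b. sw b (\<lambda>c d. G (S a \<odot> c \<odot> S d))) = G (S x)"
begin

lemma vlin_m1: "vlin g \<Longrightarrow> vlin (\<lambda>x. g x \<odot> y)"
  by (auto simp: vlin_def intro: lin_comp[OF lin_coord_comp[OF m_lin1], of g])
lemma vlin_m2: "vlin g \<Longrightarrow> vlin (\<lambda>x. y \<odot> g x)"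
  by (auto simp: vlin_def intro: lin_comp[OF lin_coord_comp[OF m_lin2], of g])
lemma vlin_S: "vlin g \<Longrightarrow> vlin (\<lambda>x. S (g x))"
  by (auto simp: vlin_def intro: lin_comp[OF lin_coord_comp[OF S_lin], of g])
lemma lin_cu: "vlin g \<Longrightarrow> lin (\<lambda>x. cu (g x))"
  by (rule lin_comp[OF cu_lin])
lemma lin_sw1: "vlin g \<Longrightarrow> lin (\<lambda>x. sw (g x) F)"
  unfolding sw_def swd_def
  by (intro lin_setsum lin_mult_right lin_comp[OF D_lin])
lemmas sw_cong = swd_cong[where D=D, folded sw_def]
lemmas sw_mult_left = swd_mult_left[where D=D, folded sw_def]
lemmas sw_mult_right = swd_mult_right[where D=D, folded sw_def]
lemmas sw_sum = swd_sum[where D=D, folded sw_def]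
lemmas lin_sw2 = lin_swd[where D=D, folded sw_def]

lemmas lins = lin_id lin_coord vlin_m1 vlin_m2 vlin_S lin_cu lin_sw1 lin_sw2 lin_mult_left lin_mult_right lin_setsum
  lin_const0 lin_plus

lemma sw_swap: "sw x (\<lambda>a b. sw y (\<lambda>c d. F a b c d)) = sw y (\<lambda>c d. sw x (\<lambda>a b. F a b c d))"
proof -
  have *: "sw z K = (\<Sum>pq\<in>UNIV. D z pq * K (bas (fst pq)) (bas (snd pq)))" for z K
    unfolding sw_def swd_def by (simp add: sum.cartesian_product split_def)
  show ?thesis unfolding * sum_distrib_left
    by (subst sum.swap) (simp add: mult.left_commute)
qed

text \<open>The target and source counital maps $\varepsilon_t$ and $\varepsilon_s$.\<close>

definition et :: "('i \<Rightarrow> complex) \<Rightarrow> ('i \<Rightarrow> complex)" where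
  "et x = (\<lambda>i. sw one (\<lambda>a b. cu (a \<odot> x) * b i))"
definition es :: "('i \<Rightarrow> complex) \<Rightarrow> ('i \<Rightarrow> complex)" where
  "es x = (\<lambda>i. sw one (\<lambda>a b. a i * cu (x \<odot> b)))"

text \<open>Elements given by a Sweedler sum are written coordinatewise; this lets a linear
  functional pass through the sum.\<close>

lemma lin_swv: "lin G \<Longrightarrow> G (\<lambda>i. sw x (\<lambda>a b. K a b * f a b i)) = sw x (\<lambda>a b. K a b * G (f a b))"
  unfolding sw_def swd_def by (simp add: lin_sum[of G] lin_scale[of G] mult.assoc[symmetric])

lemma lin_et: "lin G \<Longrightarrow> G (et x) = sw one (\<lambda>a b. cu (a \<odot> x) * G b)"
  unfolding et_def by (rule lin_swv)
lemma lin_es: "lin G \<Longrightarrow> G (es x) = sw one (\<lambda>a b. G a * cu (x \<odot> b))"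
  unfolding es_def using lin_swv[of G one "\<lambda>a b. cu (x \<odot> b)" "\<lambda>a b. a"] by (simp add: mult.commute)

lemma vlin_et: "vlin g \<Longrightarrow> vlin (\<lambda>x. et (g x))"
  unfolding et_def by (rule vlinI) (intro lins, assumption)
lemma vlin_es: "vlin g \<Longrightarrow> vlin (\<lambda>x. es (g x))"
  unfolding es_def by (rule vlinI) (intro lins, assumption)

lemmas lins' = bilinI trilinI lins vlin_et vlin_es

lemma sw_antipode_t: "lin G \<Longrightarrow> sw x (\<lambda>a b. G (a \<odot> S b)) = G (et x)"
  by (simp add: antipode_t lin_et)
lemma sw_antipode_s: "lin G \<Longrightarrow> sw x (\<lambda>a b. G (S a \<odot> b)) = G (es x)"
  by (simp add: antipode_s lin_es)

text \<open>Delta(1) need not be 1 (x) 1, but it is absorbed next to a coproduct; many calculations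
  below end with such an absorption.\<close>

lemma sw_one_mult_left:
  assumes K: "bilin K"
  shows "sw one (\<lambda>a b. sw x (\<lambda>c d. K (a \<odot> c) (b \<odot> d))) = sw x K"
  using sw_m[OF K, of one x] by (simp add: one_left)
lemma sw_one_mult_right:
  assumes K: "bilin K"
  shows "sw x (\<lambda>a b. sw one (\<lambda>c d. K (a \<odot> c) (b \<odot> d))) = sw x K"
  using sw_m[OF K, of x one] by (simp add: one_right)

text \<open>\<open>et y\<close> contracts the first leg of Delta(1) and leaves the second, so its
  coproduct can be read off from Delta^2(1). The two product orders in that axiom give the left and
  the right version.\<close>

lemma sw_et_left:
  assumes K: "bilin K"
  shows "sw (et y) K = sw one (\<lambda>a b. K (a \<odot> et y) b)"
proof -
  note kl = lins' bilin_comp[OF K]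
  have "sw (et y) K = sw one (\<lambda>a b. cu (a \<odot> y) * sw b K)"
    by (rule lin_et) (intro lins)
  also have "\<dots> = sw one (\<lambda>a b. sw b (\<lambda>c d. cu (a \<odot> y) * K c d))"
    by (simp add: sw_mult_left)
  also have "\<dots> = sw one (\<lambda>a b. sw one (\<lambda>c d. cu (a \<odot> y) * K (c \<odot> b) d))"
    by (rule sw_one1) (intro kl)
  also have "\<dots> = sw one (\<lambda>c d. sw one (\<lambda>a b. cu (a \<odot> y) * K (c \<odot> b) d))"
    by (rule sw_swap)
  also have "\<dots> = sw one (\<lambda>c d. K (c \<odot> et y) d)"
    by (intro sw_cong lin_et[symmetric] kl)
  finally show ?thesis .
qed

lemma sw_et_right:
  assumes K: "bilin K"
  shows "sw (et y) K = sw one (\<lambda>a b. K (et y \<odot> a) b)"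
proof -
  note kl = lins' bilin_comp[OF K]
  have "sw (et y) K = sw one (\<lambda>a b. cu (a \<odot> y) * sw b K)"
    by (rule lin_et) (intro lins)
  also have "\<dots> = sw one (\<lambda>a b. sw b (\<lambda>c d. cu (a \<odot> y) * K c d))"
    by (simp add: sw_mult_left)
  also have "\<dots> = sw one (\<lambda>a b. sw one (\<lambda>c d. cu (a \<odot> y) * K (b \<odot> c) d))"
    by (rule sw_one2) (intro kl)
  also have "\<dots> = sw one (\<lambda>c d. sw one (\<lambda>a b. cu (a \<odot> y) * K (b \<odot> c) d))"
    by (rule sw_swap)
  also have "\<dots> = sw one (\<lambda>c d. K (et y \<odot> c) d)"
    by (intro sw_cong lin_et[symmetric] kl)
  finally show ?thesis .
qed

lemma sw_es_left:
  assumes K: "bilin K"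
  shows "sw (es y) K = sw one (\<lambda>a b. K a (es y \<odot> b))"
proof -
  note kl = lins' bilin_comp[OF K]
  have "sw (es y) K = sw one (\<lambda>a b. sw a K * cu (y \<odot> b))"
    by (rule lin_es) (intro lins)
  also have "\<dots> = sw one (\<lambda>a b. sw a (\<lambda>c d. K c d * cu (y \<odot> b)))"
    by (simp add: sw_mult_right)
  also have "\<dots> = sw one (\<lambda>a b. sw b (\<lambda>c d. K a c * cu (y \<odot> d)))"
    by (rule coassoc)
  also have "\<dots> = sw one (\<lambda>a b. sw one (\<lambda>c d. K a (c \<odot> b) * cu (y \<odot> d)))"
    by (rule sw_one1) (intro kl)
  also have "\<dots> = sw one (\<lambda>c d. K c (es y \<odot> d))"
    by (intro sw_cong lin_es[symmetric] kl)
  finally show ?thesis .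
qed

lemma sw_es_right:
  assumes K: "bilin K"
  shows "sw (es y) K = sw one (\<lambda>a b. K a (b \<odot> es y))"
proof -
  note kl = lins' bilin_comp[OF K]
  have "sw (es y) K = sw one (\<lambda>a b. sw a K * cu (y \<odot> b))"
    by (rule lin_es) (intro lins)
  also have "\<dots> = sw one (\<lambda>a b. sw a (\<lambda>c d. K c d * cu (y \<odot> b)))"
    by (simp add: sw_mult_right)
  also have "\<dots> = sw one (\<lambda>a b. sw b (\<lambda>c d. K a c * cu (y \<odot> d)))"
    by (rule coassoc)
  also have "\<dots> = sw one (\<lambda>a b. sw one (\<lambda>c d. K a (b \<odot> c) * cu (y \<odot> d)))"
    by (rule sw_one2) (intro kl)
  also have "\<dots> = sw one (\<lambda>c d. K c (d \<odot> es y))"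
    by (intro sw_cong lin_es[symmetric] kl)
  finally show ?thesis .
qed

lemma cu_et_right: "cu (x \<odot> et y) = cu (x \<odot> y)"
proof -
  have "cu (x \<odot> et y) = sw one (\<lambda>a b. cu (a \<odot> y) * cu (x \<odot> b))"
    by (rule lin_et) (intro lins)
  also have "\<dots> = cu (x \<odot> one \<odot> y)"
    by (subst cu3') (simp add: mult.commute)
  finally show ?thesis by (simp add: one_right)
qed

lemma cu_es_left: "cu (es x \<odot> y) = cu (x \<odot> y)"
proof -
  have "cu (es x \<odot> y) = sw one (\<lambda>a b. cu (a \<odot> y) * cu (x \<odot> b))"
    by (rule lin_es) (intro lins)
  also have "\<dots> = cu (x \<odot> one \<odot> y)"
    by (subst cu3') (simp add: mult.commute)
  finally show ?thesis by (simp add: one_right)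
qed

lemma et_mult_et: "et (x \<odot> et y) = et (x \<odot> y)"
  unfolding et_def[of "x \<odot> _"] m_assoc[symmetric] cu_et_right ..

lemma es_es_mult: "es (es x \<odot> y) = es (x \<odot> y)"
  unfolding es_def[of "_ \<odot> y"] m_assoc cu_es_left ..

lemma et_et: "et (et y) = et y"
  using et_mult_et[of one y] by (simp add: one_left)

text \<open>Both products are values of one functional on the coproduct of \<open>et y\<close>,
  computed by \<open>sw_et_left\<close> and by \<open>sw_et_right\<close>.\<close>

lemma es_et_commute: "es x \<odot> et y = et y \<odot> es x"
proof (rule lin_eqI)
  fix F :: "('i \<Rightarrow> complex) \<Rightarrow> complex" assume F: "lin F"
  note kl = lins' lin_comp[OF F]
  have "F (es x \<odot> et y) = sw one (\<lambda>a b. F (a \<odot> et y) * cu (x \<odot> b))"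
    by (rule lin_es) (intro kl)
  also have "\<dots> = sw (et y) (\<lambda>a b. F a * cu (x \<odot> b))"
    by (rule sw_et_left[symmetric]) (intro kl)
  also have "\<dots> = sw one (\<lambda>a b. F (et y \<odot> a) * cu (x \<odot> b))"
    by (rule sw_et_right) (intro kl)
  also have "\<dots> = F (et y \<odot> es x)"
    by (rule lin_es[symmetric]) (intro kl)
  finally show "F (es x \<odot> et y) = F (et y \<odot> es x)" .
qed

text \<open>Inserting a counit into 1_(1) x splits it into coproducts of 1_(1) and of x; the axiom
  for Delta^2(1) then isolates a copy of Delta(1) that is absorbed by x. \<open>sw_left_es\<close>
  is the mirror image.\<close>

lemma sw_right_et:
  assumes K: "bilin K"
  shows "sw x (\<lambda>a b. K a (et b)) = sw one (\<lambda>a b. K (a \<odot> x) b)"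
proof -
  note kl = lins' bilin_comp[OF K]
  have "sw one (\<lambda>a b. K (a \<odot> x) b) = sw one (\<lambda>a b. sw (a \<odot> x) (\<lambda>c d. K c b * cu d))"
    by (intro sw_cong counit_right[symmetric] kl)
  also have "\<dots> = sw one (\<lambda>a b. sw a (\<lambda>c d. sw x (\<lambda>y z. K (c \<odot> y) b * cu (d \<odot> z))))"
    by (intro sw_cong sw_m kl)
  also have "\<dots> = sw one (\<lambda>a b. sw b (\<lambda>c d. sw x (\<lambda>y z. K (a \<odot> y) d * cu (c \<odot> z))))"
    by (rule coassoc)
  also have "\<dots> = sw one (\<lambda>a b. sw one (\<lambda>c d. sw x (\<lambda>y z. K (a \<odot> y) d * cu (c \<odot> b \<odot> z))))"
    by (rule sw_one1) (intro kl)
  also have "\<dots> = sw one (\<lambda>c d. sw one (\<lambda>a b. sw x (\<lambda>y z. K (a \<odot> y) d * cu (c \<odot> (b \<odot> z)))))"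
    by (subst sw_swap) (simp add: m_assoc)
  also have "\<dots> = sw one (\<lambda>c d. sw x (\<lambda>y z. K y d * cu (c \<odot> z)))"
    by (intro sw_cong sw_one_mult_left kl)
  also have "\<dots> = sw x (\<lambda>y z. sw one (\<lambda>c d. cu (c \<odot> z) * K y d))"
    by (subst sw_swap) (simp add: mult.commute)
  also have "\<dots> = sw x (\<lambda>y z. K y (et z))"
    by (intro sw_cong lin_et[symmetric] kl)
  finally show ?thesis by simp
qed

lemma sw_left_es:
  assumes K: "bilin K"
  shows "sw x (\<lambda>a b. K (es a) b) = sw one (\<lambda>a b. K a (x \<odot> b))"
proof -
  note kl = lins' bilin_comp[OF K]
  have "sw one (\<lambda>a b. K a (x \<odot> b)) = sw one (\<lambda>a b. sw (x \<odot> b) (\<lambda>c d. cu c * K a d))"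
    by (intro sw_cong counit_left[symmetric] kl)
  also have "\<dots> = sw one (\<lambda>a b. sw x (\<lambda>y z. sw b (\<lambda>c d. cu (y \<odot> c) * K a (z \<odot> d))))"
    by (intro sw_cong sw_m kl)
  also have "\<dots> = sw one (\<lambda>a b. sw b (\<lambda>c d. sw x (\<lambda>y z. cu (y \<odot> c) * K a (z \<odot> d))))"
    by (intro sw_cong sw_swap)
  also have "\<dots> = sw one (\<lambda>a b. sw one (\<lambda>c d. sw x (\<lambda>y z. cu (y \<odot> (c \<odot> b)) * K a (z \<odot> d))))"
    by (rule sw_one1) (intro kl)
  also have "\<dots> = sw one (\<lambda>a b. sw x (\<lambda>y z. sw one (\<lambda>c d. cu (y \<odot> c \<odot> b) * K a (z \<odot> d))))"
    by (subst sw_swap[of x]) (simp add: m_assoc)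
  also have "\<dots> = sw one (\<lambda>a b. sw x (\<lambda>y z. cu (y \<odot> b) * K a z))"
    by (intro sw_cong sw_one_mult_right kl)
  also have "\<dots> = sw x (\<lambda>y z. sw one (\<lambda>a b. K a z * cu (y \<odot> b)))"
    by (subst sw_swap) (simp add: mult.commute)
  also have "\<dots> = sw x (\<lambda>y z. K (es y) z)"
    by (intro sw_cong lin_es[symmetric] kl)
  finally show ?thesis by simp
qed

text \<open>By the coproduct formulas for the source subalgebra, the convolution id * S agrees on
  \<open>es x\<close> with es * S, and es * S = S * id * S = S.\<close>

lemma S_es: "S (es x) = et (es x)"
proof (rule lin_eqI)
  fix F :: "('i \<Rightarrow> complex) \<Rightarrow> complex" assume F: "lin F"
  note kl = lins' lin_comp[OF F]
  have "F (et (es x)) = sw (es x) (\<lambda>a b. F (a \<odot> S b))"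
    by (intro sw_antipode_t[symmetric] F)
  also have "\<dots> = sw one (\<lambda>a b. F (a \<odot> S (es x \<odot> b)))"
    by (rule sw_es_left) (intro kl)
  also have "\<dots> = sw (es x) (\<lambda>a b. F (es a \<odot> S b))"
    by (rule sw_left_es[symmetric]) (intro kl)
  also have "\<dots> = sw (es x) (\<lambda>a b. sw a (\<lambda>c d. F (S c \<odot> d \<odot> S b)))"
    by (intro sw_cong sw_antipode_s[symmetric] kl)
  also have "\<dots> = sw (es x) (\<lambda>a b. sw b (\<lambda>c d. F (S a \<odot> c \<odot> S d)))"
    by (rule coassoc)
  also have "\<dots> = F (S (es x))"
    by (rule antipode_S[OF F])
  finally show "F (S (es x)) = F (et (es x))" ..
qed

text \<open>Mirror image of \<open>S_es\<close>: on \<open>et x\<close> the convolution S * id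
  agrees with S * et, which is S * id * S = S.\<close>

lemma S_et: "S (et x) = es (et x)"
proof (rule lin_eqI)
  fix F :: "('i \<Rightarrow> complex) \<Rightarrow> complex" assume F: "lin F"
  note kl = lins' lin_comp[OF F]
  have "F (es (et x)) = sw (et x) (\<lambda>a b. F (S a \<odot> b))"
    by (intro sw_antipode_s[symmetric] F)
  also have "\<dots> = sw one (\<lambda>a b. F (S (a \<odot> et x) \<odot> b))"
    by (rule sw_et_left) (intro kl)
  also have "\<dots> = sw (et x) (\<lambda>a b. F (S a \<odot> et b))"
    by (rule sw_right_et[symmetric]) (intro kl)
  also have "\<dots> = sw (et x) (\<lambda>a b. sw b (\<lambda>c d. F (S a \<odot> (c \<odot> S d))))"
    by (intro sw_cong sw_antipode_t[symmetric] kl)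
  also have "\<dots> = F (S (et x))"
    using antipode_S[OF F] by (simp add: m_assoc)
  finally show "F (S (et x)) = F (es (et x))" ..
qed

end

section \<open>Anti-multiplicativity of the antipode\<close>

context weak_hopf
begin

text \<open>The map y -> 1_(1) cu(1_(2) y) occurring here differs from \<open>es\<close> in the
  order of the product; \<open>sw_left_et\<close> relates it to \<open>et\<close> through the
  antipode.\<close>

lemma sw_left_one_mult:
  assumes K: "bilin K"
  shows "sw one (\<lambda>a b. K a (b \<odot> x)) = sw x (\<lambda>y z. sw one (\<lambda>a b. K a z * cu (b \<odot> y)))"
proof -
  note kl = lins' bilin_comp[OF K]
  have "sw one (\<lambda>a b. K a (b \<odot> x)) = sw one (\<lambda>a b. sw (b \<odot> x) (\<lambda>c d. cu c * K a d))"
    by (intro sw_cong counit_left[symmetric] kl)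
  also have "\<dots> = sw one (\<lambda>a b. sw b (\<lambda>c d. sw x (\<lambda>y z. cu (c \<odot> y) * K a (d \<odot> z))))"
    by (intro sw_cong sw_m kl)
  also have "\<dots> = sw one (\<lambda>a b. sw one (\<lambda>c d. sw x (\<lambda>y z. cu (b \<odot> c \<odot> y) * K a (d \<odot> z))))"
    by (rule sw_one2) (intro kl)
  also have "\<dots> = sw one (\<lambda>a b. sw one (\<lambda>c d. sw x (\<lambda>y z. cu (b \<odot> (c \<odot> y)) * K a (d \<odot> z))))"
    by (simp add: m_assoc)
  also have "\<dots> = sw one (\<lambda>a b. sw x (\<lambda>y z. cu (b \<odot> y) * K a z))"
    by (intro sw_cong sw_one_mult_left kl)
  also have "\<dots> = sw x (\<lambda>y z. sw one (\<lambda>a b. K a z * cu (b \<odot> y)))"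
    by (subst sw_swap) (simp add: mult.commute)
  finally show ?thesis .
qed

lemma sw_one_es:
  assumes K: "bilin K"
  shows "sw one (\<lambda>a b. K (es a) b) = sw one K"
  using sw_left_es[OF K, of one] by (simp add: one_left)

lemma sw_one_et:
  assumes K: "bilin K"
  shows "sw one (\<lambda>a b. K a (et b)) = sw one K"
  using sw_right_et[OF K, of one] by (simp add: one_right)

text \<open>The first legs of Delta(1) lie in the source subalgebra, on which S coincides with
  \<open>et\<close>. After S has been replaced in this way, \<open>cu3\<close> merges the two
  counits into the one that defines \<open>et\<close>.\<close>

lemma sw_left_et:
  assumes K: "bilin K"
  shows "sw x (\<lambda>a b. K (et a) b) = sw one (\<lambda>a b. K (S a) (b \<odot> x))"
proof -
  note kl = lins' bilin_comp[OF K]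
  have "sw one (\<lambda>a b. K (S a) (b \<odot> x)) = sw one (\<lambda>a b. K (S (es a)) (b \<odot> x))"
    by (rule sw_one_es[symmetric]) (intro kl)
  also have "\<dots> = sw one (\<lambda>a b. K (et (es a)) (b \<odot> x))"
    by (simp add: S_es)
  also have "\<dots> = sw one (\<lambda>a b. K (et a) (b \<odot> x))"
    by (rule sw_one_es) (intro kl)
  also have "\<dots> = sw x (\<lambda>y z. sw one (\<lambda>a b. K (et a) z * cu (b \<odot> y)))"
    by (rule sw_left_one_mult) (intro kl)
  also have "\<dots> = sw x (\<lambda>y z. sw one (\<lambda>a b. sw one (\<lambda>c d. cu (c \<odot> a) * K d z) * cu (b \<odot> y)))"
    by (intro sw_cong arg_cong[where f="\<lambda>z. z * _"] lin_et kl)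
  also have "\<dots> = sw x (\<lambda>y z. sw one (\<lambda>a b. sw one (\<lambda>c d. K d z * (cu (c \<odot> a) * cu (b \<odot> y)))))"
    unfolding sw_mult_right[symmetric] by (simp add: mult_ac)
  also have "\<dots> = sw x (\<lambda>y z. sw one (\<lambda>c d. K d z * sw one (\<lambda>a b. cu (c \<odot> a) * cu (b \<odot> y))))"
    by (subst sw_swap[of one]) (simp add: sw_mult_left)
  also have "\<dots> = sw x (\<lambda>y z. sw one (\<lambda>c d. cu (c \<odot> y) * K d z))"
    by (simp add: cu3[symmetric] one_right mult.commute)
  also have "\<dots> = sw x (\<lambda>y z. K (et y) z)"
    by (intro sw_cong lin_et[symmetric] kl)
  finally show ?thesis by simp
qed

lemma sw_mult_et:
  assumes K: "bilin K"
  shows "sw (x \<odot> et y) K = sw x (\<lambda>a b. K (a \<odot> et y) b)"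
proof -
  note kl = lins' bilin_comp[OF K]
  have "sw (x \<odot> et y) K = sw x (\<lambda>a b. sw (et y) (\<lambda>c d. K (a \<odot> c) (b \<odot> d)))"
    by (rule sw_m[OF K])
  also have "\<dots> = sw x (\<lambda>a b. sw one (\<lambda>c d. K (a \<odot> (c \<odot> et y)) (b \<odot> d)))"
    by (intro sw_cong sw_et_left kl)
  also have "\<dots> = sw x (\<lambda>a b. K (a \<odot> et y) b)"
    unfolding m_assoc[symmetric] by (rule sw_one_mult_right) (intro kl)
  finally show ?thesis .
qed

lemma sw_et_mult:
  assumes K: "bilin K"
  shows "sw (et y \<odot> x) K = sw x (\<lambda>a b. K (et y \<odot> a) b)"
proof -
  note kl = lins' bilin_comp[OF K]
  have "sw (et y \<odot> x) K = sw (et y) (\<lambda>c d. sw x (\<lambda>a b. K (c \<odot> a) (d \<odot> b)))"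
    by (rule sw_m[OF K])
  also have "\<dots> = sw one (\<lambda>c d. sw x (\<lambda>a b. K (et y \<odot> c \<odot> a) (d \<odot> b)))"
    by (rule sw_et_right) (intro kl)
  also have "\<dots> = sw x (\<lambda>a b. K (et y \<odot> a) b)"
    unfolding m_assoc by (rule sw_one_mult_left) (intro kl)
  finally show ?thesis .
qed

lemma sw_mult_es:
  assumes K: "bilin K"
  shows "sw (x \<odot> es y) K = sw x (\<lambda>a b. K a (b \<odot> es y))"
proof -
  note kl = lins' bilin_comp[OF K]
  have "sw (x \<odot> es y) K = sw x (\<lambda>a b. sw (es y) (\<lambda>c d. K (a \<odot> c) (b \<odot> d)))"
    by (rule sw_m[OF K])
  also have "\<dots> = sw x (\<lambda>a b. sw one (\<lambda>c d. K (a \<odot> c) (b \<odot> (d \<odot> es y))))"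
    by (intro sw_cong sw_es_right kl)
  also have "\<dots> = sw x (\<lambda>a b. K a (b \<odot> es y))"
    unfolding m_assoc[symmetric] by (rule sw_one_mult_right) (intro kl)
  finally show ?thesis .
qed

lemma sw_es_mult:
  assumes K: "bilin K"
  shows "sw (es y \<odot> x) K = sw x (\<lambda>a b. K a (es y \<odot> b))"
proof -
  note kl = lins' bilin_comp[OF K]
  have "sw (es y \<odot> x) K = sw (es y) (\<lambda>c d. sw x (\<lambda>a b. K (c \<odot> a) (d \<odot> b)))"
    by (rule sw_m[OF K])
  also have "\<dots> = sw one (\<lambda>c d. sw x (\<lambda>a b. K (c \<odot> a) (es y \<odot> d \<odot> b)))"
    by (rule sw_es_left) (intro kl)
  also have "\<dots> = sw x (\<lambda>a b. K a (es y \<odot> b))"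
    unfolding m_assoc by (rule sw_one_mult_left) (intro kl)
  finally show ?thesis .
qed

lemma et_mult:
  assumes G: "lin G"
  shows "sw x (\<lambda>a b. G (a \<odot> et y \<odot> S b)) = G (et (x \<odot> y))"
proof -
  note kl = lins' lin_comp[OF G]
  have "sw x (\<lambda>a b. G (a \<odot> et y \<odot> S b)) = sw (x \<odot> et y) (\<lambda>a b. G (a \<odot> S b))"
    by (rule sw_mult_et[symmetric]) (intro kl)
  then show ?thesis by (simp add: sw_antipode_t[OF G] et_mult_et)
qed

lemma es_mult:
  assumes G: "lin G"
  shows "sw y (\<lambda>a b. G (S a \<odot> es x \<odot> b)) = G (es (x \<odot> y))"
proof -
  note kl = lins' lin_comp[OF G]
  have "sw y (\<lambda>a b. G (S a \<odot> (es x \<odot> b))) = sw (es x \<odot> y) (\<lambda>a b. G (S a \<odot> b))"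
    by (rule sw_es_mult[symmetric]) (intro kl)
  then show ?thesis by (simp add: sw_antipode_s[OF G] es_es_mult m_assoc)
qed

lemma sw_es_S:
  assumes G: "lin G"
  shows "sw x (\<lambda>a b. G (es a \<odot> S b)) = G (S x)"
proof -
  note kl = lins' lin_comp[OF G]
  have "sw x (\<lambda>a b. G (es a \<odot> S b)) = sw x (\<lambda>a b. sw a (\<lambda>c d. G (S c \<odot> d \<odot> S b)))"
    by (intro sw_cong sw_antipode_s[symmetric] kl)
  then show ?thesis unfolding coassoc by (simp add: antipode_S[OF G])
qed

lemma sw_S_et:
  assumes G: "lin G"
  shows "sw x (\<lambda>a b. G (S a \<odot> et b)) = G (S x)"
proof -
  note kl = lins' lin_comp[OF G]
  have "sw x (\<lambda>a b. G (S a \<odot> et b)) = sw x (\<lambda>a b. sw b (\<lambda>c d. G (S a \<odot> (c \<odot> S d))))"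
    by (intro sw_cong sw_antipode_t[symmetric] kl)
  then show ?thesis using antipode_S[OF G] by (simp add: m_assoc)
qed

text \<open>Both sides are brought to the common form \<open>M\<close>. For S(xy), write S = es * S
  on the product, split \<open>es (a \<odot> c)\<close> by \<open>A\<close>, collapse the remaining
  id * S to \<open>et\<close> and split that by \<open>B\<close>. For S(y) S(x), use S = es * S on x
  and S = S * et on y; the two inserted elements are moved past each other by \<open>c\<close> and
  then expanded.\<close>

lemma S_mult: "S (x \<odot> y) = S y \<odot> S x"
proof (rule lin_eqI)
  fix G :: "('i \<Rightarrow> complex) \<Rightarrow> complex" assume G: "lin G"
  note kl = lins' lin_comp[OF G]
  have A: "sw a (\<lambda>p q. sw c (\<lambda>r s. G' (S r \<odot> S p \<odot> (q \<odot> s)))) = G' (es (a \<odot> c))" if G': "lin G'" for G' a c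
  proof -
    have "sw a (\<lambda>p q. sw c (\<lambda>r s. G' (S r \<odot> S p \<odot> (q \<odot> s)))) = sw c (\<lambda>r s. sw a (\<lambda>p q. G' (S r \<odot> (S p \<odot> q) \<odot> s)))"
      by (subst sw_swap) (simp add: m_assoc)
    also have "\<dots> = sw c (\<lambda>r s. G' (S r \<odot> es a \<odot> s))"
      by (intro sw_cong sw_antipode_s lins' lin_comp[OF G'])
    finally show ?thesis by (simp add: es_mult[OF G'])
  qed
  have B: "sw a (\<lambda>p q. sw c (\<lambda>r s. G' (p \<odot> r \<odot> (S s \<odot> S q)))) = G' (et (a \<odot> c))" if G': "lin G'" for G' a c
  proof -
    have "sw a (\<lambda>p q. sw c (\<lambda>r s. G' (p \<odot> r \<odot> (S s \<odot> S q)))) = sw a (\<lambda>p q. sw c (\<lambda>r s. G' (p \<odot> (r \<odot> S s) \<odot> S q)))"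
      by (simp add: m_assoc)
    also have "\<dots> = sw a (\<lambda>p q. G' (p \<odot> et c \<odot> S q))"
      by (intro sw_cong sw_antipode_t lins' lin_comp[OF G'])
    finally show ?thesis by (simp add: et_mult[OF G'])
  qed
  have c: "et d \<odot> (es a \<odot> b) = es a \<odot> (et d \<odot> b)" for a b d
    by (simp only: m_assoc[symmetric] es_et_commute)
  define M where "M = sw x (\<lambda>p b'. sw y (\<lambda>r d'. sw b' (\<lambda>q b. sw d' (\<lambda>s d. G (S r \<odot> S p \<odot> (q \<odot> s \<odot> (S d \<odot> S b)))))))"
  have "G (S (x \<odot> y)) = sw (x \<odot> y) (\<lambda>a b. G (es a \<odot> S b))"
    by (rule sw_es_S[OF G, symmetric])
  also have "\<dots> = sw x (\<lambda>a b. sw y (\<lambda>c d. G (es (a \<odot> c) \<odot> S (b \<odot> d))))"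
    by (rule sw_m) (intro kl)
  also have "\<dots> = sw x (\<lambda>a b. sw y (\<lambda>c d. sw a (\<lambda>p q. sw c (\<lambda>r s. G (S r \<odot> S p \<odot> (q \<odot> s) \<odot> S (b \<odot> d))))))"
    by (intro sw_cong A[symmetric] kl)
  also have "\<dots> = sw x (\<lambda>a b. sw a (\<lambda>p q. sw y (\<lambda>c d. sw c (\<lambda>r s. G (S r \<odot> S p \<odot> (q \<odot> s) \<odot> S (b \<odot> d))))))"
    by (intro sw_cong sw_swap)
  also have "\<dots> = sw x (\<lambda>p b'. sw b' (\<lambda>q b. sw y (\<lambda>r d'. sw d' (\<lambda>s d. G (S r \<odot> S p \<odot> (q \<odot> s) \<odot> S (b \<odot> d))))))"
    unfolding coassoc ..
  also have "\<dots> = sw x (\<lambda>p b'. sw y (\<lambda>r d'. sw b' (\<lambda>q b. sw d' (\<lambda>s d. G (S r \<odot> S p \<odot> (q \<odot> s \<odot> S (b \<odot> d)))))))"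
    unfolding m_assoc by (intro sw_cong sw_swap)
  also have "\<dots> = sw x (\<lambda>p b'. sw y (\<lambda>r d'. sw (b' \<odot> d') (\<lambda>u v. G (S r \<odot> S p \<odot> (u \<odot> S v)))))"
    by (intro sw_cong sw_m[symmetric] kl)
  also have "\<dots> = sw x (\<lambda>p b'. sw y (\<lambda>r d'. G (S r \<odot> S p \<odot> et (b' \<odot> d'))))"
    by (intro sw_cong sw_antipode_t kl)
  also have "\<dots> = M"
    unfolding M_def by (intro sw_cong B[symmetric] kl)
  finally have 1: "G (S (x \<odot> y)) = M" .
  have "G (S y \<odot> S x) = sw x (\<lambda>a b. G (S y \<odot> (es a \<odot> S b)))"
    by (rule sw_es_S[symmetric]) (intro kl)
  also have "\<dots> = sw x (\<lambda>a b. sw y (\<lambda>r d'. G (S r \<odot> et d' \<odot> (es a \<odot> S b))))"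
    by (intro sw_cong sw_S_et[symmetric] kl)
  also have "\<dots> = sw x (\<lambda>a b. sw y (\<lambda>r d'. G (S r \<odot> es a \<odot> (et d' \<odot> S b))))"
    by (simp only: m_assoc c)
  also have "\<dots> = sw x (\<lambda>a b. sw y (\<lambda>r d'. sw a (\<lambda>p q. G (S r \<odot> (S p \<odot> q) \<odot> (et d' \<odot> S b)))))"
    by (intro sw_cong sw_antipode_s[symmetric] kl)
  also have "\<dots> = sw x (\<lambda>a b. sw y (\<lambda>r d'. sw a (\<lambda>p q. sw d' (\<lambda>s d. G (S r \<odot> (S p \<odot> q) \<odot> (s \<odot> S d \<odot> S b))))))"
    by (intro sw_cong sw_antipode_t[symmetric] kl)
  also have "\<dots> = sw x (\<lambda>a b. sw a (\<lambda>p q. sw y (\<lambda>r d'. sw d' (\<lambda>s d. G (S r \<odot> S p \<odot> (q \<odot> s \<odot> (S d \<odot> S b)))))))"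
    unfolding m_assoc by (intro sw_cong sw_swap)
  also have "\<dots> = sw x (\<lambda>p b'. sw b' (\<lambda>q b. sw y (\<lambda>r d'. sw d' (\<lambda>s d. G (S r \<odot> S p \<odot> (q \<odot> s \<odot> (S d \<odot> S b)))))))"
    by (rule coassoc)
  also have "\<dots> = M"
    unfolding M_def by (intro sw_cong sw_swap)
  finally show "G (S (x \<odot> y)) = G (S y \<odot> S x)" using 1 by simp
qed

lemma et_one: "et one = one"
  by (rule lin_eqI) (simp add: lin_et one_right counit_left)
lemma es_one: "es one = one"
  by (rule lin_eqI) (simp add: lin_es one_left counit_right)
lemma S_one: "S one = one"
  using S_et[of one] by (simp add: et_one es_one)

section \<open>Integrals and pivotal elements\<close>

text \<open>A functional on this algebra is an element of the dual algebra. There the condition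
  reads x \<Lambda> = \<epsilon>_t(x) \<Lambda>, with G in the role of x.\<close>

definition left_integral :: "(('i \<Rightarrow> complex) \<Rightarrow> complex) \<Rightarrow> bool" where
  "left_integral \<Lambda> \<longleftrightarrow> lin \<Lambda> \<and> (\<forall>f G. lin G \<longrightarrow> sw f (\<lambda>a b. G a * \<Lambda> b) = sw f (\<lambda>a b. G (et a) * \<Lambda> b))"

text \<open>\<open>X\<close> is computed in two ways. The integral property turns the first leg of
  the coproduct of f_(2) g into \<open>et\<close>, which leads to the right side; splitting that
  coproduct by multiplicativity collapses S(f_(1)) f_(2) to \<open>es\<close>, which leads to the
  left side.\<close>

lemma left_integral_shift:
  assumes \<Lambda>: "left_integral \<Lambda>" and G: "lin G"
  shows "sw g (\<lambda>a b. G a * \<Lambda> (f \<odot> b)) = sw f (\<lambda>a b. G (S a) * \<Lambda> (b \<odot> g))"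
proof -
  have l: "lin \<Lambda>" using \<Lambda> by (simp add: left_integral_def)
  have int: "lin G \<Longrightarrow> sw f (\<lambda>a b. G a * \<Lambda> b) = sw f (\<lambda>a b. G (et a) * \<Lambda> b)" for f G
    using \<Lambda> unfolding left_integral_def by blast
  note kl = lins' lin_comp[OF G] lin_comp[OF l]
  define X where "X = sw f (\<lambda>a b. sw (b \<odot> g) (\<lambda>c d. G (S a \<odot> c) * \<Lambda> d))"
  have "X = sw f (\<lambda>a b. sw (b \<odot> g) (\<lambda>c d. G (S a \<odot> et c) * \<Lambda> d))"
    unfolding X_def by (intro sw_cong int kl)
  also have "\<dots> = sw f (\<lambda>a b. sw one (\<lambda>u v. G (S a \<odot> S u) * \<Lambda> (v \<odot> (b \<odot> g))))"
    by (intro sw_cong sw_left_et kl)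
  also have "\<dots> = sw one (\<lambda>u v. sw f (\<lambda>a b. G (S (u \<odot> a)) * \<Lambda> (v \<odot> b \<odot> g)))"
    by (subst sw_swap) (simp add: S_mult m_assoc)
  also have "\<dots> = sw f (\<lambda>a b. G (S a) * \<Lambda> (b \<odot> g))"
    by (rule sw_one_mult_left) (intro kl)
  finally have 1: "X = sw f (\<lambda>a b. G (S a) * \<Lambda> (b \<odot> g))" .
  have "X = sw f (\<lambda>a b. sw b (\<lambda>r s. sw g (\<lambda>c d. G (S a \<odot> (r \<odot> c)) * \<Lambda> (s \<odot> d))))"
    unfolding X_def by (intro sw_cong sw_m kl)
  also have "\<dots> = sw f (\<lambda>b s. sw b (\<lambda>a r. sw g (\<lambda>c d. G (S a \<odot> (r \<odot> c)) * \<Lambda> (s \<odot> d))))"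
    by (rule coassoc[symmetric])
  also have "\<dots> = sw f (\<lambda>b s. sw g (\<lambda>c d. sw b (\<lambda>a r. G (S a \<odot> r \<odot> c) * \<Lambda> (s \<odot> d))))"
    unfolding m_assoc by (intro sw_cong sw_swap)
  also have "\<dots> = sw f (\<lambda>b s. sw g (\<lambda>c d. G (es b \<odot> c) * \<Lambda> (s \<odot> d)))"
    by (intro sw_cong sw_antipode_s kl)
  also have "\<dots> = sw g (\<lambda>c d. sw f (\<lambda>b s. G (es b \<odot> c) * \<Lambda> (s \<odot> d)))"
    by (rule sw_swap)
  also have "\<dots> = sw g (\<lambda>c d. sw one (\<lambda>u v. G (u \<odot> c) * \<Lambda> (f \<odot> v \<odot> d)))"
    by (intro sw_cong sw_left_es kl)
  also have "\<dots> = sw one (\<lambda>u v. sw g (\<lambda>c d. G (u \<odot> c) * \<Lambda> (f \<odot> (v \<odot> d))))"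
    unfolding m_assoc by (rule sw_swap)
  also have "\<dots> = sw g (\<lambda>c d. G c * \<Lambda> (f \<odot> d))"
    by (rule sw_one_mult_left) (intro kl)
  finally show ?thesis using 1 by simp
qed

text \<open>The element $1_{(2)}\, \varphi(S(1_{(1)}))$. If $\varphi$ is a $k$-twisted character it is central, which
determines $\varphi$ on the target subalgebra.\<close>

definition partial_cu :: "(('i \<Rightarrow> complex) \<Rightarrow> complex) \<Rightarrow> 'i \<Rightarrow> complex" where
  "partial_cu \<phi> = (\<lambda>i. sw one (\<lambda>a b. \<phi> (S a) * b i))"

lemma lin_partial_cu: "lin G \<Longrightarrow> G (partial_cu \<phi>) = sw one (\<lambda>a b. \<phi> (S a) * G b)"
  unfolding partial_cu_def by (rule lin_swv)

text \<open>Multiplication by f on the right produces \<phi> on \<open>et\<close>, on the left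
  \<phi> on \<open>S\<close> of \<open>es\<close>. The twist identifies them, since \<phi>(c S(d)) =
  \<phi>(S(d) S(S(c))) = \<phi>(S(S(c) d)).\<close>

lemma partial_cu_central:
  assumes \<phi>: "lin \<phi>" and tw: "\<And>f g. \<phi> (g \<odot> f) = \<phi> (f \<odot> S (S g))"
  shows "f \<odot> partial_cu \<phi> = partial_cu \<phi> \<odot> f"
proof (rule lin_eqI)
  fix G :: "('i \<Rightarrow> complex) \<Rightarrow> complex" assume G: "lin G"
  note kl = lins' lin_comp[OF G] lin_comp[OF \<phi>]
  have "G (partial_cu \<phi> \<odot> f) = sw one (\<lambda>a b. \<phi> (S a) * G (b \<odot> f))"
    by (rule lin_partial_cu) (intro kl)
  also have "\<dots> = sw f (\<lambda>a b. \<phi> (et a) * G b)"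
    by (rule sw_left_et[symmetric]) (intro kl)
  also have "\<dots> = sw f (\<lambda>a b. sw a (\<lambda>c d. \<phi> (c \<odot> S d)) * G b)"
    by (simp add: sw_antipode_t[OF \<phi>])
  also have "\<dots> = sw f (\<lambda>a b. sw a (\<lambda>c d. \<phi> (S (S c \<odot> d))) * G b)"
    unfolding S_mult tw[symmetric] ..
  also have "\<dots> = sw f (\<lambda>a b. \<phi> (S (es a)) * G b)"
    by (intro sw_cong arg_cong[where f="\<lambda>z. z * _"] sw_antipode_s kl)
  also have "\<dots> = sw one (\<lambda>a b. \<phi> (S a) * G (f \<odot> b))"
    by (rule sw_left_es) (intro kl)
  also have "\<dots> = G (f \<odot> partial_cu \<phi>)"
    by (rule lin_partial_cu[symmetric]) (intro kl)
  finally show "G (f \<odot> partial_cu \<phi>) = G (partial_cu \<phi> \<odot> f)" ..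
qed

lemma cu_partial_cu:
  assumes \<phi>: "lin \<phi>"
  shows "cu (partial_cu \<phi> \<odot> z) = \<phi> (et z)"
proof -
  note kl = lins' lin_comp[OF \<phi>]
  have "cu (partial_cu \<phi> \<odot> z) = sw one (\<lambda>a b. \<phi> (S a) * cu (b \<odot> z))"
    by (rule lin_partial_cu) (intro kl)
  also have "\<dots> = sw z (\<lambda>a b. \<phi> (et a) * cu b)"
    by (rule sw_left_et[symmetric]) (intro kl)
  also have "\<dots> = \<phi> (et z)"
    by (rule counit_right) (intro kl)
  finally show ?thesis .
qed

end

locale pivotal_weak_hopf = weak_hopf +
  fixes k ki
  assumes k_inv: "k \<odot> ki = one" and ki_inv: "ki \<odot> k = one"
    and group_like_left: "bilin K \<Longrightarrow> sw k K = sw one (\<lambda>a b. K (k \<odot> a) (k \<odot> b))"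
    and group_like_right: "bilin K \<Longrightarrow> sw k K = sw one (\<lambda>a b. K (a \<odot> k) (b \<odot> k))"
    and S_S: "S (S f) = k \<odot> f \<odot> ki"
begin

lemma sw_mult_k:
  assumes K: "bilin K"
  shows "sw (f \<odot> k) K = sw f (\<lambda>a b. K (a \<odot> k) (b \<odot> k))"
proof -
  note kl = lins' bilin_comp[OF K]
  have "sw (f \<odot> k) K = sw f (\<lambda>a b. sw k (\<lambda>c d. K (a \<odot> c) (b \<odot> d)))"
    by (rule sw_m[OF K])
  also have "\<dots> = sw f (\<lambda>a b. sw one (\<lambda>c d. K (a \<odot> (c \<odot> k)) (b \<odot> (d \<odot> k))))"
    by (intro sw_cong group_like_right kl)
  also have "\<dots> = sw f (\<lambda>a b. K (a \<odot> k) (b \<odot> k))"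
    unfolding m_assoc[symmetric] by (rule sw_one_mult_right) (intro kl)
  finally show ?thesis .
qed

lemma sw_k_mult:
  assumes K: "bilin K"
  shows "sw (k \<odot> f) K = sw f (\<lambda>a b. K (k \<odot> a) (k \<odot> b))"
proof -
  note kl = lins' bilin_comp[OF K]
  have "sw (k \<odot> f) K = sw k (\<lambda>c d. sw f (\<lambda>a b. K (c \<odot> a) (d \<odot> b)))"
    by (rule sw_m[OF K])
  also have "\<dots> = sw one (\<lambda>c d. sw f (\<lambda>a b. K (k \<odot> c \<odot> a) (k \<odot> d \<odot> b)))"
    by (rule group_like_left) (intro kl)
  also have "\<dots> = sw f (\<lambda>a b. K (k \<odot> a) (k \<odot> b))"
    unfolding m_assoc by (rule sw_one_mult_left) (intro kl)
  finally show ?thesis .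
qed

lemma sw_mult_ki:
  assumes K: "bilin K"
  shows "sw (f \<odot> ki) K = sw f (\<lambda>a b. K (a \<odot> ki) (b \<odot> ki))"
proof -
  note kl = lins' bilin_comp[OF K]
  have "sw (f \<odot> ki \<odot> k) (\<lambda>a b. K (a \<odot> ki) (b \<odot> ki)) = sw (f \<odot> ki) (\<lambda>a b. K (a \<odot> k \<odot> ki) (b \<odot> k \<odot> ki))"
    by (rule sw_mult_k) (intro kl)
  then show ?thesis by (simp add: m_assoc k_inv ki_inv one_right)
qed

lemma sw_S_S:
  assumes K: "bilin K"
  shows "sw (S (S x)) K = sw x (\<lambda>a b. K (S (S a)) (S (S b)))"
proof -
  note kl = lins' bilin_comp[OF K]
  have "sw (S (S x)) K = sw (k \<odot> x) (\<lambda>a b. K (a \<odot> ki) (b \<odot> ki))"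
    unfolding S_S by (rule sw_mult_ki[OF K])
  also have "\<dots> = sw x (\<lambda>a b. K (k \<odot> a \<odot> ki) (k \<odot> b \<odot> ki))"
    by (rule sw_k_mult) (intro kl)
  finally show ?thesis by (simp add: S_S)
qed

text \<open>The counit axiom and group-likeness give k = \<open>et k \<odot> k\<close>; then k is
  cancelled.\<close>

lemma et_k: "et k = one"
proof -
  have "k = et k \<odot> k"
  proof (rule lin_eqI)
    fix G :: "('a \<Rightarrow> complex) \<Rightarrow> complex" assume G: "lin G"
    note kl = lins' lin_comp[OF G]
    have "G k = sw k (\<lambda>a b. cu a * G b)" by (rule counit_left[OF G, symmetric])
    also have "\<dots> = sw one (\<lambda>a b. cu (a \<odot> k) * G (b \<odot> k))"
      by (rule group_like_right) (intro kl)
    also have "\<dots> = G (et k \<odot> k)"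
      by (rule lin_et[symmetric]) (intro kl)
    finally show "G k = G (et k \<odot> k)" .
  qed
  then have "k \<odot> ki = et k \<odot> k \<odot> ki" by simp
  then show ?thesis by (simp add: m_assoc k_inv one_right)
qed

lemma S_k: "S k = ki"
proof -
  have "one = k \<odot> S k"
  proof (rule lin_eqI)
    fix G :: "('a \<Rightarrow> complex) \<Rightarrow> complex" assume G: "lin G"
    note kl = lins' lin_comp[OF G]
    have "G one = sw k (\<lambda>a b. G (a \<odot> S b))"
      using sw_antipode_t[OF G, of k] by (simp add: et_k)
    also have "\<dots> = sw one (\<lambda>a b. G (k \<odot> a \<odot> S (k \<odot> b)))"
      by (rule group_like_left) (intro kl)
    also have "\<dots> = sw one (\<lambda>a b. G (k \<odot> (a \<odot> S b) \<odot> S k))"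
      by (simp add: S_mult m_assoc)
    also have "\<dots> = G (k \<odot> et one \<odot> S k)"
      by (rule sw_antipode_t) (intro kl)
    finally show "G one = G (k \<odot> S k)" by (simp add: et_one one_right)
  qed
  then have "ki \<odot> one = ki \<odot> k \<odot> S k" by (simp add: m_assoc)
  then show ?thesis by (simp add: ki_inv one_left one_right)
qed

text \<open>Inserts $S(\varepsilon_t(b_{(1)})) = S^2(b_{(2)}) S(b_{(1)})$ into the first tensor factor.\<close>

lemma sw_insert:
  assumes K: "bilin K"
  shows "sw f (\<lambda>a c. K a (c \<odot> S (S b))) = sw b (\<lambda>p q. sw (f \<odot> S (S q)) (\<lambda>a c. K (a \<odot> S p) c))"
proof -
  note kl = lins' bilin_comp[OF K]
  have "sw b (\<lambda>p q. sw (f \<odot> S (S q)) (\<lambda>a c. K (a \<odot> S p) c)) =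
      sw b (\<lambda>p q. sw f (\<lambda>a c. sw (S (S q)) (\<lambda>r s. K (a \<odot> r \<odot> S p) (c \<odot> s))))"
    by (intro sw_cong sw_m kl)
  also have "\<dots> = sw b (\<lambda>p q. sw f (\<lambda>a c. sw q (\<lambda>r s. K (a \<odot> S (S r) \<odot> S p) (c \<odot> S (S s)))))"
    by (intro sw_cong sw_S_S kl)
  also have "\<dots> = sw f (\<lambda>a c. sw b (\<lambda>p q. sw q (\<lambda>r s. K (a \<odot> S (S r) \<odot> S p) (c \<odot> S (S s)))))"
    by (rule sw_swap)
  also have "\<dots> = sw f (\<lambda>a c. sw b (\<lambda>q s. sw q (\<lambda>p r. K (a \<odot> S (p \<odot> S r)) (c \<odot> S (S s)))))"
    by (simp add: coassoc S_mult m_assoc)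
  also have "\<dots> = sw f (\<lambda>a c. sw b (\<lambda>q s. K (a \<odot> S (et q)) (c \<odot> S (S s))))"
    by (intro sw_cong sw_antipode_t kl)
  also have "\<dots> = sw f (\<lambda>a c. sw one (\<lambda>u v. K (a \<odot> S (S u)) (c \<odot> S (S (v \<odot> b)))))"
    by (intro sw_cong sw_left_et kl)
  also have "\<dots> = sw f (\<lambda>a c. sw one (\<lambda>u v. K (a \<odot> S (S u)) (c \<odot> S (S v) \<odot> S (S b))))"
    by (simp add: S_mult m_assoc)
  also have "\<dots> = sw f (\<lambda>a c. sw (S (S one)) (\<lambda>u v. K (a \<odot> u) (c \<odot> v \<odot> S (S b))))"
    by (intro sw_cong sw_S_S[symmetric] kl)
  also have "\<dots> = sw f (\<lambda>a c. K a (c \<odot> S (S b)))"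
    unfolding S_one by (rule sw_one_mult_right) (intro kl)
  finally show ?thesis ..
qed

definition trace_form :: "('a \<Rightarrow> complex) \<Rightarrow> ('a \<Rightarrow> complex) \<Rightarrow> complex" where
  "trace_form h f = (\<Sum>i\<in>UNIV. (f \<odot> S (S (bas i)) \<odot> h) i)"

lemma lin_trace_form: "vlin g \<Longrightarrow> lin (\<lambda>x. trace_form h (g x))"
  unfolding trace_form_def by (intro lins' lin_comp[OF lin_coord])

text \<open>After the insertion, cyclicity of the trace moves the coproduct of $f S^2(b)$ to the summation variable,
where the antipode collapses it to $\varepsilon_t$.\<close>

lemma sw_trace_form:
  assumes G: "lin G"
  shows "sw f (\<lambda>a c. G a * trace_form (es y) c) =
    (\<Sum>j\<in>UNIV. sw (bas j) (\<lambda>a c. G (et a) * (f \<odot> S (S c) \<odot> es y) j))"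
proof -
  note kl = lins' lin_comp[OF G] lin_comp[OF lin_coord]
  define L where "L q = f \<odot> S (S q) \<odot> es y" for q
  have L: "vlin g \<Longrightarrow> vlin (\<lambda>x. L (g x))" for g :: "('a \<Rightarrow> complex) \<Rightarrow> _" unfolding L_def by (intro lins)
  have "sw f (\<lambda>a c. G a * trace_form (es y) c) = (\<Sum>i\<in>UNIV. sw f (\<lambda>a c. G a * (c \<odot> S (S (bas i)) \<odot> es y) i))"
    by (simp add: trace_form_def sum_distrib_left sw_sum)
  also have "\<dots> = (\<Sum>i\<in>UNIV. sw (bas i) (\<lambda>p q. sw (f \<odot> S (S q)) (\<lambda>a c. G (a \<odot> S p) * (c \<odot> es y) i)))"
    by (intro sum.cong refl sw_insert kl)
  also have "\<dots> = (\<Sum>i\<in>UNIV. sw (bas i) (\<lambda>p q. sw (L q) (\<lambda>a c. G (a \<odot> S p) * c i)))"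
    unfolding L_def by (intro sum.cong refl sw_cong sw_mult_es[symmetric] kl)
  \<comment> \<open>Expanding \<open>L q\<close> in the basis exposes a second trace index j.
    Summing over i afterwards replaces \<open>bas i\<close> by c, which is the cyclicity of the
    trace.\<close>
  also have "\<dots> = (\<Sum>i\<in>UNIV. sw (bas i) (\<lambda>p q. \<Sum>j\<in>UNIV. L q j * sw (bas j) (\<lambda>a c. G (a \<odot> S p) * c i)))"
    by (intro sum.cong refl sw_cong linD lins)
  also have "\<dots> = (\<Sum>i\<in>UNIV. \<Sum>j\<in>UNIV. sw (bas i) (\<lambda>p q. sw (bas j) (\<lambda>a c. c i * (L q j * G (a \<odot> S p)))))"
    unfolding sw_sum sw_mult_left[symmetric] by (simp add: mult_ac)
  also have "\<dots> = (\<Sum>j\<in>UNIV. \<Sum>i\<in>UNIV. sw (bas j) (\<lambda>a c. sw (bas i) (\<lambda>p q. c i * (L q j * G (a \<odot> S p)))))"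
    by (subst sum.swap) (intro sum.cong refl sw_swap)
  also have "\<dots> = (\<Sum>j\<in>UNIV. sw (bas j) (\<lambda>a c. \<Sum>i\<in>UNIV. c i * sw (bas i) (\<lambda>p q. L q j * G (a \<odot> S p))))"
    by (simp add: sw_sum sw_mult_left)
  also have "\<dots> = (\<Sum>j\<in>UNIV. sw (bas j) (\<lambda>a c. sw c (\<lambda>p q. L q j * G (a \<odot> S p))))"
    by (intro sum.cong refl sw_cong linD[symmetric] lins)
  also have "\<dots> = (\<Sum>j\<in>UNIV. sw (bas j) (\<lambda>a q. sw a (\<lambda>c p. L q j * G (c \<odot> S p))))"
    by (simp add: coassoc)
  also have "\<dots> = (\<Sum>j\<in>UNIV. sw (bas j) (\<lambda>a q. L q j * G (et a)))"
    by (intro sum.cong refl sw_cong sw_antipode_t kl)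
  finally show ?thesis by (simp add: L_def mult.commute)
qed

text \<open>The right side of \<open>sw_trace_form\<close> involves G only through
  \<open>G (et a)\<close>, and \<open>et\<close> is idempotent, so G may be replaced by its
  composition with \<open>et\<close>.\<close>

lemma left_integral_trace_form: "left_integral (trace_form (es y))"
proof -
  have "sw f (\<lambda>a b. G a * trace_form (es y) b) = sw f (\<lambda>a b. G (et a) * trace_form (es y) b)"
    if G: "lin G" for f G
    using sw_trace_form[OF G] sw_trace_form[of "\<lambda>x. G (et x)"] lin_comp[OF G vlin_et[OF lin_id]]
    by (simp add: et_et)
  then show ?thesis unfolding left_integral_def using lin_trace_form[OF lin_id] by auto
qed

end

section \<open>Semisimple weak Hopf algebras\<close>

text \<open>The algebra is a direct sum of matrix algebras with coordinates $\rho$ and matrix units $E$; fusion enters only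
through the vanishing of matrix coefficients and the decomposition of products of characters.\<close>

locale block_weak_hopf = weak_hopf m one D cu S sw
  for m :: "('i::finite \<Rightarrow> complex) \<Rightarrow> ('i \<Rightarrow> complex) \<Rightarrow> ('i \<Rightarrow> complex)" (infixl "\<odot>" 75)
    and one D cu S sw +
  fixes n :: "'r::finite \<Rightarrow> nat"
    and \<rho> :: "'r \<Rightarrow> nat \<Rightarrow> nat \<Rightarrow> ('i \<Rightarrow> complex) \<Rightarrow> complex"
    and E :: "'r \<Rightarrow> nat \<Rightarrow> nat \<Rightarrow> 'i \<Rightarrow> complex"
    and N :: "'r \<Rightarrow> 'r \<Rightarrow> 'r \<Rightarrow> nat"
    and vacs :: "'r set"
    and u v :: "'r \<Rightarrow> nat \<Rightarrow> complex"
    and l r :: "'r \<Rightarrow> 'r"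
  assumes n_pos: "n a > 0"
    and rho_lin: "lin (\<rho> a i j)"
    and rho_mult: "i < n a \<Longrightarrow> j < n a \<Longrightarrow> \<rho> a i j (f \<odot> g) = (\<Sum>h<n a. \<rho> a i h f * \<rho> a h j g)"
    and rho_one: "i < n a \<Longrightarrow> j < n a \<Longrightarrow> \<rho> a i j one = (if i = j then 1 else 0)"
    and rho_E: "i < n a \<Longrightarrow> j < n a \<Longrightarrow> i' < n b \<Longrightarrow> j' < n b \<Longrightarrow>
        \<rho> b i' j' (E a i j) = (if a = b \<and> i = i' \<and> j = j' then 1 else 0)"
    and rho_ext: "(\<And>a i j. i < n a \<Longrightarrow> j < n a \<Longrightarrow> \<rho> a i j f = \<rho> a i j g) \<Longrightarrow> f = g"
    and cu_rho: "cu f = (\<Sum>e\<in>vacs. \<Sum>i<n e. \<Sum>j<n e. u e i * \<rho> e i j f * v e j)"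
    and fusion_zero: "(\<And>c i j. N a b c \<noteq> 0 \<Longrightarrow> i < n c \<Longrightarrow> j < n c \<Longrightarrow> \<rho> c i j f = 0) \<Longrightarrow>
        i < n a \<Longrightarrow> j < n a \<Longrightarrow> i' < n b \<Longrightarrow> j' < n b \<Longrightarrow> sw f (\<lambda>p q. \<rho> a i j p * \<rho> b i' j' q) = 0"
    and fusion_trace: "sw f (\<lambda>p q. (\<Sum>i<n a. \<rho> a i i p) * (\<Sum>i<n b. \<rho> b i i q)) =
        (\<Sum>c\<in>UNIV. of_nat (N a b c) * (\<Sum>i<n c. \<rho> c i i f))"
    and l_vac: "l a \<in> vacs" and r_vac: "r a \<in> vacs"
    and N_left: "e \<in> vacs \<Longrightarrow> N e a c = (if e = l a \<and> a = c then 1 else 0)"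
    and N_right: "e \<in> vacs \<Longrightarrow> N a e c = (if e = r a \<and> a = c then 1 else 0)"
begin

section \<open>Characters, central idempotents and vacuum labels\<close>

definition tr :: "'r \<Rightarrow> ('i \<Rightarrow> complex) \<Rightarrow> complex" where
  "tr a f = (\<Sum>i<n a. \<rho> a i i f)"

lemma rho_comp: "vlin g \<Longrightarrow> lin (\<lambda>x. \<rho> a i j (g x))"
  by (rule lin_comp[OF rho_lin])
lemma tr_lin: "vlin g \<Longrightarrow> lin (\<lambda>x. tr a (g x))"
  unfolding tr_def by (intro lins rho_comp)

lemmas lins_rho = lins' rho_comp tr_lin

lemma tr_commute: "tr a (f \<odot> g) = tr a (g \<odot> f)"
proof -
  have "tr a (f \<odot> g) = (\<Sum>i<n a. \<Sum>h<n a. \<rho> a i h f * \<rho> a h i g)"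
    unfolding tr_def by (simp add: rho_mult)
  also have "\<dots> = tr a (g \<odot> f)"
    unfolding tr_def by (subst sum.swap) (simp add: rho_mult mult.commute)
  finally show ?thesis .
qed

definition scalar_on :: "'r \<Rightarrow> ('i \<Rightarrow> complex) \<Rightarrow> complex \<Rightarrow> bool" where
  "scalar_on a z c \<longleftrightarrow> (\<forall>i<n a. \<forall>j<n a. \<rho> a i j z = (if i = j then c else 0))"

lemma scalar_on_left: "scalar_on a z c \<Longrightarrow> i < n a \<Longrightarrow> j < n a \<Longrightarrow> \<rho> a i j (z \<odot> f) = c * \<rho> a i j f"
  by (simp add: rho_mult scalar_on_def if_distrib[of "\<lambda>x. x * _"] cong: if_cong)
lemma scalar_on_right: "scalar_on a z c \<Longrightarrow> i < n a \<Longrightarrow> j < n a \<Longrightarrow> \<rho> a i j (f \<odot> z) = c * \<rho> a i j f"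
  by (simp add: rho_mult scalar_on_def if_distrib[of "\<lambda>x. _ * x"] mult.commute cong: if_cong)
lemma scalar_on_tr: "scalar_on a z c \<Longrightarrow> tr a z = c * of_nat (n a)"
  by (simp add: tr_def scalar_on_def)
lemma scalar_on_tr_left: "scalar_on a z c \<Longrightarrow> tr a (z \<odot> f) = c * tr a f"
  by (simp add: tr_def scalar_on_left sum_distrib_left)
lemma scalar_on_tr_right: "scalar_on a z c \<Longrightarrow> tr a (f \<odot> z) = c * tr a f"
  unfolding tr_commute[of a f z] by (rule scalar_on_tr_left)

definition blk :: "'r \<Rightarrow> 'i \<Rightarrow> complex" where
  "blk a = (\<lambda>x. \<Sum>i<n a. E a i i x)"

lemma scalar_blk: "scalar_on b (blk a) (if a = b then 1 else 0)"
  unfolding scalar_on_def blk_def by (simp add: lin_sum[OF rho_lin] rho_E)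

lemma blk_central: "blk a \<odot> f = f \<odot> blk a"
  by (rule rho_ext) (simp add: scalar_on_left[OF scalar_blk] scalar_on_right[OF scalar_blk])

lemma cu_blk: "cu (blk e \<odot> f) = (if e \<in> vacs then \<Sum>i<n e. \<Sum>j<n e. u e i * \<rho> e i j f * v e j else 0)"
proof -
  have "cu (blk e \<odot> f) = (\<Sum>a\<in>vacs. if e = a then \<Sum>i<n a. \<Sum>j<n a. u a i * \<rho> a i j f * v a j else 0)"
    unfolding cu_rho by (intro sum.cong refl) (simp add: scalar_on_left[OF scalar_blk])
  then show ?thesis by (simp add: sum.delta finite_subset[OF subset_UNIV])
qed

lemma cu_sum_blk: "cu f = (\<Sum>e\<in>vacs. cu (blk e \<odot> f))"
  unfolding cu_rho[of f] by (simp add: cu_blk)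

lemma cu_scalar:
  assumes "\<And>e. e \<in> vacs \<Longrightarrow> scalar_on e z (s e)"
  shows "cu (z \<odot> f) = (\<Sum>e\<in>vacs. s e * cu (blk e \<odot> f))"
  unfolding cu_rho[of "z \<odot> f"]
  by (intro sum.cong refl) (simp add: cu_blk scalar_on_left[OF assms] sum_distrib_left mult_ac)

text \<open>On block e the counit is a combination of matrix coefficients, and e fused with a has no
  constituents when e differs from \<open>l a\<close>, so \<open>fusion_zero\<close> applies with a
  vacuous premise.\<close>

lemma left_vac_zero:
  assumes "e \<in> vacs" "e \<noteq> l a" "i < n a" "j < n a"
  shows "sw f (\<lambda>p q. cu (blk e \<odot> p) * \<rho> a i j q) = 0"
proof -
  have "sw f (\<lambda>p q. cu (blk e \<odot> p) * \<rho> a i j q) =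
    (\<Sum>i'<n e. \<Sum>j'<n e. u e i' * v e j' * sw f (\<lambda>p q. \<rho> e i' j' p * \<rho> a i j q))"
    unfolding sw_mult_left[symmetric] sw_sum[symmetric] cu_blk using assms(1)
    by (simp add: sum_distrib_right mult_ac sum_distrib_left)
  also have "\<dots> = 0"
  proof (intro sum.neutral ballI)
    fix i' j' assume "i' \<in> {..<n e}" "j' \<in> {..<n e}"
    then have "sw f (\<lambda>p q. \<rho> e i' j' p * \<rho> a i j q) = 0"
      using assms by (intro fusion_zero) (auto simp: N_left)
    then show "u e i' * v e j' * sw f (\<lambda>p q. \<rho> e i' j' p * \<rho> a i j q) = 0" by simp
  qed
  finally show ?thesis .
qed

lemma right_vac_zero:
  assumes "e \<in> vacs" "e \<noteq> r a" "i < n a" "j < n a"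
  shows "sw f (\<lambda>p q. \<rho> a i j p * cu (blk e \<odot> q)) = 0"
proof -
  have "sw f (\<lambda>p q. \<rho> a i j p * cu (blk e \<odot> q)) =
    (\<Sum>i'<n e. \<Sum>j'<n e. u e i' * v e j' * sw f (\<lambda>p q. \<rho> a i j p * \<rho> e i' j' q))"
    unfolding sw_mult_left[symmetric] sw_sum[symmetric] cu_blk using assms(1)
    by (simp add: sum_distrib_left mult_ac)
  also have "\<dots> = 0"
  proof (intro sum.neutral ballI)
    fix i' j' assume "i' \<in> {..<n e}" "j' \<in> {..<n e}"
    then have "sw f (\<lambda>p q. \<rho> a i j p * \<rho> e i' j' q) = 0"
      using assms by (intro fusion_zero) (auto simp: N_right)
    then show "u e i' * v e j' * sw f (\<lambda>p q. \<rho> a i j p * \<rho> e i' j' q) = 0" by simp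
  qed
  finally show ?thesis .
qed

lemma finite_vacs: "finite vacs" by simp

text \<open>The counit is the sum of its blocks; all except the block of \<open>l a\<close> drop out
  by \<open>left_vac_zero\<close>.\<close>

lemma left_vac:
  assumes e: "e \<in> vacs" and ij: "i < n a" "j < n a"
  shows "sw f (\<lambda>p q. cu (blk e \<odot> p) * \<rho> a i j q) = (if e = l a then \<rho> a i j f else 0)"
proof -
  have "\<rho> a i j f = sw f (\<lambda>p q. cu p * \<rho> a i j q)"
    by (rule counit_left[symmetric, OF rho_lin])
  also have "\<dots> = (\<Sum>e\<in>vacs. sw f (\<lambda>p q. cu (blk e \<odot> p) * \<rho> a i j q))"
    by (subst cu_sum_blk) (simp add: sum_distrib_right sw_sum)
  also have "\<dots> = sw f (\<lambda>p q. cu (blk (l a) \<odot> p) * \<rho> a i j q)"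
    using ij by (subst sum.remove[OF finite_vacs l_vac[of a]]) (simp add: left_vac_zero)
  finally show ?thesis using left_vac_zero[OF e _ ij] by auto
qed

lemma right_vac:
  assumes e: "e \<in> vacs" and ij: "i < n a" "j < n a"
  shows "sw f (\<lambda>p q. \<rho> a i j p * cu (blk e \<odot> q)) = (if e = r a then \<rho> a i j f else 0)"
proof -
  have "\<rho> a i j f = sw f (\<lambda>p q. \<rho> a i j p * cu q)"
    by (rule counit_right[symmetric, OF rho_lin])
  also have "\<dots> = (\<Sum>e\<in>vacs. sw f (\<lambda>p q. \<rho> a i j p * cu (blk e \<odot> q)))"
    by (subst cu_sum_blk) (simp add: sum_distrib_left sw_sum)
  also have "\<dots> = sw f (\<lambda>p q. \<rho> a i j p * cu (blk (r a) \<odot> q))"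
    using ij by (subst sum.remove[OF finite_vacs r_vac[of a]]) (simp add: right_vac_zero)
  finally show ?thesis using right_vac_zero[OF e _ ij] by auto
qed

text \<open>These central projectors detect the vacuum labels: questions about l and r become traces
  of \<open>et (blk e)\<close> and \<open>es (blk e)\<close>.\<close>

lemma scalar_et_blk: "e \<in> vacs \<Longrightarrow> scalar_on a (et (blk e)) (if e = l a then 1 else 0)"
  unfolding scalar_on_def by (simp add: lin_et[OF rho_lin] blk_central[symmetric] left_vac rho_one)

lemma scalar_es_blk: "e \<in> vacs \<Longrightarrow> scalar_on a (es (blk e)) (if e = r a then 1 else 0)"
  unfolding scalar_on_def by (simp add: lin_es[OF rho_lin] right_vac rho_one)

text \<open>\<open>N (l e) e e\<close> is 1 when read as fusion with the vacuum \<open>l e\<close>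
  on the left; read as fusion with the vacuum e on the right, this forces
  \<open>l e = e\<close>.\<close>

lemma l_vac_id: "e \<in> vacs \<Longrightarrow> l e = e"
  using N_left[OF l_vac[of e], of e e] N_right[of e "l e" e] by (metis zero_neq_one)

text \<open>\<open>es x\<close> depends only on the functional f -> cu(x f). Since l fixes the
  vacuums, \<open>et (blk e)\<close> and \<open>blk e\<close> act alike on every vacuum block and
  thus give the same functional.\<close>

lemma S_et_blk:
  assumes e: "e \<in> vacs"
  shows "S (et (blk e)) = es (blk e)"
proof -
  have "cu (et (blk e) \<odot> f) = (\<Sum>a\<in>vacs. (if e = a then 1 else 0) * cu (blk a \<odot> f))" for f
    by (rule cu_scalar) (use scalar_et_blk[OF e] l_vac_id in metis)
  then have "cu (et (blk e) \<odot> f) = cu (blk e \<odot> f)" for f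
    using e by (simp add: if_distrib[of "\<lambda>x. x * _"] sum.delta finite_vacs cong: if_cong)
  then show ?thesis by (simp add: S_et es_def)
qed

text \<open>The product of the characters of a and c is evaluated at
  \<open>et (blk (l b)) \<odot> blk b\<close>. Fusion gives N a c b times the dimension of b; since
  a target element enters only the first leg, the value vanishes unless
  \<open>l b = l a\<close>.\<close>

lemma fusion_l:
  assumes "N a c b \<noteq> 0"
  shows "l b = l a"
proof -
  have "sw (et (blk (l b)) \<odot> blk b) (\<lambda>x y. tr a x * tr c y) =
     (\<Sum>b'\<in>UNIV. of_nat (N a c b') * tr b' (et (blk (l b)) \<odot> blk b))"
    unfolding tr_def by (rule fusion_trace)
  also have "\<dots> = (\<Sum>b'\<in>UNIV. if b' = b then of_nat (N a c b * n b) else 0)"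
    by (intro sum.cong refl) (simp add: scalar_on_tr_left[OF scalar_et_blk[OF l_vac]] scalar_on_tr[OF scalar_blk])
  finally have 1: "sw (et (blk (l b)) \<odot> blk b) (\<lambda>x y. tr a x * tr c y) = of_nat (N a c b * n b)"
    by (simp add: sum.delta)
  have "sw (et (blk (l b)) \<odot> blk b) (\<lambda>x y. tr a x * tr c y) =
      sw (blk b) (\<lambda>x y. tr a (et (blk (l b)) \<odot> x) * tr c y)"
    by (rule sw_et_mult) (intro lins_rho)
  also have "\<dots> = (if l b = l a then 1 else 0) * sw (blk b) (\<lambda>x y. tr a x * tr c y)"
    by (simp add: scalar_on_tr_left[OF scalar_et_blk[OF l_vac]] sw_mult_left mult.assoc)
  finally show ?thesis using 1 assms n_pos[of b] by (auto split: if_splits)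
qed

text \<open>Otherwise applying $S \otimes \mathrm{id}$ and multiplying gives $\psi_c(\varepsilon_s(P)) = 0$ for the block
projector $P$ of $r_c$, although this matrix is the identity.\<close>

lemma fusion_conj_pos:
  assumes conj: "\<And>i j f. i < n c \<Longrightarrow> j < n c \<Longrightarrow>
      \<rho> c i j (S f) = (\<Sum>s<n c'. \<Sum>t<n c'. A i j s t * \<rho> c' s t f)"
  shows "N c' c (r c) \<noteq> 0"
proof
  assume 0: "N c' c (r c) = 0"
  let ?P = "blk (r c)"
  have z: "sw ?P (\<lambda>p q. \<rho> c' s t p * \<rho> c i j q) = 0" if "s < n c'" "t < n c'" "i < n c" "j < n c" for s t i j
    using scalar_blk 0 that by (intro fusion_zero) (auto simp: scalar_on_def)
  have "1 = \<rho> c 0 0 (es ?P)"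
    using scalar_es_blk[OF r_vac, of c c] n_pos[of c] by (simp add: scalar_on_def)
  also have "\<dots> = sw ?P (\<lambda>p q. \<rho> c 0 0 (S p \<odot> q))"
    by (rule sw_antipode_s[symmetric, OF rho_lin])
  also have "\<dots> = (\<Sum>h<n c. \<Sum>s<n c'. \<Sum>t<n c'. A 0 h s t * sw ?P (\<lambda>p q. \<rho> c' s t p * \<rho> c h 0 q))"
    unfolding sw_mult_left[symmetric] sw_sum[symmetric]
    by (simp add: rho_mult conj n_pos sum_distrib_right mult.assoc)
  also have "\<dots> = 0" by (simp add: z n_pos)
  finally show False by simp
qed

text \<open>Test the characters on \<open>et (blk (l a'))\<close>. Its trace on a' is nonzero, and S
  turns it into \<open>es (blk (l a'))\<close>, which acts on a as nonzero only if
  \<open>l a' = r a\<close>.\<close>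

lemma l_conj:
  assumes "\<And>f. tr a' f = tr a (S f)"
  shows "l a' = r a"
proof -
  have "tr a' (et (blk (l a'))) = tr a (es (blk (l a')))"
    by (simp add: assms S_et_blk l_vac)
  then show ?thesis
    using n_pos[of a'] by (simp add: scalar_on_tr[OF scalar_et_blk[OF l_vac]] scalar_on_tr[OF scalar_es_blk[OF l_vac]] split: if_splits)
qed

lemma rho_E_mult:
  assumes "i < n a" "j < n a" "i' < n a" "j' < n a"
  shows "\<rho> a i' j' (E a i j \<odot> z) = (if i = i' then \<rho> a j j' z else 0)"
proof -
  have "\<rho> a i' j' (E a i j \<odot> z) = (\<Sum>h<n a. if h = j then (if i = i' then \<rho> a j j' z else 0) else 0)"
    unfolding rho_mult[OF assms(3,4)] using assms by (intro sum.cong refl) (auto simp: rho_E)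
  then show ?thesis using assms by (simp add: sum.delta)
qed

lemma rho_mult_E:
  assumes "i < n a" "j < n a" "i' < n a" "j' < n a"
  shows "\<rho> a i' j' (z \<odot> E a i j) = (if j = j' then \<rho> a i' i z else 0)"
proof -
  have "\<rho> a i' j' (z \<odot> E a i j) = (\<Sum>h<n a. if h = i then (if j = j' then \<rho> a i' i z else 0) else 0)"
    unfolding rho_mult[OF assms(3,4)] using assms by (intro sum.cong refl) (auto simp: rho_E)
  then show ?thesis using assms by (simp add: sum.delta)
qed

text \<open>Commuting with the matrix units \<open>E a j 0\<close> compares every entry with the
  entry at (0, 0).\<close>

lemma central_scalar:
  assumes "\<And>f. f \<odot> z = z \<odot> f"
  shows "scalar_on a z (\<rho> a 0 0 z)"
  unfolding scalar_on_def
proof (intro allI impI)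
  fix i j assume i: "i < n a" and j: "j < n a"
  have "\<rho> a i 0 (E a j 0 \<odot> z) = \<rho> a i 0 (z \<odot> E a j 0)" using assms by simp
  then show "\<rho> a i j z = (if i = j then \<rho> a 0 0 z else 0)"
    using i j n_pos[of a] by (auto simp: rho_E_mult rho_mult_E split: if_splits)
qed

lemma scalar_on_sum:
  "(\<And>k. k \<in> K \<Longrightarrow> scalar_on a (z k) (s k)) \<Longrightarrow> scalar_on a (\<lambda>i. \<Sum>k\<in>K. c k * z k i) (\<Sum>k\<in>K. c k * s k)"
  unfolding scalar_on_def by (auto simp: lin_sum[OF rho_lin] lin_scale[OF rho_lin] sum.neutral)

text \<open>Passing from the coordinate basis to the matrix units turns the trace of z -> x z y into
  a sum over blocks; on a full matrix algebra it is the product of the two traces.\<close>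

lemma trace_two_sided: "(\<Sum>i\<in>UNIV. (x \<odot> bas i \<odot> y) i) = (\<Sum>a\<in>UNIV. tr a x * tr a y)"
proof -
  have ex: "z = (\<lambda>p. \<Sum>a\<in>UNIV. \<Sum>s<n a. \<Sum>t<n a. \<rho> a s t z * E a s t p)" for z
  proof (rule rho_ext)
    fix b i j assume i: "i < n b" and j: "j < n b"
    have "(\<Sum>s<n a. \<Sum>t<n a. \<rho> a s t z * \<rho> b i j (E a s t)) = (if a = b then \<rho> b i j z else 0)" for a
    proof (cases "a = b")
      case True
      have "(\<Sum>s<n b. \<Sum>t<n b. \<rho> b s t z * \<rho> b i j (E b s t)) = (\<Sum>s<n b. if s = i then \<rho> b i j z else 0)"
      proof (intro sum.cong refl)
        fix s assume "s \<in> {..<n b}"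
        then have "(\<Sum>t<n b. \<rho> b s t z * \<rho> b i j (E b s t)) = (\<Sum>t<n b. if t = j then (if s = i then \<rho> b i j z else 0) else 0)"
          using i j by (intro sum.cong refl) (auto simp: rho_E)
        then show "(\<Sum>t<n b. \<rho> b s t z * \<rho> b i j (E b s t)) = (if s = i then \<rho> b i j z else 0)"
          using j by (simp add: sum.delta)
      qed
      then show ?thesis using True i by (simp add: sum.delta)
    next
      case False
      then show ?thesis using i j by (simp add: rho_E)
    qed
    then show "\<rho> b i j z = \<rho> b i j (\<lambda>p. \<Sum>a\<in>UNIV. \<Sum>s<n a. \<Sum>t<n a. \<rho> a s t z * E a s t p)"
      by (simp add: lin_sum[OF rho_lin] lin_scale[OF rho_lin] sum.delta)
  qed
  have "(\<Sum>i\<in>UNIV. (x \<odot> bas i \<odot> y) i) =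
     (\<Sum>i\<in>UNIV. \<Sum>a\<in>UNIV. \<Sum>s<n a. \<Sum>t<n a. \<rho> a s t (x \<odot> bas i \<odot> y) * E a s t i)"
    by (intro sum.cong refl) (rule fun_cong[OF ex])
  also have "\<dots> = (\<Sum>a\<in>UNIV. \<Sum>s<n a. \<Sum>t<n a. \<Sum>i\<in>UNIV. E a s t i * \<rho> a s t (x \<odot> bas i \<odot> y))"
    by (subst sum.swap, intro sum.cong refl, subst sum.swap, intro sum.cong refl, subst sum.swap)
      (simp add: mult.commute)
  also have "\<dots> = (\<Sum>a\<in>UNIV. \<Sum>s<n a. \<Sum>t<n a. \<rho> a s t (x \<odot> E a s t \<odot> y))"
    by (intro sum.cong refl linD[symmetric] lins_rho)
  also have "\<dots> = (\<Sum>a\<in>UNIV. \<Sum>s<n a. \<Sum>t<n a. \<rho> a s s x * \<rho> a t t y)"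
    by (intro sum.cong refl) (simp add: rho_mult[of _ _ _ "x \<odot> _"] rho_mult_E if_distrib[of "\<lambda>x. x * _"] sum.delta' cong: if_cong)
  finally show ?thesis by (simp add: tr_def sum_product)
qed

end

section \<open>Spherical elements\<close>

locale spherical_weak_hopf = block_weak_hopf m one D cu S sw n \<rho> E N vacs u v l r
    + pivotal_weak_hopf m one D cu S sw k ki
  for m :: "('i::finite \<Rightarrow> complex) \<Rightarrow> ('i \<Rightarrow> complex) \<Rightarrow> ('i \<Rightarrow> complex)" (infixl "\<odot>" 75)
    and one D cu S sw
    and n :: "'r::finite \<Rightarrow> nat" and \<rho> E N vacs u v l r k ki +
  fixes bar :: "'r \<Rightarrow> 'r"
  assumes cu_blk_nonzero: "e \<in> vacs \<Longrightarrow> cu (blk e) \<noteq> 0"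
    and spherical: "tr a k / cu (blk (l a)) = tr a ki / cu (blk (r a))"
    and tr_k_nonzero: "tr a k \<noteq> 0"
    and tr_bar: "tr (bar a) f = tr a (S f)"
    and bar_bar: "bar (bar a) = a"
begin

text \<open>Twisting the character by k yields \<open>phi_twist\<close>, the property that
  \<open>partial_cu_central\<close> requires.\<close>

definition \<phi> :: "'r \<Rightarrow> ('i \<Rightarrow> complex) \<Rightarrow> complex" where
  "\<phi> a f = tr a (f \<odot> k)"

definition p :: "'r \<Rightarrow> complex" where
  "p a = tr a k / cu (blk (l a))"

lemma phi_comp: "vlin g \<Longrightarrow> lin (\<lambda>x. \<phi> a (g x))"
  unfolding \<phi>_def by (intro lins_rho)

lemmas lins_phi = lins_rho phi_comp

lemma p_nonzero: "p a \<noteq> 0"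
  by (simp add: p_def tr_k_nonzero cu_blk_nonzero l_vac)

lemma tr_k: "tr a k = p a * cu (blk (l a))"
  by (simp add: p_def cu_blk_nonzero l_vac)

lemma tr_ki: "tr a ki = p a * cu (blk (r a))"
  using spherical[of a] by (simp add: p_def cu_blk_nonzero r_vac l_vac field_simps)

lemma phi_twist: "\<phi> a (g \<odot> f) = \<phi> a (f \<odot> S (S g))"
  using tr_commute[of a g "f \<odot> k"] unfolding \<phi>_def S_S by (simp add: m_assoc ki_inv one_right)

text \<open>Since \<open>partial_cu (\<phi> a)\<close> is central, it acts on each vacuum block by a
  scalar, so on the target subalgebra \<phi> is a combination of the blocks of the counit.\<close>

lemma phi_et: "\<phi> a (et z) = p a * cu (blk (l a) \<odot> z)"
proof -
  let ?q = "partial_cu (\<phi> a)"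
  let ?s = "\<lambda>b. \<rho> b 0 0 ?q"
  have lin: "lin (\<phi> a)" using phi_comp[OF lin_id] .
  have "scalar_on b ?q (?s b)" for b
    by (rule central_scalar) (rule partial_cu_central[OF lin phi_twist])
  then have 1: "\<phi> a (et z) = (\<Sum>e\<in>vacs. ?s e * cu (blk e \<odot> z))" for z
    by (subst cu_partial_cu[OF lin, symmetric]) (rule cu_scalar)
  \<comment> \<open>Taking z = \<open>blk e\<close> isolates one scalar; the value is known because
    \<open>et (blk e)\<close> is a projector that acts on block a by 0 or 1.\<close>
  have 2: "?s e * cu (blk e) = (if e = l a then p a * cu (blk e) else 0)" if e: "e \<in> vacs" for e
  proof -
    have "cu (blk e' \<odot> blk e) = (if e' = e then cu (blk e) else 0)" for e'
    proof -
      have "blk e' \<odot> blk e = (if e' = e then blk e else (\<lambda>_. 0))"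
        by (rule rho_ext) (use scalar_blk in \<open>auto simp: scalar_on_left[OF scalar_blk] scalar_on_def lin_zero[OF rho_lin]\<close>)
      then show ?thesis using lin_zero[OF cu_lin] by auto
    qed
    then have "?s e * cu (blk e) = \<phi> a (et (blk e))"
      using e by (simp add: 1 if_distrib[of "\<lambda>x. _ * x"] sum.delta finite_vacs cong: if_cong)
    also have "\<dots> = (if e = l a then 1 else 0) * tr a k"
      unfolding \<phi>_def by (rule scalar_on_tr_left[OF scalar_et_blk[OF e]])
    finally show ?thesis by (simp add: tr_k)
  qed
  have "?s e = (if e = l a then p a else 0)" if "e \<in> vacs" for e
    using 2[OF that] cu_blk_nonzero[OF that] by (auto split: if_splits)
  then have "\<phi> a (et z) = (\<Sum>e\<in>vacs. if e = l a then p a * cu (blk e \<odot> z) else 0)"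
    unfolding 1 by (intro sum.cong refl) auto
  then show ?thesis using l_vac[of a] by (simp add: sum.delta finite_vacs)
qed

lemma left_integral_weighted: "left_integral (\<lambda>f. \<Sum>a\<in>UNIV. \<gamma> (r a) * p a * \<phi> a f)"
proof -
  \<comment> \<open>With this choice \<open>es y\<close> acts on block a by
    \<open>\<gamma> (r a) / cu (blk (r a))\<close>; the denominator cancels against the factor
    \<open>cu (blk (r a))\<close> of \<open>tr_ki\<close>.\<close>
  define y where "y = (\<lambda>i. \<Sum>e\<in>vacs. (\<gamma> e / cu (blk e)) * blk e i)"
  have es: "es y = (\<lambda>i. \<Sum>e\<in>vacs. (\<gamma> e / cu (blk e)) * es (blk e) i)"
  proof
    fix i
    have "lin (\<lambda>x. es x i)" by (rule lin_comp[OF lin_coord]) (rule vlin_es[OF lin_id])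
    then show "es y i = (\<Sum>e\<in>vacs. (\<gamma> e / cu (blk e)) * es (blk e) i)"
      unfolding y_def by (simp only: lin_sum[of "\<lambda>x. es x i"] lin_scale[of "\<lambda>x. es x i"])
  qed
  have "scalar_on a (es y) (\<Sum>e\<in>vacs. (\<gamma> e / cu (blk e)) * (if e = r a then 1 else 0))" for a
    unfolding es by (rule scalar_on_sum) (rule scalar_es_blk)
  then have sc: "scalar_on a (es y) (\<gamma> (r a) / cu (blk (r a)))" for a
    by (simp add: if_distrib[of "\<lambda>x. _ * x"] sum.delta finite_vacs r_vac cong: if_cong)
  have "trace_form (es y) f = (\<Sum>a\<in>UNIV. \<gamma> (r a) * p a * \<phi> a f)" for f
  proof -
    have "trace_form (es y) f = (\<Sum>i\<in>UNIV. (f \<odot> k \<odot> bas i \<odot> (ki \<odot> es y)) i)"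
      unfolding trace_form_def S_S by (simp add: m_assoc)
    also have "\<dots> = (\<Sum>a\<in>UNIV. \<phi> a f * tr a (ki \<odot> es y))"
      by (simp add: trace_two_sided \<phi>_def)
    also have "\<dots> = (\<Sum>a\<in>UNIV. \<gamma> (r a) * p a * \<phi> a f)"
      by (intro sum.cong refl) (simp add: scalar_on_tr_right[OF sc] tr_ki cu_blk_nonzero r_vac)
    finally show ?thesis .
  qed
  then have "trace_form (es y) = (\<lambda>f. \<Sum>a\<in>UNIV. \<gamma> (r a) * p a * \<phi> a f)" by (rule ext)
  then show ?thesis using left_integral_trace_form[of y] by (simp only:)
qed

lemma sw_cu_blk_phi:
  assumes e: "e \<in> vacs"
  shows "sw f (\<lambda>x y. cu (blk e \<odot> x) * \<phi> b y) = (if e = l b then \<phi> b f else 0)"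
proof -
  have ph: "\<phi> b y = (\<Sum>i<n b. \<Sum>h<n b. \<rho> b h i k * \<rho> b i h y)" for y
    unfolding \<phi>_def tr_def by (simp add: rho_mult mult.commute)
  have "sw f (\<lambda>x y. cu (blk e \<odot> x) * \<phi> b y) =
     (\<Sum>i<n b. \<Sum>h<n b. \<rho> b h i k * sw f (\<lambda>x y. cu (blk e \<odot> x) * \<rho> b i h y))"
    unfolding sw_mult_left[symmetric] sw_sum[symmetric] ph by (simp add: sum_distrib_left mult_ac)
  also have "\<dots> = (if e = l b then \<phi> b f else 0)"
    by (simp add: left_vac[OF e] ph)
  finally show ?thesis .
qed

text \<open>Group-likeness of k lets both twists come from a single factor k in the argument, so
  twisted characters multiply as the characters do.\<close>

lemma sw_phi_phi: "sw f (\<lambda>x y. \<phi> a x * \<phi> c y) = (\<Sum>b\<in>UNIV. of_nat (N a c b) * \<phi> b f)"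
proof -
  have "sw f (\<lambda>x y. \<phi> a x * \<phi> c y) = sw (f \<odot> k) (\<lambda>x y. tr a x * tr c y)"
    unfolding \<phi>_def by (rule sw_mult_k[symmetric]) (intro lins_rho)
  then show ?thesis unfolding tr_def fusion_trace by (simp add: \<phi>_def tr_def)
qed

text \<open>These elements are dual to the twisted characters; evaluating at them reads off
  coefficients.\<close>

lemma phi_dual:
  shows "\<phi> b (E a 0 0 \<odot> ki) = (if a = b then 1 else 0)"
proof -
  have "tr b (E a 0 0) = (\<Sum>i<n b. if i = 0 then (if a = b then 1 else 0) else 0)"
    unfolding tr_def by (intro sum.cong refl) (auto simp: rho_E n_pos)
  then show ?thesis unfolding \<phi>_def by (simp add: m_assoc ki_inv one_right sum.delta n_pos)
qed

text \<open>\<open>\<Lambda>\<close> is the integral with all weights 1. Multiplied by \<phi>_a, it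
  expands by fusion on one side; on the other, the integral property reduces \<phi>_a to
  \<open>phi_et\<close>, that is, to p_a times the projection onto left vacuum \<open>l a\<close>.
  The two coefficients of \<phi>_b are compared.\<close>

lemma fusion_p_source: "(\<Sum>c\<in>UNIV. of_nat (N a c b) * p c) = (if l a = l b then p a * p b else 0)"
proof -
  define \<Lambda> where "\<Lambda> f = (\<Sum>c\<in>UNIV. p c * \<phi> c f)" for f
  have \<Lambda>: "left_integral \<Lambda>"
    using left_integral_weighted[of "\<lambda>_. 1"] unfolding \<Lambda>_def by simp
  define f where "f = E b 0 0 \<odot> ki"
  have "(\<Sum>c\<in>UNIV. of_nat (N a c b) * p c) = (\<Sum>c\<in>UNIV. p c * sw f (\<lambda>x y. \<phi> a x * \<phi> c y))"
    unfolding sw_phi_phi f_def phi_dual by (simp add: if_distrib[of "\<lambda>x. _ * x"] sum.delta mult.commute cong: if_cong)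
  also have "\<dots> = sw f (\<lambda>x y. \<phi> a x * \<Lambda> y)"
    unfolding sw_mult_left[symmetric] sw_sum[symmetric] \<Lambda>_def by (simp add: sum_distrib_left mult_ac)
  also have "\<dots> = sw f (\<lambda>x y. \<phi> a (et x) * \<Lambda> y)"
    using \<Lambda> phi_comp[OF lin_id] unfolding left_integral_def by blast
  also have "\<dots> = (\<Sum>c\<in>UNIV. p a * p c * sw f (\<lambda>x y. cu (blk (l a) \<odot> x) * \<phi> c y))"
    unfolding sw_mult_left[symmetric] sw_sum[symmetric] \<Lambda>_def phi_et by (simp add: sum_distrib_left mult_ac)
  also have "\<dots> = (\<Sum>c\<in>UNIV. if b = c then (if l a = l b then p a * p b else 0) else 0)"
    unfolding sw_cu_blk_phi[OF l_vac] f_def phi_dual by (intro sum.cong refl) auto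
  finally show ?thesis by simp
qed

lemma fusion_p_target: "(\<Sum>b\<in>UNIV. of_nat (N a c b) * p b) = (if r a = l c then p a * p c else 0)"
proof -
  have "(\<Sum>b\<in>UNIV. of_nat (N a c b) * p b) * cu (blk (l a)) = (\<Sum>b\<in>UNIV. of_nat (N a c b) * tr b k)"
    unfolding sum_distrib_right
  proof (intro sum.cong refl)
    \<comment> \<open>By \<open>fusion_l\<close> every b that occurs has left vacuum
      \<open>l a\<close>, so the same normalising factor turns each p b into a trace of k.\<close>
    fix b show "of_nat (N a c b) * p b * cu (blk (l a)) = of_nat (N a c b) * tr b k"
      using fusion_l[of a c b] by (cases "N a c b = 0") (simp_all add: tr_k)
  qed
  also have "\<dots> = sw one (\<lambda>x y. \<phi> a x * \<phi> c y)"
    unfolding sw_phi_phi by (simp add: \<phi>_def one_left)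
  also have "\<dots> = sw one (\<lambda>x y. \<phi> a x * \<phi> c (et y))"
    by (rule sw_one_et[symmetric]) (intro lins_phi)
  also have "\<dots> = p c * sw one (\<lambda>x y. \<phi> a x * cu (blk (l c) \<odot> y))"
    unfolding phi_et sw_mult_left[symmetric] by (simp add: mult_ac)
  also have "\<dots> = p c * \<phi> a (es (blk (l c)))"
    using lin_es[OF phi_comp[OF lin_id], of a "blk (l c)"] by simp
  also have "\<dots> = p c * ((if l c = r a then 1 else 0) * tr a k)"
    unfolding \<phi>_def scalar_on_tr_left[OF scalar_es_blk[OF l_vac]] ..
  finally show ?thesis using cu_blk_nonzero[OF l_vac[of a]] by (auto simp: tr_k split: if_splits)
qed

text \<open>Moduli make positivity immediate; the agreement with the sum of the p^2 in \<Omega> is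
  available only after p is known to be real.\<close>

definition nsq :: "'r \<Rightarrow> real" where
  "nsq e = (\<Sum>x\<in>{x. l x = e}. (cmod (p x))\<^sup>2)"

lemma cnj_p_p: "cnj (p x) * p x = complex_of_real ((cmod (p x))\<^sup>2)"
  by (metis complex_norm_square mult.commute of_real_power)

text \<open>Both sides equal $\sum_{b,c} \overline{p_b} N_{ac}^b p_c$.\<close>

lemma p_nsq: "p a * complex_of_real (nsq (l a)) = cnj (p a) * complex_of_real (nsq (r a))"
proof -
  have nsq: "complex_of_real (nsq e) = (\<Sum>x\<in>UNIV. if l x = e then cnj (p x) * p x else 0)" for e
    unfolding nsq_def cnj_p_p of_real_sum by (simp add: sum.If_cases)
  have "p a * complex_of_real (nsq (l a)) = (\<Sum>b\<in>UNIV. cnj (p b) * (\<Sum>c\<in>UNIV. of_nat (N a c b) * p c))"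
    unfolding fusion_p_source nsq sum_distrib_left by (intro sum.cong refl) auto
  also have "\<dots> = (\<Sum>b\<in>UNIV. \<Sum>c\<in>UNIV. p c * (of_nat (N a c b) * cnj (p b)))"
    by (simp add: sum_distrib_left mult_ac)
  \<comment> \<open>The multiplicities are natural numbers, so complex conjugation can be pulled out
    of the sum over b.\<close>
  also have "\<dots> = (\<Sum>c\<in>UNIV. p c * cnj (\<Sum>b\<in>UNIV. of_nat (N a c b) * p b))"
    by (subst sum.swap) (simp add: sum_distrib_left)
  also have "\<dots> = cnj (p a) * complex_of_real (nsq (r a))"
    unfolding fusion_p_target nsq sum_distrib_left by (intro sum.cong refl) auto
  finally show ?thesis .
qed

lemma nsq_pos: "e \<in> vacs \<Longrightarrow> nsq e > 0"
  unfolding nsq_def by (rule sum_pos2[of _ e]) (auto simp: l_vac_id p_nonzero)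

text \<open>Take moduli in \<open>p_nsq\<close>. Substituting the result back into
  \<open>p_nsq\<close> then yields \<open>p_real\<close>.\<close>

lemma nsq_l_r: "nsq (l a) = nsq (r a)"
proof -
  have "cmod (p a) * nsq (l a) = cmod (p a) * nsq (r a)"
    using arg_cong[OF p_nsq[of a], of cmod] nsq_pos[OF l_vac[of a]] nsq_pos[OF r_vac[of a]]
    by (simp add: norm_mult)
  then show ?thesis using p_nonzero[of a] by simp
qed

lemma p_real: "cnj (p a) = p a"
  using p_nsq[of a] nsq_pos[OF l_vac[of a]] by (simp add: nsq_l_r)

lemma nsq_eq: "complex_of_real (nsq e) = (\<Sum>x\<in>{x. l x = e}. (p x)\<^sup>2)"
  unfolding nsq_def of_real_sum
  by (intro sum.cong refl) (metis cnj_p_p p_real power2_eq_square)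

text \<open>The functional f -> f(\<Omega>) of the theorem, with d_x^2 and d_a / \<xi>_a replaced by
  p_x^2 and p_a.\<close>

definition \<Omega> :: "('i \<Rightarrow> complex) \<Rightarrow> complex" where
  "\<Omega> f = (\<Sum>a\<in>UNIV. (1 / (\<Sum>x\<in>{x. l x = l a}. (p x)\<^sup>2)) * p a * tr a f)"

lemma Omega_alt: "\<Omega> f = (\<Sum>a\<in>UNIV. (1 / complex_of_real (nsq (l a))) * p a * tr a f)"
  by (simp add: \<Omega>_def nsq_eq)

lemma Omega_comp: "vlin g \<Longrightarrow> lin (\<lambda>x. \<Omega> (g x))"
  unfolding \<Omega>_def by (intro lins_rho)

lemma left_integral_Omega: "left_integral (\<lambda>f. \<Omega> (f \<odot> k))"
  using left_integral_weighted[of "\<lambda>e. 1 / complex_of_real (nsq e)"]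
  by (simp add: Omega_alt \<phi>_def nsq_l_r)

text \<open>\<open>phi_et\<close> contributes a second factor p_a, and over each class of labels
  with the same left vacuum the squares add up to the normaliser.\<close>

lemma Omega_et: "\<Omega> (et f \<odot> k) = cu f"
proof -
  have "\<Omega> (et f \<odot> k) = (\<Sum>a\<in>UNIV. (1 / complex_of_real (nsq (l a))) * cu (blk (l a) \<odot> f) * (p a)\<^sup>2)"
    unfolding Omega_alt \<phi>_def[symmetric] phi_et by (simp add: power2_eq_square mult_ac)
  also have "\<dots> = (\<Sum>e\<in>vacs. \<Sum>a\<in>{a. l a = e}. (1 / complex_of_real (nsq e)) * cu (blk e \<odot> f) * (p a)\<^sup>2)"
    using sum.group[of UNIV vacs l "\<lambda>a. (1 / complex_of_real (nsq (l a))) * cu (blk (l a) \<odot> f) * (p a)\<^sup>2"] l_vac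
    by (auto intro!: sum.cong simp: image_subset_iff)
  also have "\<dots> = (\<Sum>e\<in>vacs. cu (blk e \<odot> f))"
  proof (intro sum.cong refl)
    fix e assume "e \<in> vacs"
    then have "nsq e \<noteq> 0" using nsq_pos[of e] by simp
    then show "(\<Sum>a\<in>{a. l a = e}. (1 / complex_of_real (nsq e)) * cu (blk e \<odot> f) * (p a)\<^sup>2) = cu (blk e \<odot> f)"
      unfolding sum_distrib_left[symmetric] nsq_eq[symmetric] by simp
  qed
  finally show ?thesis by (simp flip: cu_sum_blk)
qed

text \<open>After moving the inverse of k into the argument, the integral property and
  \<open>Omega_et\<close> replace one factor \<Omega> by the counit.\<close>

lemma Omega_idem: "sw f (\<lambda>x y. \<Omega> x * \<Omega> y) = \<Omega> f"
proof -
  let ?L = "\<lambda>f. \<Omega> (f \<odot> k)"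
  have l: "lin ?L" by (intro lins' Omega_comp)
  have "sw f (\<lambda>x y. \<Omega> x * \<Omega> y) = sw f (\<lambda>x y. ?L (x \<odot> ki) * ?L (y \<odot> ki))"
    by (simp add: m_assoc ki_inv one_right)
  also have "\<dots> = sw (f \<odot> ki) (\<lambda>x y. ?L x * ?L y)"
    by (rule sw_mult_ki[symmetric]) (intro lins' Omega_comp)
  also have "\<dots> = sw (f \<odot> ki) (\<lambda>x y. ?L (et x) * ?L y)"
    using left_integral_Omega l unfolding left_integral_def by blast
  also have "\<dots> = ?L (f \<odot> ki)"
    unfolding Omega_et by (rule counit_left[OF l])
  finally show ?thesis by (simp add: m_assoc ki_inv one_right)
qed

text \<open>This becomes the pulling-through identity. The integral shift is applied to g times the
  inverse of k; as that inverse appears in both legs of the coproduct, G must carry a compensating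
  factor k, which survives as the k in \<open>G (S a \<odot> k)\<close>.\<close>

lemma Omega_shift:
  assumes G: "lin G"
  shows "sw g (\<lambda>a b. G a * \<Omega> (f \<odot> b)) = sw f (\<lambda>a b. G (S a \<odot> k) * \<Omega> (b \<odot> g))"
proof -
  let ?L = "\<lambda>f. \<Omega> (f \<odot> k)"
  note kl = lins' lin_comp[OF G] Omega_comp
  have "sw f (\<lambda>a b. G (S a \<odot> k) * \<Omega> (b \<odot> g)) = sw f (\<lambda>a b. G (S a \<odot> k) * ?L (b \<odot> (g \<odot> ki)))"
    by (simp add: m_assoc ki_inv one_right)
  also have "\<dots> = sw (g \<odot> ki) (\<lambda>a b. G (a \<odot> k) * ?L (f \<odot> b))"
    by (rule left_integral_shift[OF left_integral_Omega, symmetric]) (intro kl)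
  also have "\<dots> = sw g (\<lambda>a b. G (a \<odot> ki \<odot> k) * ?L (f \<odot> (b \<odot> ki)))"
    by (rule sw_mult_ki) (intro kl)
  finally show ?thesis by (simp add: m_assoc ki_inv one_right)
qed

lemma Omega_commute: "\<Omega> (f \<odot> g) = \<Omega> (g \<odot> f)"
  unfolding \<Omega>_def tr_commute[of _ f g] ..

lemma l_bar: "l (bar a) = r a"
  by (rule l_conj) (rule tr_bar)

text \<open>By sphericity, p_a can also be computed from the inverse of k, which is S(k), at the
  right vacuum of a; the latter is the left vacuum of bar a.\<close>

lemma p_bar: "p (bar a) = p a"
  using tr_ki[of a] cu_blk_nonzero[OF r_vac[of a]] by (simp add: p_def[of "bar a"] l_bar tr_bar S_k)

lemma Omega_S: "\<Omega> (S f) = \<Omega> f"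
proof -
  have "\<Omega> (S f) = (\<Sum>a\<in>UNIV. (1 / complex_of_real (nsq (l (bar a)))) * p (bar a) * tr (bar a) f)"
    by (simp add: Omega_alt tr_bar l_bar nsq_l_r p_bar)
  also have "\<dots> = \<Omega> f"
    unfolding Omega_alt by (rule sum.reindex_bij_witness[of _ bar bar]) (auto simp: bar_bar)
  finally show ?thesis .
qed

text \<open>Every character has a nonzero coefficient in \<Omega>, so multiplication by matrix units
  recovers all coordinates of f.\<close>

lemma Omega_nondegenerate:
  assumes "\<And>g. \<Omega> (f \<odot> g) = 0"
  shows "f = (\<lambda>_. 0)"
proof (rule rho_ext)
  fix a i j assume i: "i < n a" and j: "j < n a"
  have t: "tr b (f \<odot> E a j i) = (if b = a then \<rho> a i j f else 0)" for b
  proof -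
    have "\<rho> b h h (f \<odot> E a j i) = (if h = i then (if b = a then \<rho> a i j f else 0) else 0)" if "h < n b" for h
      using that i j by (cases "b = a") (auto simp: rho_mult_E, simp_all add: rho_mult rho_E)
    then show ?thesis using i unfolding tr_def by (auto simp: sum.delta)
  qed
  have "\<Omega> (f \<odot> E a j i) = (1 / complex_of_real (nsq (l a))) * p a * \<rho> a i j f"
    unfolding Omega_alt t by (simp add: if_distrib[of "\<lambda>x. _ * x"] sum.delta cong: if_cong)
  then show "\<rho> a i j f = \<rho> a i j (\<lambda>_. 0)"
    using assms[of "E a j i"] p_nonzero[of a] nsq_pos[OF l_vac[of a]] by (simp add: lin_zero[OF rho_lin])
qed

end

section \<open>The dual of a weak Hopf algebra\<close>

lemma lin_ext:
  assumes "lin F" "lin G" "\<And>i. F (bas i) = G (bas i)"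
  shows "F x = G x"
  using linD[OF assms(1), of x] linD[OF assms(2), of x] assms(3) by simp

lemma sum4_rot: "(\<Sum>p\<in>P. \<Sum>q\<in>Q. \<Sum>r\<in>R. \<Sum>s\<in>S. X p q r s) = (\<Sum>r\<in>R. \<Sum>s\<in>S. \<Sum>q\<in>Q. \<Sum>p\<in>P. X p q r s)"
proof -
  have "(\<Sum>p\<in>P. \<Sum>q\<in>Q. \<Sum>r\<in>R. \<Sum>s\<in>S. X p q r s) = (\<Sum>q\<in>Q. \<Sum>r\<in>R. \<Sum>s\<in>S. \<Sum>p\<in>P. X p q r s)"
    by (subst sum.swap, rule sum.cong[OF refl], subst sum.swap, rule sum.cong[OF refl], rule sum.swap)
  also have "\<dots> = (\<Sum>r\<in>R. \<Sum>s\<in>S. \<Sum>q\<in>Q. \<Sum>p\<in>P. X p q r s)"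
    by (subst sum.swap, rule sum.cong[OF refl], rule sum.swap)
  finally show ?thesis .
qed

lemma sum3_front: "(\<Sum>q\<in>Q. \<Sum>r\<in>R. \<Sum>s\<in>S. X q r s) = (\<Sum>s\<in>S. \<Sum>q\<in>Q. \<Sum>r\<in>R. X q r s)"
proof -
  have "(\<Sum>q\<in>Q. \<Sum>r\<in>R. \<Sum>s\<in>S. X q r s) = (\<Sum>q\<in>Q. \<Sum>s\<in>S. \<Sum>r\<in>R. X q r s)"
    by (rule sum.cong[OF refl], rule sum.swap)
  also have "\<dots> = (\<Sum>s\<in>S. \<Sum>q\<in>Q. \<Sum>r\<in>R. X q r s)" by (rule sum.swap)
  finally show ?thesis .
qed

lemma sum4_front: "(\<Sum>p\<in>P. \<Sum>q\<in>Q. \<Sum>r\<in>R. \<Sum>s\<in>S. X p q r s) = (\<Sum>s\<in>S. \<Sum>p\<in>P. \<Sum>q\<in>Q. \<Sum>r\<in>R. X p q r s)"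
proof -
  have "(\<Sum>p\<in>P. \<Sum>q\<in>Q. \<Sum>r\<in>R. \<Sum>s\<in>S. X p q r s) = (\<Sum>p\<in>P. \<Sum>s\<in>S. \<Sum>q\<in>Q. \<Sum>r\<in>R. X p q r s)"
    by (rule sum.cong[OF refl], rule sum3_front)
  also have "\<dots> = (\<Sum>s\<in>S. \<Sum>p\<in>P. \<Sum>q\<in>Q. \<Sum>r\<in>R. X p q r s)" by (rule sum.swap)
  finally show ?thesis .
qed

lemma sum4_perm: "(\<Sum>p\<in>P. \<Sum>q\<in>Q. \<Sum>r\<in>R. \<Sum>s\<in>S. X p q r s) = (\<Sum>q\<in>Q. \<Sum>s\<in>S. \<Sum>r\<in>R. \<Sum>p\<in>P. X p q r s)"
proof -
  have "(\<Sum>p\<in>P. \<Sum>q\<in>Q. \<Sum>r\<in>R. \<Sum>s\<in>S. X p q r s) = (\<Sum>q\<in>Q. \<Sum>p\<in>P. \<Sum>r\<in>R. \<Sum>s\<in>S. X p q r s)"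
    by (rule sum.swap)
  also have "\<dots> = (\<Sum>q\<in>Q. \<Sum>s\<in>S. \<Sum>p\<in>P. \<Sum>r\<in>R. X p q r s)"
    by (rule sum.cong[OF refl], rule sum3_front)
  also have "\<dots> = (\<Sum>q\<in>Q. \<Sum>s\<in>S. \<Sum>r\<in>R. \<Sum>p\<in>P. X p q r s)"
    by (intro sum.cong[OF refl] sum.swap)
  finally show ?thesis .
qed

lemma lin_coords: "lin G \<Longrightarrow> G z = (\<Sum>t\<in>UNIV. G (bas t) * z t)"
  by (subst linD) (simp_all add: mult.commute)

lemma bilin_coords: "bilin K \<Longrightarrow> K y z = (\<Sum>t\<in>UNIV. \<Sum>t'\<in>UNIV. K (bas t) (bas t') * (y t * z t'))"
proof -
  assume K: "bilin K"
  have "K y z = (\<Sum>t\<in>UNIV. K (bas t) z * y t)"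
    by (rule lin_coords) (use K in \<open>simp add: bilin_def\<close>)
  also have "\<dots> = (\<Sum>t\<in>UNIV. (\<Sum>t'\<in>UNIV. K (bas t) (bas t') * z t') * y t)"
    by (intro sum.cong refl arg_cong[where f="\<lambda>x. x * _"] lin_coords) (use K in \<open>simp add: bilin_def\<close>)
  finally show ?thesis by (simp add: sum_distrib_right sum_distrib_left mult_ac)
qed

lemma trilin_coords: "trilin F \<Longrightarrow> F x y z = (\<Sum>s\<in>UNIV. \<Sum>t\<in>UNIV. \<Sum>t'\<in>UNIV. F (bas s) (bas t) (bas t') * (x s * (y t * z t')))"
proof -
  assume F: "trilin F"
  have "F x y z = (\<Sum>s\<in>UNIV. F (bas s) y z * x s)"
    by (rule lin_coords) (use F in \<open>simp add: trilin_def\<close>)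
  also have "\<dots> = (\<Sum>s\<in>UNIV. (\<Sum>t\<in>UNIV. \<Sum>t'\<in>UNIV. F (bas s) (bas t) (bas t') * (y t * z t')) * x s)"
    by (intro sum.cong refl arg_cong[where f="\<lambda>x. x * _"] bilin_coords) (use F in \<open>simp add: trilin_def bilin_def\<close>)
  finally show ?thesis by (simp add: sum_distrib_right sum_distrib_left mult_ac)
qed

context
  fixes H :: "('i::finite) wha"
  assumes wha: "weak_hopf_algebra H"
begin

section \<open>The axioms of the given algebra in structure constants\<close>

lemma mul_bas: "mul H (bas i) (bas j) k = mu H i j k"
  by (simp add: mul_def mult.assoc flip: sum_distrib_left)
lemma cop_bas: "cop H (bas i) (a, b) = de H i a b"
  by (simp add: cop_def)
lemma ant_bas: "ant H (bas i) j = an H i j"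
  by (simp add: ant_def)
lemma dant_bas: "dant H (bas j) i = an H i j"
  by (simp add: dant_def)
lemma dcop_bas: "dcop H (bas k) (i, j) = mu H i j k"
  by (simp add: dcop_def)

lemma mul_left_bas: "mul H (bas i) y k = (\<Sum>j\<in>UNIV. y j * mu H i j k)"
  by (simp add: mul_def mult.assoc flip: sum_distrib_left)
lemma mul_right_bas: "mul H x (bas j) k = (\<Sum>i\<in>UNIV. x i * mu H i j k)"
  by (simp add: mul_def mult.assoc flip: sum_distrib_left)
lemma dmul_left_bas: "dmul H (bas a) g i = (\<Sum>b\<in>UNIV. de H i a b * g b)"
  unfolding dmul_def by (subst sum.swap) (simp flip: sum_distrib_right)
lemma dmul_right_bas: "dmul H f (bas b) i = (\<Sum>a\<in>UNIV. de H i a b * f a)"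
  by (simp add: dmul_def)
lemma dmul_bas: "dmul H (bas a) (bas b) i = de H i a b"
  by (simp add: dmul_right_bas)

lemma mu_assoc: "(\<Sum>s\<in>UNIV. mu H i j s * mu H s h k) = (\<Sum>s\<in>UNIV. mu H j h s * mu H i s k)"
proof -
  have "mul H (mul H (bas i) (bas j)) (bas h) k = mul H (bas i) (mul H (bas j) (bas h)) k"
    using wha by (simp add: weak_hopf_algebra_def)
  then show ?thesis by (simp add: mul_left_bas[of i] mul_right_bas[of _ h] mul_bas)
qed

lemma mu_one_left: "(\<Sum>i\<in>UNIV. un H i * mu H i j k) = bas j k"
proof -
  have "mul H (un H) (bas j) = bas j" using wha by (simp add: weak_hopf_algebra_def)
  then show ?thesis using mul_right_bas[of "un H" j k] by simp
qed
lemma mu_one_right: "(\<Sum>j\<in>UNIV. un H j * mu H i j k) = bas i k"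
proof -
  have "mul H (bas i) (un H) = bas i" using wha by (simp add: weak_hopf_algebra_def)
  then show ?thesis using mul_left_bas[of i "un H" k] by simp
qed

lemma de_coassoc: "(\<Sum>s\<in>UNIV. de H i s c * de H s a b) = (\<Sum>s\<in>UNIV. de H i a s * de H s b c)"
proof -
  have "cop_l H (cop H (bas i)) (a, b, c) = cop_r H (cop H (bas i)) (a, b, c)"
    using wha by (simp add: weak_hopf_algebra_def)
  then show ?thesis by (simp add: cop_l_def cop_r_def cop_bas)
qed

lemma de_counit_left: "(\<Sum>a\<in>UNIV. de H i a b * ep H a) = bas i b"
proof -
  have "(\<lambda>b. \<Sum>a\<in>UNIV. ep H a * cop H (bas i) (a, b)) = bas i" using wha by (simp add: weak_hopf_algebra_def)
  from fun_cong[OF this, of b] show ?thesis by (simp add: cop_bas mult.commute)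
qed
lemma de_counit_right: "(\<Sum>b\<in>UNIV. de H i a b * ep H b) = bas i a"
proof -
  have "(\<lambda>a. \<Sum>b\<in>UNIV. cop H (bas i) (a, b) * ep H b) = bas i" using wha by (simp add: weak_hopf_algebra_def)
  from fun_cong[OF this, of a] show ?thesis by (simp add: cop_bas)
qed

lemma mu_de: "(\<Sum>k\<in>UNIV. mu H i j k * de H k a b) =
   (\<Sum>p\<in>UNIV. \<Sum>q\<in>UNIV. \<Sum>p'\<in>UNIV. \<Sum>q'\<in>UNIV. de H i p q * de H j p' q' * mu H p p' a * mu H q q' b)"
proof -
  have "cop H (mul H (bas i) (bas j)) (a, b) = mul2 H (cop H (bas i)) (cop H (bas j)) (a, b)"
    using wha by (simp add: weak_hopf_algebra_def)
  then show ?thesis by (simp add: mul2_def cop_bas) (simp add: cop_def mul_bas)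
qed

abbreviation "c1 \<equiv> cop H (un H)"
abbreviation "d1 \<equiv> dcop H (ep H)"

lemma cou_mul_bas: "cou H (mul H (bas i) (bas j)) = d1 (i, j)"
  by (simp add: cou_def mul_bas dcop_def)

text \<open>\<open>A\<close>, \<open>B\<close> and \<open>C\<close> collect the three tensor slots.
  The units in the outer slots contract to basis vectors, leaving a product only in the middle
  slot.\<close>

lemma mul3_1: "mul3 H (tn_1X (un H) X) (tn_X1 Y (un H)) (k, l, m) = (\<Sum>j\<in>UNIV. \<Sum>j'\<in>UNIV. X (j, m) * Y (k, j') * mu H j j' l)"
proof -
  define A where "A i i' = un H i * mu H i i' k" for i i'
  define B where "B j h i' j' = X (j, h) * Y (i', j') * mu H j j' l" for j h i' j'
  define C where "C h h' = un H h' * mu H h h' m" for h h'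
  have A: "(\<Sum>i\<in>UNIV. A i i') = bas i' k" for i' unfolding A_def by (rule mu_one_left)
  have C: "(\<Sum>h'\<in>UNIV. C h h') = bas h m" for h unfolding C_def by (rule mu_one_right)
  have "mul3 H (tn_1X (un H) X) (tn_X1 Y (un H)) (k, l, m) =
     (\<Sum>i\<in>UNIV. \<Sum>j\<in>UNIV. \<Sum>h\<in>UNIV. \<Sum>i'\<in>UNIV. \<Sum>j'\<in>UNIV. \<Sum>h'\<in>UNIV. A i i' * B j h i' j' * C h h')"
    by (simp add: mul3_def tn_1X_def tn_X1_def A_def B_def C_def mult_ac)
  also have "\<dots> = (\<Sum>i\<in>UNIV. \<Sum>j\<in>UNIV. \<Sum>h\<in>UNIV. (\<Sum>i'\<in>UNIV. \<Sum>j'\<in>UNIV. A i i' * B j h i' j') * bas h m)"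
  proof -
    have "(\<Sum>h'\<in>UNIV. A i i' * B j h i' j' * C h h') = A i i' * B j h i' j' * bas h m" for i i' j j' h
      by (simp only: sum_distrib_left[symmetric] C)
    then show ?thesis by (simp only: sum_distrib_right)
  qed
  also have "\<dots> = (\<Sum>i\<in>UNIV. \<Sum>j\<in>UNIV. \<Sum>i'\<in>UNIV. A i i' * (\<Sum>j'\<in>UNIV. B j m i' j'))"
    by (simp add: sum_distrib_left)
  also have "\<dots> = (\<Sum>j\<in>UNIV. \<Sum>i'\<in>UNIV. \<Sum>i\<in>UNIV. A i i' * (\<Sum>j'\<in>UNIV. B j m i' j'))"
    by (subst sum.swap) (intro sum.cong[OF refl] sum.swap)
  also have "\<dots> = (\<Sum>j\<in>UNIV. \<Sum>j'\<in>UNIV. B j m k j')"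
    by (simp only: sum_distrib_right[symmetric] A sum_bas')
  finally show ?thesis by (simp only: B_def)
qed

lemma mul3_2: "mul3 H (tn_X1 X (un H)) (tn_1X (un H) Y) (k, l, m) = (\<Sum>j\<in>UNIV. \<Sum>j'\<in>UNIV. X (k, j) * Y (j', m) * mu H j j' l)"
proof -
  define A where "A i i' = un H i' * mu H i i' k" for i i'
  define B where "B i j j' h' = X (i, j) * Y (j', h') * mu H j j' l" for i j j' h'
  define C where "C h h' = un H h * mu H h h' m" for h h'
  have A: "(\<Sum>i'\<in>UNIV. A i i') = bas i k" for i unfolding A_def by (rule mu_one_right)
  have C: "(\<Sum>h\<in>UNIV. C h h') = bas h' m" for h' unfolding C_def by (rule mu_one_left)
  have "mul3 H (tn_X1 X (un H)) (tn_1X (un H) Y) (k, l, m) =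
     (\<Sum>i\<in>UNIV. \<Sum>j\<in>UNIV. \<Sum>h\<in>UNIV. \<Sum>i'\<in>UNIV. \<Sum>j'\<in>UNIV. \<Sum>h'\<in>UNIV. A i i' * (B i j j' h' * C h h'))"
    by (simp add: mul3_def tn_1X_def tn_X1_def A_def B_def C_def mult_ac)
  also have "\<dots> = (\<Sum>i\<in>UNIV. bas i k * (\<Sum>j\<in>UNIV. \<Sum>h\<in>UNIV. \<Sum>j'\<in>UNIV. \<Sum>h'\<in>UNIV. B i j j' h' * C h h'))"
    by (simp only: sum_distrib_left[symmetric]) (simp only: sum_distrib_left[symmetric] sum_distrib_right[symmetric] A)
  also have "\<dots> = (\<Sum>j\<in>UNIV. \<Sum>j'\<in>UNIV. \<Sum>h'\<in>UNIV. \<Sum>h\<in>UNIV. B k j j' h' * C h h')"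
    unfolding sum_bas' by (rule sum.cong[OF refl], subst sum.swap) (intro sum.cong[OF refl] sum.swap)
  also have "\<dots> = (\<Sum>j\<in>UNIV. \<Sum>j'\<in>UNIV. B k j j' m)"
    by (simp only: sum_distrib_left[symmetric] C sum_bas')
  finally show ?thesis by (simp only: B_def)
qed

lemma cop2_un: "cop2 H (un H) (i, j, h) = (\<Sum>s\<in>UNIV. c1 (s, h) * de H s i j)"
  by (simp add: cop2_def cop_l_def)

text \<open>Dually this is a counit axiom: \<open>un_coprod1\<close> yields the flipped form of
  \<open>dcu3\<close>, and \<open>un_coprod2\<close> the other one.\<close>

lemma un_coprod1: "(\<Sum>s\<in>UNIV. c1 (s, h) * de H s i j) = (\<Sum>p\<in>UNIV. \<Sum>q\<in>UNIV. mu H p q j * (c1 (i, q) * c1 (p, h)))"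
proof -
  have "cop2 H (un H) (i, j, h) = mul3 H (tn_1X (un H) c1) (tn_X1 c1 (un H)) (i, j, h)"
    using wha by (simp add: weak_hopf_algebra_def)
  then show ?thesis unfolding mul3_1 cop2_un by (simp add: mult_ac)
qed
lemma un_coprod2: "(\<Sum>s\<in>UNIV. c1 (s, h) * de H s i j) = (\<Sum>p\<in>UNIV. \<Sum>q\<in>UNIV. mu H p q j * (c1 (i, p) * c1 (q, h)))"
proof -
  have "cop2 H (un H) (i, j, h) = mul3 H (tn_X1 c1 (un H)) (tn_1X (un H) c1) (i, j, h)"
    using wha unfolding weak_hopf_algebra_def by metis
  then show ?thesis unfolding mul3_2 cop2_un by (simp add: mult_ac)
qed

text \<open>Dually these are the axioms for the iterated coproduct of the unit \<open>ep H\<close>,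
  proved in \<open>dsw_one1\<close>.\<close>

lemma ep_prod:
  "(\<Sum>q\<in>UNIV. d1 (i, q) * mu H j h q) = (\<Sum>a\<in>UNIV. \<Sum>b\<in>UNIV. de H j a b * d1 (i, a) * d1 (b, h))"
  "(\<Sum>q\<in>UNIV. d1 (i, q) * mu H j h q) = (\<Sum>a\<in>UNIV. \<Sum>b\<in>UNIV. de H j a b * d1 (i, b) * d1 (a, h))"
proof -
  have eq: "cou H (mul H (mul H (bas i) (bas j)) (bas h)) = (\<Sum>q\<in>UNIV. d1 (i, q) * mu H j h q)"
  proof -
    have "cou H (mul H (mul H (bas i) (bas j)) (bas h)) = cou H (mul H (bas i) (mul H (bas j) (bas h)))"
      using wha by (simp add: weak_hopf_algebra_def)
    also have "\<dots> = (\<Sum>k\<in>UNIV. \<Sum>q\<in>UNIV. mu H j h q * mu H i q k * ep H k)"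
      by (simp add: cou_def mul_left_bas[of i] mul_bas sum_distrib_right)
    also have "\<dots> = (\<Sum>q\<in>UNIV. d1 (i, q) * mu H j h q)"
      by (subst sum.swap) (simp add: dcop_def sum_distrib_left mult_ac)
    finally show ?thesis .
  qed
  have "cou H (mul H (mul H x y) z) =
          (\<Sum>i\<in>UNIV. \<Sum>j\<in>UNIV. cop H y (i, j) * cou H (mul H x (bas i)) * cou H (mul H (bas j) z))"
       "cou H (mul H (mul H x y) z) =
          (\<Sum>i\<in>UNIV. \<Sum>j\<in>UNIV. cop H y (i, j) * cou H (mul H x (bas j)) * cou H (mul H (bas i) z))" for x y z
    using wha unfolding weak_hopf_algebra_def by blast+
  note * = this[of "bas i" "bas j" "bas h"]
  show "(\<Sum>q\<in>UNIV. d1 (i, q) * mu H j h q) = (\<Sum>a\<in>UNIV. \<Sum>b\<in>UNIV. de H j a b * d1 (i, a) * d1 (b, h))"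
    using *(1) unfolding eq by (simp add: cop_bas cou_mul_bas)
  show "(\<Sum>q\<in>UNIV. d1 (i, q) * mu H j h q) = (\<Sum>a\<in>UNIV. \<Sum>b\<in>UNIV. de H j a b * d1 (i, b) * d1 (a, h))"
    using *(2) unfolding eq by (simp add: cop_bas cou_mul_bas)
qed

text \<open>The antipode axioms are self-dual: with transposed structure constants,
  \<open>an_s\<close>, \<open>an_t\<close> and \<open>an_S\<close> become
  \<open>dantipode_s\<close>, \<open>dantipode_t\<close> and \<open>dantipode_S\<close>.\<close>

lemma an_s: "(\<Sum>i\<in>UNIV. \<Sum>j\<in>UNIV. de H t i j * (\<Sum>s\<in>UNIV. an H i s * mu H s j k)) = (\<Sum>j\<in>UNIV. c1 (k, j) * d1 (t, j))"
proof -
  have "(\<lambda>k. \<Sum>i\<in>UNIV. \<Sum>j\<in>UNIV. cop H (bas t) (i, j) * mul H (ant H (bas i)) (bas j) k) =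
          (\<lambda>k. \<Sum>i\<in>UNIV. \<Sum>j\<in>UNIV. c1 (i, j) * cou H (mul H (bas t) (bas j)) * bas i k)"
    using wha unfolding weak_hopf_algebra_def by blast
  from fun_cong[OF this, of k] show ?thesis
    by (simp add: cop_bas mul_right_bas ant_bas cou_mul_bas flip: sum_distrib_right)
qed

lemma an_t: "(\<Sum>i\<in>UNIV. \<Sum>j\<in>UNIV. de H t i j * (\<Sum>s\<in>UNIV. an H j s * mu H i s k)) = (\<Sum>j\<in>UNIV. c1 (j, k) * d1 (j, t))"
proof -
  have "(\<lambda>k. \<Sum>i\<in>UNIV. \<Sum>j\<in>UNIV. cop H (bas t) (i, j) * mul H (bas i) (ant H (bas j)) k) =
          (\<lambda>k. \<Sum>i\<in>UNIV. \<Sum>j\<in>UNIV. c1 (i, j) * cou H (mul H (bas i) (bas t)) * bas j k)"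
    using wha unfolding weak_hopf_algebra_def by blast
  from fun_cong[OF this, of k] show ?thesis
    by (simp add: cop_bas mul_left_bas ant_bas cou_mul_bas)
qed

lemma an_S: "(\<Sum>i\<in>UNIV. \<Sum>j\<in>UNIV. \<Sum>h\<in>UNIV. (\<Sum>a\<in>UNIV. de H t a h * de H a i j) *
    (\<Sum>u\<in>UNIV. \<Sum>w\<in>UNIV. (\<Sum>p\<in>UNIV. an H i p * mu H p j u) * an H h w * mu H u w k)) = an H t k"
proof -
  have "(\<lambda>k. \<Sum>i\<in>UNIV. \<Sum>j\<in>UNIV. \<Sum>h\<in>UNIV. cop2 H (bas t) (i, j, h) *
              mul H (mul H (ant H (bas i)) (bas j)) (ant H (bas h)) k) = ant H (bas t)"
    using wha unfolding weak_hopf_algebra_def by blast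
  from fun_cong[OF this, of k] show ?thesis
    unfolding mul_def[of H "mul H _ _"] by (simp add: cop_bas cop2_def cop_l_def mul_right_bas ant_bas)
qed

section \<open>The structure maps of the dual\<close>

abbreviation "dcu f \<equiv> ev f (un H)"
abbreviation "dsw \<equiv> swd (dcop H)"

lemma dcu_bas: "dcu (bas i) = un H i"
  by (simp add: ev_def)

lemma dmul_lin1: "vlin (\<lambda>x. dmul H x y)" and dmul_lin2: "vlin (\<lambda>y. dmul H x y)"
  unfolding dmul_def
  by (intro vlinI lin_setsum lin_mult_left lin_mult_right lin_coord)+

lemma dcop_lin: "lin (\<lambda>x. dcop H x pq)"
  unfolding dcop_def by (cases pq) (auto intro!: lin_setsum lin_mult_left lin_coord)

lemma dcu_lin: "lin dcu"
  unfolding ev_def by (intro lin_setsum lin_mult_right lin_coord)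

lemma dant_lin: "vlin (dant H)"
  unfolding dant_def by (intro vlinI lin_setsum lin_mult_left lin_coord)

lemma dmul_comp1: "vlin g \<Longrightarrow> vlin (\<lambda>x. dmul H (g x) y)"
  by (auto simp: vlin_def intro: lin_comp[OF lin_coord_comp[OF dmul_lin1], of g])
lemma dmul_comp2: "vlin g \<Longrightarrow> vlin (\<lambda>x. dmul H y (g x))"
  by (auto simp: vlin_def intro: lin_comp[OF lin_coord_comp[OF dmul_lin2], of g])
lemma dant_comp: "vlin g \<Longrightarrow> vlin (\<lambda>x. dant H (g x))"
  by (auto simp: vlin_def intro: lin_comp[OF lin_coord_comp[OF dant_lin], of g])
lemma dcu_comp: "vlin g \<Longrightarrow> lin (\<lambda>x. dcu (g x))"
  by (rule lin_comp[OF dcu_lin])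
lemma dsw_comp1: "vlin g \<Longrightarrow> lin (\<lambda>x. dsw (g x) F)"
  unfolding swd_def by (intro lin_setsum lin_mult_right lin_comp[OF dcop_lin])
lemmas dlins = lin_id lin_coord lin_coord_comp[OF dmul_comp1] lin_coord_comp[OF dmul_comp2] lin_coord_comp[OF dant_comp] dmul_comp1 dmul_comp2 dant_comp dcu_comp dsw_comp1 lin_swd
  lin_mult_left lin_mult_right bilinI trilinI

lemma dsw_bas: "dsw (bas k) F = (\<Sum>p\<in>UNIV. \<Sum>q\<in>UNIV. mu H p q k * F (bas p) (bas q))"
  by (simp add: swd_def dcop_bas)
lemma dmul_assoc: "dmul H (dmul H x y) z = dmul H x (dmul H y z)"
proof
  fix t
  have 1: "dmul H (dmul H (bas a) (bas b)) (bas c) t = dmul H (bas a) (dmul H (bas b) (bas c)) t" for a b c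
    by (simp add: dmul_right_bas[of _ c] dmul_left_bas[of a] dmul_bas de_coassoc)
  have 2: "dmul H (dmul H (bas a) (bas b)) z t = dmul H (bas a) (dmul H (bas b) z) t" for a b
    by (rule lin_ext[where x=z], (intro dlins)+, rule 1)
  have 3: "dmul H (dmul H (bas a) y) z t = dmul H (bas a) (dmul H y z) t" for a
    by (rule lin_ext[where x=y], (intro dlins)+, rule 2)
  show "dmul H (dmul H x y) z t = dmul H x (dmul H y z) t"
    by (rule lin_ext[where x=x], (intro dlins)+, rule 3)
qed

lemma dmul_one_left: "dmul H (ep H) x = x"
proof
  fix t show "dmul H (ep H) x t = x t"
    by (rule lin_ext[where x=x], (intro dlins)+) (simp add: dmul_right_bas de_counit_left, simp add: bas_def)
qed
lemma dmul_one_right: "dmul H x (ep H) = x"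
proof
  fix t show "dmul H x (ep H) t = x t"
    by (rule lin_ext[where x=x], (intro dlins)+) (simp add: dmul_left_bas de_counit_right, simp add: bas_def)
qed

lemma dcoassoc: "dsw x (\<lambda>a b. dsw a (\<lambda>c d. F c d b)) = dsw x (\<lambda>a b. dsw b (\<lambda>c d. F a c d))"
proof (rule lin_ext[where x=x], (intro dlins)+)
  fix k
  let ?F = "\<lambda>r s q. F (bas r) (bas s) (bas q)"
  have "dsw (bas k) (\<lambda>a b. dsw a (\<lambda>c d. F c d b)) =
      (\<Sum>p\<in>UNIV. \<Sum>q\<in>UNIV. \<Sum>r\<in>UNIV. \<Sum>s\<in>UNIV. mu H r s p * mu H p q k * ?F r s q)"
    by (simp add: dsw_bas sum_distrib_left mult_ac)
  also have "\<dots> = (\<Sum>r\<in>UNIV. \<Sum>s\<in>UNIV. \<Sum>q\<in>UNIV. (\<Sum>p\<in>UNIV. mu H r s p * mu H p q k) * ?F r s q)"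
    unfolding sum_distrib_right by (rule sum4_rot)
  also have "\<dots> = (\<Sum>r\<in>UNIV. \<Sum>s\<in>UNIV. \<Sum>q\<in>UNIV. \<Sum>p\<in>UNIV. mu H s q p * mu H r p k * ?F r s q)"
    unfolding mu_assoc sum_distrib_right ..
  also have "\<dots> = (\<Sum>r\<in>UNIV. \<Sum>p\<in>UNIV. \<Sum>s\<in>UNIV. \<Sum>q\<in>UNIV. mu H s q p * mu H r p k * ?F r s q)"
    by (rule sum.cong[OF refl], subst (2) sum.swap, rule sum.cong[OF refl], rule sum.swap)
  also have "\<dots> = dsw (bas k) (\<lambda>a b. dsw b (\<lambda>c d. F a c d))"
    by (simp add: dsw_bas sum_distrib_left mult_ac)
  finally show "dsw (bas k) (\<lambda>a b. dsw a (\<lambda>c d. F c d b)) = dsw (bas k) (\<lambda>a b. dsw b (\<lambda>c d. F a c d))" .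
qed

lemma dcounit_left:
  assumes G: "lin G" shows "dsw x (\<lambda>a b. dcu a * G b) = G x"
proof (rule lin_ext[where x=x], (intro dlins G)+)
  fix k
  have "dsw (bas k) (\<lambda>a b. dcu a * G b) = (\<Sum>q\<in>UNIV. (\<Sum>p\<in>UNIV. un H p * mu H p q k) * G (bas q))"
    unfolding dsw_bas sum_distrib_right by (subst sum.swap) (simp add: dcu_bas mult_ac)
  then show "dsw (bas k) (\<lambda>a b. dcu a * G b) = G (bas k)"
    by (simp add: mu_one_left)
qed

lemma dcounit_right:
  assumes G: "lin G" shows "dsw x (\<lambda>a b. G a * dcu b) = G x"
proof (rule lin_ext[where x=x], (intro dlins G)+)
  fix k
  have "dsw (bas k) (\<lambda>a b. G a * dcu b) = (\<Sum>p\<in>UNIV. (\<Sum>q\<in>UNIV. un H q * mu H p q k) * G (bas p))"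
    unfolding dsw_bas sum_distrib_right by (simp add: dcu_bas mult_ac)
  then show "dsw (bas k) (\<lambda>a b. G a * dcu b) = G (bas k)"
    by (simp add: mu_one_right)
qed

lemma dsw_m:
  assumes K: "bilin K"
  shows "dsw (dmul H x y) K = dsw x (\<lambda>a b. dsw y (\<lambda>c d. K (dmul H a c) (dmul H b d)))"
proof -
  have 1: "dsw (dmul H (bas i) (bas j)) (\<lambda>y z. y t * z t') =
     dsw (bas i) (\<lambda>a b. dsw (bas j) (\<lambda>c d. dmul H a c t * dmul H b d t'))" for i j t t'
  proof -
    have "dsw (dmul H (bas i) (bas j)) (\<lambda>y z. y t * z t') = (\<Sum>k\<in>UNIV. mu H t t' k * de H k i j)"
      by (simp add: swd_def dcop_def dmul_bas mult.assoc[symmetric] sum_distrib_right[symmetric])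
    also have "\<dots> = (\<Sum>p\<in>UNIV. \<Sum>r\<in>UNIV. \<Sum>q\<in>UNIV. \<Sum>s\<in>UNIV. de H t p r * de H t' q s * mu H p q i * mu H r s j)"
      by (rule mu_de)
    also have "\<dots> = (\<Sum>p\<in>UNIV. \<Sum>q\<in>UNIV. \<Sum>r\<in>UNIV. \<Sum>s\<in>UNIV. de H t p r * de H t' q s * mu H p q i * mu H r s j)"
      by (rule sum.cong[OF refl], rule sum.swap)
    finally show ?thesis by (simp add: dsw_bas dmul_bas sum_distrib_left mult_ac)
  qed
  have 2: "dsw (dmul H x y) (\<lambda>y z. y t * z t') =
     dsw x (\<lambda>a b. dsw y (\<lambda>c d. dmul H a c t * dmul H b d t'))" for t t'
    by (rule lin_ext[where x=x], (intro dlins)+, rule lin_ext[where x=y], (intro dlins)+, rule 1)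
  have "dsw (dmul H x y) K = (\<Sum>t\<in>UNIV. \<Sum>t'\<in>UNIV. K (bas t) (bas t') * dsw (dmul H x y) (\<lambda>y z. y t * z t'))"
    unfolding swd_mult_left[symmetric] swd_sum[symmetric] by (intro swd_cong bilin_coords K)
  also have "\<dots> = dsw x (\<lambda>a b. dsw y (\<lambda>c d. \<Sum>t\<in>UNIV. \<Sum>t'\<in>UNIV. K (bas t) (bas t') * (dmul H a c t * dmul H b d t')))"
    by (simp add: 2 swd_mult_left swd_sum)
  also have "\<dots> = dsw x (\<lambda>a b. dsw y (\<lambda>c d. K (dmul H a c) (dmul H b d)))"
    by (intro swd_cong bilin_coords[symmetric] K)
  finally show ?thesis .
qed

text \<open>By trilinearity it suffices to test products of coordinate functionals, for which the
  three expressions are those of \<open>ep_prod\<close>.\<close>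

lemma dsw_one1:
  assumes F: "trilin F"
  shows "dsw (ep H) (\<lambda>a b. dsw b (\<lambda>c d. F a c d)) = dsw (ep H) (\<lambda>a b. dsw (ep H) (\<lambda>c d. F a (dmul H c b) d))"
   "dsw (ep H) (\<lambda>a b. dsw b (\<lambda>c d. F a c d)) = dsw (ep H) (\<lambda>a b. dsw (ep H) (\<lambda>c d. F a (dmul H b c) d))"
proof -
  have L: "dsw (ep H) (\<lambda>a b. dsw b (\<lambda>c d. a i * (c j * d h))) = (\<Sum>q\<in>UNIV. d1 (i, q) * mu H j h q)" for i j h
  proof -
    have "dsw (bas q) (\<lambda>c d. bas p i * (c j * d h)) = bas p i * mu H j h q" for p q
      by (simp add: dsw_bas mult.assoc[symmetric] sum_distrib_right[symmetric] sum_distrib_left[symmetric] mult.left_commute)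
    then show ?thesis
      unfolding swd_def[of _ "ep H"] by (subst sum.swap) (simp add: mult.assoc[symmetric] sum_distrib_right[symmetric])
  qed
  have R1: "dsw (ep H) (\<lambda>a b. dsw (ep H) (\<lambda>c d. a i * (dmul H c b j * d h))) = (\<Sum>q\<in>UNIV. d1 (i, q) * mu H j h q)" for i j h
  proof -
    have "dsw (ep H) (\<lambda>a b. dsw (ep H) (\<lambda>c d. a i * (dmul H c b j * d h))) =
       (\<Sum>b\<in>UNIV. \<Sum>a\<in>UNIV. de H j a b * d1 (i, b) * d1 (a, h))"
    proof -
      have inner: "dsw (ep H) (\<lambda>c d. bas p i * (dmul H c (bas q) j * d h)) = bas p i * (\<Sum>r\<in>UNIV. de H j r q * d1 (r, h))" for p q
      proof -
        have inner: "dsw (ep H) (\<lambda>c d. bas p i * (dmul H c (bas q) j * d h)) = (\<Sum>r\<in>UNIV. \<Sum>s\<in>UNIV. bas p i * de H j r q * d1 (r, s) * bas s h)"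
          unfolding swd_def by (simp add: dmul_bas mult_ac)
        then show ?thesis unfolding sum_bas' by (simp add: sum_distrib_left mult.assoc)
      qed
      have "dsw (ep H) (\<lambda>a b. dsw (ep H) (\<lambda>c d. a i * (dmul H c b j * d h))) =
          (\<Sum>p\<in>UNIV. \<Sum>q\<in>UNIV. d1 (p, q) * (\<Sum>r\<in>UNIV. de H j r q * d1 (r, h)) * bas p i)"
        by (subst swd_def, simp only: inner) (simp add: mult_ac)
      also have "\<dots> = (\<Sum>q\<in>UNIV. d1 (i, q) * (\<Sum>r\<in>UNIV. de H j r q * d1 (r, h)))"
        by (subst sum.swap) simp
      finally show ?thesis by (simp add: sum_distrib_left mult_ac)
    qed
    then show ?thesis unfolding ep_prod(2) by (subst sum.swap)
  qed
  have R2: "dsw (ep H) (\<lambda>a b. dsw (ep H) (\<lambda>c d. a i * (dmul H b c j * d h))) = (\<Sum>q\<in>UNIV. d1 (i, q) * mu H j h q)" for i j h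
  proof -
    have "dsw (ep H) (\<lambda>a b. dsw (ep H) (\<lambda>c d. a i * (dmul H b c j * d h))) =
       (\<Sum>b\<in>UNIV. \<Sum>a\<in>UNIV. de H j b a * d1 (i, b) * d1 (a, h))"
    proof -
      have inner: "dsw (ep H) (\<lambda>c d. bas p i * (dmul H (bas q) c j * d h)) = bas p i * (\<Sum>r\<in>UNIV. de H j q r * d1 (r, h))" for p q
      proof -
        have inner: "dsw (ep H) (\<lambda>c d. bas p i * (dmul H (bas q) c j * d h)) = (\<Sum>r\<in>UNIV. \<Sum>s\<in>UNIV. bas p i * de H j q r * d1 (r, s) * bas s h)"
          unfolding swd_def by (simp add: dmul_bas mult_ac)
        then show ?thesis unfolding sum_bas' by (simp add: sum_distrib_left mult.assoc)
      qed
      have "dsw (ep H) (\<lambda>a b. dsw (ep H) (\<lambda>c d. a i * (dmul H b c j * d h))) =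
          (\<Sum>p\<in>UNIV. \<Sum>q\<in>UNIV. d1 (p, q) * (\<Sum>r\<in>UNIV. de H j q r * d1 (r, h)) * bas p i)"
        by (subst swd_def, simp only: inner) (simp add: mult_ac)
      also have "\<dots> = (\<Sum>q\<in>UNIV. d1 (i, q) * (\<Sum>r\<in>UNIV. de H j q r * d1 (r, h)))"
        by (subst sum.swap) simp
      finally show ?thesis by (simp add: sum_distrib_left mult_ac)
    qed
    then show ?thesis unfolding ep_prod(1) by simp
  qed
  have ex: "dsw (ep H) (\<lambda>a b. dsw b (\<lambda>c d. F a c d)) = (\<Sum>s\<in>UNIV. \<Sum>t\<in>UNIV. \<Sum>t'\<in>UNIV. F (bas s) (bas t) (bas t') *
      dsw (ep H) (\<lambda>a b. dsw b (\<lambda>c d. a s * (c t * d t'))))"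
    unfolding swd_mult_left[symmetric] swd_sum[symmetric] by (intro swd_cong trilin_coords F)
  have ex1: "dsw (ep H) (\<lambda>a b. dsw (ep H) (\<lambda>c d. F a (X b c) d)) = (\<Sum>s\<in>UNIV. \<Sum>t\<in>UNIV. \<Sum>t'\<in>UNIV. F (bas s) (bas t) (bas t') *
      dsw (ep H) (\<lambda>a b. dsw (ep H) (\<lambda>c d. a s * (X b c t * d t'))))" for X
    unfolding swd_mult_left[symmetric] swd_sum[symmetric] by (intro swd_cong trilin_coords F)
  show "dsw (ep H) (\<lambda>a b. dsw b (\<lambda>c d. F a c d)) = dsw (ep H) (\<lambda>a b. dsw (ep H) (\<lambda>c d. F a (dmul H c b) d))"
    unfolding ex ex1 L R1 ..
  show "dsw (ep H) (\<lambda>a b. dsw b (\<lambda>c d. F a c d)) = dsw (ep H) (\<lambda>a b. dsw (ep H) (\<lambda>c d. F a (dmul H b c) d))"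
    unfolding ex ex1 L R2 ..
qed

lemma dcu_dmul_bas: "dcu (dmul H (bas i) (bas j)) = c1 (i, j)"
  by (simp add: ev_def dmul_bas cop_def mult.commute)

lemma dcu3:
  "dcu (dmul H (dmul H x y) z) = dsw y (\<lambda>a b. dcu (dmul H x a) * dcu (dmul H b z))"
  "dcu (dmul H (dmul H x y) z) = dsw y (\<lambda>a b. dcu (dmul H x b) * dcu (dmul H a z))"
proof -
  have L: "dcu (dmul H (dmul H (bas i) (bas j)) (bas h)) = (\<Sum>s\<in>UNIV. c1 (s, h) * de H s i j)" for i j h
  proof -
    have "dcu (dmul H (dmul H (bas i) (bas j)) (bas h)) = (\<Sum>t\<in>UNIV. \<Sum>s\<in>UNIV. de H t s h * de H s i j * un H t)"
      by (simp add: ev_def dmul_right_bas[of _ h] dmul_bas sum_distrib_right)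
    also have "\<dots> = (\<Sum>s\<in>UNIV. c1 (s, h) * de H s i j)"
      by (subst sum.swap) (simp add: cop_def sum_distrib_right sum_distrib_left mult_ac)
    finally show ?thesis .
  qed
  have 1: "dcu (dmul H (dmul H (bas i) (bas j)) (bas h)) = dsw (bas j) (\<lambda>a b. dcu (dmul H (bas i) a) * dcu (dmul H b (bas h)))" for i j h
    unfolding L un_coprod2 dsw_bas dcu_dmul_bas ..
  have 2: "dcu (dmul H (dmul H (bas i) (bas j)) (bas h)) = dsw (bas j) (\<lambda>a b. dcu (dmul H (bas i) b) * dcu (dmul H a (bas h)))" for i j h
    unfolding L un_coprod1 dsw_bas dcu_dmul_bas ..
  show "dcu (dmul H (dmul H x y) z) = dsw y (\<lambda>a b. dcu (dmul H x a) * dcu (dmul H b z))"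
    by (rule lin_ext[where x=x], (intro dlins)+, rule lin_ext[where x=y], (intro dlins)+, rule lin_ext[where x=z], (intro dlins)+, rule 1)
  show "dcu (dmul H (dmul H x y) z) = dsw y (\<lambda>a b. dcu (dmul H x b) * dcu (dmul H a z))"
    by (rule lin_ext[where x=x], (intro dlins)+, rule lin_ext[where x=y], (intro dlins)+, rule lin_ext[where x=z], (intro dlins)+, rule 2)
qed

lemma dantipode_s:
  assumes G: "lin G"
  shows "dsw x (\<lambda>a b. G (dmul H (dant H a) b)) = dsw (ep H) (\<lambda>a b. G a * dcu (dmul H x b))"
proof -
  have 1: "dsw (bas k) (\<lambda>a b. dmul H (dant H a) b t) = dsw (ep H) (\<lambda>a b. a t * dcu (dmul H (bas k) b))" for k t
  proof -
    have "dsw (ep H) (\<lambda>a b. a t * dcu (dmul H (bas k) b)) = (\<Sum>j\<in>UNIV. c1 (k, j) * d1 (t, j))"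
      unfolding swd_def dcu_dmul_bas
      by (subst sum.swap) (simp add: mult.assoc[symmetric] sum_distrib_right[symmetric], simp add: mult.commute)
    also have "\<dots> = (\<Sum>i\<in>UNIV. \<Sum>j\<in>UNIV. \<Sum>s\<in>UNIV. de H t i j * an H i s * mu H s j k)"
      unfolding an_s[symmetric] by (simp add: sum_distrib_left mult.assoc)
    also have "\<dots> = (\<Sum>s\<in>UNIV. \<Sum>j\<in>UNIV. \<Sum>i\<in>UNIV. de H t i j * an H i s * mu H s j k)"
      by (subst sum.swap, subst (2) sum.swap, subst sum.swap) (rule refl)
    also have "\<dots> = dsw (bas k) (\<lambda>a b. dmul H (dant H a) b t)"
      by (simp add: dsw_bas dmul_right_bas dant_bas sum_distrib_left mult_ac)
    finally show ?thesis ..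
  qed
  have "dsw x (\<lambda>a b. G (dmul H (dant H a) b)) = (\<Sum>t\<in>UNIV. G (bas t) * dsw x (\<lambda>a b. dmul H (dant H a) b t))"
    unfolding swd_mult_left[symmetric] swd_sum[symmetric] by (intro swd_cong lin_coords G)
  also have "\<dots> = (\<Sum>t\<in>UNIV. G (bas t) * dsw (ep H) (\<lambda>a b. a t * dcu (dmul H x b)))"
    by (rule sum.cong[OF refl], rule arg_cong[where f="\<lambda>x. _ * x"], rule lin_ext[where x=x], (intro dlins)+, rule 1)
  also have "\<dots> = dsw (ep H) (\<lambda>a b. G a * dcu (dmul H x b))"
    unfolding swd_mult_left[symmetric] swd_sum[symmetric]
    by (rule swd_cong, subst (2) lin_coords[OF G]) (simp add: sum_distrib_right mult.assoc)
  finally show ?thesis .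
qed

lemma dantipode_t:
  assumes G: "lin G"
  shows "dsw x (\<lambda>a b. G (dmul H a (dant H b))) = dsw (ep H) (\<lambda>a b. dcu (dmul H a x) * G b)"
proof -
  have 1: "dsw (bas k) (\<lambda>a b. dmul H a (dant H b) t) = dsw (ep H) (\<lambda>a b. dcu (dmul H a (bas k)) * b t)" for k t
  proof -
    have "dsw (ep H) (\<lambda>a b. dcu (dmul H a (bas k)) * b t) = (\<Sum>j\<in>UNIV. c1 (j, k) * d1 (j, t))"
      unfolding swd_def dcu_dmul_bas by (simp add: mult.assoc[symmetric]) (simp add: mult.commute)
    also have "\<dots> = (\<Sum>i\<in>UNIV. \<Sum>j\<in>UNIV. \<Sum>s\<in>UNIV. de H t i j * an H j s * mu H i s k)"
      unfolding an_t[symmetric] by (simp add: sum_distrib_left mult.assoc)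
    also have "\<dots> = (\<Sum>i\<in>UNIV. \<Sum>s\<in>UNIV. \<Sum>j\<in>UNIV. de H t i j * an H j s * mu H i s k)"
      by (rule sum.cong[OF refl], rule sum.swap)
    also have "\<dots> = dsw (bas k) (\<lambda>a b. dmul H a (dant H b) t)"
      by (simp add: dsw_bas dmul_left_bas dant_bas sum_distrib_left mult_ac)
    finally show ?thesis ..
  qed
  have "dsw x (\<lambda>a b. G (dmul H a (dant H b))) = (\<Sum>t\<in>UNIV. G (bas t) * dsw x (\<lambda>a b. dmul H a (dant H b) t))"
    unfolding swd_mult_left[symmetric] swd_sum[symmetric] by (intro swd_cong lin_coords G)
  also have "\<dots> = (\<Sum>t\<in>UNIV. G (bas t) * dsw (ep H) (\<lambda>a b. dcu (dmul H a x) * b t))"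
    by (rule sum.cong[OF refl], rule arg_cong[where f="\<lambda>x. _ * x"], rule lin_ext[where x=x], (intro dlins)+, rule 1)
  also have "\<dots> = dsw (ep H) (\<lambda>a b. dcu (dmul H a x) * G b)"
    unfolding swd_mult_left[symmetric] swd_sum[symmetric]
    by (rule swd_cong, subst (2) lin_coords[OF G]) (simp add: sum_distrib_left mult_ac)
  finally show ?thesis .
qed

lemma dantipode_S:
  assumes G: "lin G"
  shows "dsw x (\<lambda>a b. dsw b (\<lambda>c d. G (dmul H (dmul H (dant H a) c) (dant H d)))) = G (dant H x)"
proof -
  let ?Q = "\<lambda>a c d. dmul H (dmul H (dant H a) c) (dant H d)"
  \<comment> \<open>The product in \<open>an_S\<close> is bracketed to the left, which dualises to
    iterating the coproduct in the first leg; coassociativity then gives the stated form.\<close>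
  have 1: "dsw (bas k) (\<lambda>a b. dsw a (\<lambda>c d. ?Q c d b t)) = dant H (bas k) t" for k t
  proof -
    have Q: "?Q (bas p) (bas j) (bas w) t = (\<Sum>a\<in>UNIV. \<Sum>h\<in>UNIV. de H t a h * (\<Sum>i\<in>UNIV. de H a i j * an H i p) * an H h w)" for p j w
      unfolding dmul_def[of H "dmul H _ _"] by (simp add: dmul_right_bas dant_bas)
    have "an H t k = (\<Sum>i\<in>UNIV. \<Sum>j\<in>UNIV. \<Sum>h\<in>UNIV. \<Sum>u\<in>UNIV. \<Sum>w\<in>UNIV. \<Sum>p\<in>UNIV. \<Sum>a\<in>UNIV.
        de H t a h * de H a i j * (an H i p * mu H p j u * an H h w * mu H u w k))"
      unfolding an_S[where t=t and k=k, symmetric] by (simp add: sum_distrib_left sum_distrib_right mult.assoc)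
    also have "\<dots> = (\<Sum>u\<in>UNIV. \<Sum>w\<in>UNIV. \<Sum>p\<in>UNIV. \<Sum>j\<in>UNIV. \<Sum>a\<in>UNIV. \<Sum>h\<in>UNIV. \<Sum>i\<in>UNIV.
        de H t a h * de H a i j * (an H i p * mu H p j u * an H h w * mu H u w k))"
      by (subst sum4_front, rule sum.cong[OF refl], subst sum4_front, rule sum.cong[OF refl],
          subst sum4_front, rule sum.cong[OF refl], rule sum4_perm)
    also have "\<dots> = dsw (bas k) (\<lambda>a b. dsw a (\<lambda>c d. ?Q c d b t))"
      unfolding dsw_bas Q by (simp add: sum_distrib_left sum_distrib_right mult_ac)
    finally show ?thesis by (simp add: dant_bas)
  qed
  have "dsw x (\<lambda>a b. dsw b (\<lambda>c d. G (?Q a c d))) = dsw x (\<lambda>a b. dsw a (\<lambda>c d. G (?Q c d b)))"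
    by (rule dcoassoc[symmetric])
  also have "\<dots> = (\<Sum>t\<in>UNIV. G (bas t) * dsw x (\<lambda>a b. dsw a (\<lambda>c d. ?Q c d b t)))"
    unfolding swd_mult_left[symmetric] swd_sum[symmetric] by (intro swd_cong lin_coords G)
  also have "\<dots> = (\<Sum>t\<in>UNIV. G (bas t) * dant H x t)"
    by (rule sum.cong[OF refl], rule arg_cong[where f="\<lambda>x. _ * x"], rule lin_ext[where x=x], (intro dlins)+, rule 1)
  also have "\<dots> = G (dant H x)" by (rule lin_coords[OF G, symmetric])
  finally show ?thesis .
qed

lemma weak_hopf_dual: "weak_hopf (dmul H) (ep H) (dcop H) dcu (dant H)"
  by unfold_locales
    (fact dmul_lin1 dmul_lin2 dcop_lin dcu_lin dant_lin dmul_assoc dmul_one_left dmul_one_right dcoassoc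
      dcounit_left dcounit_right dsw_m dsw_one1 dcu3 dantipode_s dantipode_t dantipode_S)+

end

section \<open>Irreducible representations\<close>

lemma mult_unit_vec:
  assumes "A \<in> carrier_mat m n" "i < n"
  shows "A *\<^sub>v unit_vec n i = col (A :: complex mat) i"
  by (rule eq_vecI) (use assms in \<open>auto simp: scalar_prod_right_unit\<close>)

lemma eq_mat_on_vecs:
  assumes A: "A \<in> carrier_mat m n" and B: "B \<in> carrier_mat m n"
    and eq: "\<And>y. y \<in> carrier_vec n \<Longrightarrow> A *\<^sub>v y = B *\<^sub>v y"
  shows "A = (B :: complex mat)"
proof (rule mat_col_eqI)
  fix i assume "i < dim_col B"
  then show "col A i = col B i"
    using eq[of "unit_vec n i"] mult_unit_vec[OF A, of i] mult_unit_vec[OF B, of i] B by auto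
qed (use A B in auto)

lemma linear_map_mat:
  fixes L :: "complex vec \<Rightarrow> complex vec"
  assumes car: "\<And>y. y \<in> carrier_vec n \<Longrightarrow> L y \<in> carrier_vec m"
    and add: "\<And>y z. y \<in> carrier_vec n \<Longrightarrow> z \<in> carrier_vec n \<Longrightarrow> L (y + z) = L y + L z"
    and smult: "\<And>c y. y \<in> carrier_vec n \<Longrightarrow> L (c \<cdot>\<^sub>v y) = c \<cdot>\<^sub>v L y"
  obtains P where "P \<in> carrier_mat m n" "\<And>y. y \<in> carrier_vec n \<Longrightarrow> P *\<^sub>v y = L y"
proof -
  define P where "P = mat m n (\<lambda>(r, i). L (unit_vec n i) $ r)"
  have P: "P \<in> carrier_mat m n" by (simp add: P_def)
  have "P *\<^sub>v y = L y" if y: "y \<in> carrier_vec n" for y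
  proof -
    \<comment> \<open>\<open>t s\<close> keeps the first s coordinates of y, so that linearity is
      applied to one unit vector at a time.\<close>
    define t where "t s = vec n (\<lambda>i. if i < s then y $ i else 0)" for s
    have tc: "t s \<in> carrier_vec n" for s by (simp add: t_def)
    have "s \<le> n \<Longrightarrow> P *\<^sub>v t s = L (t s)" for s
    proof (induction s)
      case 0
      have "t 0 = 0 \<cdot>\<^sub>v 0\<^sub>v n" by (rule eq_vecI) (auto simp: t_def)
      then show ?case using mult_mat_vec[OF P, of "0\<^sub>v n" 0] smult[of "0\<^sub>v n" 0] car[of "0\<^sub>v n"] P
        by (auto intro!: eq_vecI)
    next
      case (Suc s)
      have s: "t (Suc s) = t s + y $ s \<cdot>\<^sub>v unit_vec n s"
        by (rule eq_vecI) (use Suc.prems in \<open>auto simp: t_def less_Suc_eq\<close>)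
      have "P *\<^sub>v unit_vec n s = L (unit_vec n s)"
        using mult_unit_vec[OF P, of s] Suc.prems car[of "unit_vec n s"] by (auto simp: P_def intro!: eq_vecI)
      then show ?case using Suc tc[of s] unfolding s
        by (simp add: mult_add_distrib_mat_vec[OF P] mult_mat_vec[OF P] add smult)
    qed
    moreover have "t n = y" by (rule eq_vecI) (use y in \<open>auto simp: t_def\<close>)
    ultimately show ?thesis by (metis order_refl)
  qed
  then show thesis using P that by blast
qed

lemma mtrace_comm:
  assumes "A \<in> carrier_mat n m" "B \<in> carrier_mat m n"
  shows "mtrace (A * B) = mtrace (B * A)"
proof -
  have "mtrace (A * B) = (\<Sum>i<n. \<Sum>j<m. A $$ (i, j) * B $$ (j, i))"
    using assms by (auto simp: mtrace_def scalar_prod_def atLeast0LessThan intro!: sum.cong)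
  also have "\<dots> = mtrace (B * A)"
    using assms by (subst sum.swap) (auto simp: mtrace_def scalar_prod_def atLeast0LessThan mult.commute intro!: sum.cong)
  finally show ?thesis .
qed

lemma mtrace_one: "mtrace (1\<^sub>m n) = of_nat n"
  by (simp add: mtrace_def)

lemma irreducible_repD:
  assumes "irreducible_rep n \<rho>" "U \<subseteq> carrier_vec n" "0\<^sub>v n \<in> U" "\<And>x y. x \<in> U \<Longrightarrow> y \<in> U \<Longrightarrow> x + y \<in> U"
    "\<And>c x. x \<in> U \<Longrightarrow> c \<cdot>\<^sub>v x \<in> U" "\<And>f x. x \<in> U \<Longrightarrow> \<rho> f *\<^sub>v x \<in> U"
  shows "U = {0\<^sub>v n} \<or> U = carrier_vec n"
  by (rule assms(1)[unfolded irreducible_rep_def, THEN conjunct2, THEN spec, THEN mp, THEN mp])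
    (use assms(2-) in auto)

text \<open>Kernel and image of P are invariant, so irreducibility makes P bijective; a two-sided
  inverse is assembled from preimages of the unit vectors.\<close>

lemma schur_iso:
  fixes \<rho> \<sigma> :: "('i \<Rightarrow> complex) \<Rightarrow> complex mat"
  assumes irr: "irreducible_rep n \<rho>" "irreducible_rep m \<sigma>"
    and car: "\<And>f. \<rho> f \<in> carrier_mat n n" "\<And>f. \<sigma> f \<in> carrier_mat m m"
    and P: "P \<in> carrier_mat m n" and inter: "\<And>f. \<sigma> f * P = P * \<rho> f" and nz: "P \<noteq> 0\<^sub>m m n"
  shows "n = m" "invertible_mat P" "\<And>x. x \<in> carrier_vec n \<Longrightarrow> P *\<^sub>v x = 0\<^sub>v m \<Longrightarrow> x = 0\<^sub>v n"
proof -
  have inter': "\<sigma> f *\<^sub>v (P *\<^sub>v x) = P *\<^sub>v (\<rho> f *\<^sub>v x)" if "x \<in> carrier_vec n" for f x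
    using inter[of f] that P car[of f] by (metis assoc_mult_mat_vec)
  have "{x \<in> carrier_vec n. P *\<^sub>v x = 0\<^sub>v m} = {0\<^sub>v n} \<or> {x \<in> carrier_vec n. P *\<^sub>v x = 0\<^sub>v m} = carrier_vec n"
  proof (rule irreducible_repD[OF irr(1)])
    fix f x assume x: "x \<in> {x \<in> carrier_vec n. P *\<^sub>v x = 0\<^sub>v m}"
    have "\<sigma> f *\<^sub>v 0\<^sub>v m = 0\<^sub>v m" using car(2)[of f] by (auto intro!: eq_vecI)
    then show "\<rho> f *\<^sub>v x \<in> {x \<in> carrier_vec n. P *\<^sub>v x = 0\<^sub>v m}"
      using x inter'[of x f] car(1)[of f] by (auto intro: mult_mat_vec_carrier)
  qed (use P in \<open>auto simp: mult_add_distrib_mat_vec[OF P] mult_mat_vec[OF P] intro!: eq_vecI\<close>)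
  moreover have "{x \<in> carrier_vec n. P *\<^sub>v x = 0\<^sub>v m} \<noteq> carrier_vec n"
  proof
    assume a: "{x \<in> carrier_vec n. P *\<^sub>v x = 0\<^sub>v m} = carrier_vec n"
    have "P = 0\<^sub>m m n"
    proof (rule eq_mat_on_vecs[OF P])
      fix y :: "complex vec" assume y: "y \<in> carrier_vec n"
      then have "P *\<^sub>v y = 0\<^sub>v m" using a by blast
      moreover have "0\<^sub>m m n *\<^sub>v y = 0\<^sub>v m" using y by (auto intro!: eq_vecI)
      ultimately show "P *\<^sub>v y = 0\<^sub>m m n *\<^sub>v y" by simp
    qed simp
    then show False using nz by simp
  qed
  ultimately have "{x \<in> carrier_vec n. P *\<^sub>v x = 0\<^sub>v m} = {0\<^sub>v n}" by blast
  then show inj: "x \<in> carrier_vec n \<Longrightarrow> P *\<^sub>v x = 0\<^sub>v m \<Longrightarrow> x = 0\<^sub>v n" for x by blast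
  have "(\<lambda>x. P *\<^sub>v x) ` carrier_vec n = {0\<^sub>v m} \<or> (\<lambda>x. P *\<^sub>v x) ` carrier_vec n = carrier_vec m"
  proof (rule irreducible_repD[OF irr(2)])
    show "(\<lambda>x. P *\<^sub>v x) ` carrier_vec n \<subseteq> carrier_vec m" using P by (auto intro: mult_mat_vec_carrier)
    show "0\<^sub>v m \<in> (\<lambda>x. P *\<^sub>v x) ` carrier_vec n"
      by (rule image_eqI[of _ _ "0\<^sub>v n"]) (use P in \<open>auto intro!: eq_vecI\<close>)
  next
    fix x y assume "x \<in> (\<lambda>x. P *\<^sub>v x) ` carrier_vec n" "y \<in> (\<lambda>x. P *\<^sub>v x) ` carrier_vec n"
    then show "x + y \<in> (\<lambda>x. P *\<^sub>v x) ` carrier_vec n"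
      by (auto simp flip: mult_add_distrib_mat_vec[OF P])
  next
    fix c x assume "x \<in> (\<lambda>x. P *\<^sub>v x) ` carrier_vec n"
    then show "c \<cdot>\<^sub>v x \<in> (\<lambda>x. P *\<^sub>v x) ` carrier_vec n"
      by (auto simp flip: mult_mat_vec[OF P])
  next
    fix f x assume "x \<in> (\<lambda>x. P *\<^sub>v x) ` carrier_vec n"
    then show "\<sigma> f *\<^sub>v x \<in> (\<lambda>x. P *\<^sub>v x) ` carrier_vec n"
      using car(1)[of f] by (auto simp: inter' intro: mult_mat_vec_carrier)
  qed
  moreover have "(\<lambda>x. P *\<^sub>v x) ` carrier_vec n \<noteq> {0\<^sub>v m}"
  proof
    assume a: "(\<lambda>x. P *\<^sub>v x) ` carrier_vec n = {0\<^sub>v m}"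
    have "P *\<^sub>v unit_vec n 0 \<in> {0\<^sub>v m}" unfolding a[symmetric] by (rule imageI) simp
    then have "unit_vec n 0 = (0\<^sub>v n :: complex vec)" by (intro inj) simp_all
    then have "unit_vec n 0 $ 0 = (0\<^sub>v n :: complex vec) $ 0" by simp
    moreover have "n > 0" using irr(1) by (simp add: irreducible_rep_def)
    ultimately show False by simp
  qed
  ultimately have surj: "(\<lambda>x. P *\<^sub>v x) ` carrier_vec n = carrier_vec m" by blast
  have "\<exists>x. i < m \<longrightarrow> x \<in> carrier_vec n \<and> P *\<^sub>v x = unit_vec m i" for i
  proof -
    have "unit_vec m i \<in> (\<lambda>x. P *\<^sub>v x) ` carrier_vec n" unfolding surj by simp
    then show ?thesis by auto
  qed
  then obtain q where q: "\<And>i. i < m \<Longrightarrow> q i \<in> carrier_vec n" "\<And>i. i < m \<Longrightarrow> P *\<^sub>v q i = unit_vec m i"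
    by metis
  define Q where "Q = mat n m (\<lambda>(s, i). q i $ s)"
  have Q: "Q \<in> carrier_mat n m" by (simp add: Q_def)
  have cQ: "col Q i = q i" if "i < m" for i
    using that q(1)[OF that] by (auto simp: Q_def intro!: eq_vecI)
  have PQ: "P * Q = 1\<^sub>m m"
  proof (rule mat_col_eqI)
    fix i assume "i < dim_col (1\<^sub>m m :: complex mat)"
    then have i: "i < m" by simp
    show "col (P * Q) i = col (1\<^sub>m m) i"
      unfolding col_mult2[OF P Q i] cQ[OF i] q(2)[OF i] using i by simp
  qed (use P Q in auto)
  have QP: "Q * P = 1\<^sub>m n"
  proof (rule eq_mat_on_vecs)
    show "Q * P \<in> carrier_mat n n" "1\<^sub>m n \<in> carrier_mat n n" using P Q by auto
    fix y :: "complex vec" assume y: "y \<in> carrier_vec n"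
    have c: "Q *\<^sub>v (P *\<^sub>v y) \<in> carrier_vec n" using P Q y by (auto intro: mult_mat_vec_carrier)
    have Py: "P *\<^sub>v y \<in> carrier_vec m" using P y by (auto intro: mult_mat_vec_carrier)
    have "P *\<^sub>v (Q *\<^sub>v (P *\<^sub>v y)) = P *\<^sub>v y"
      using PQ Py assoc_mult_mat_vec[OF P Q Py] by simp
    then have "P *\<^sub>v (Q *\<^sub>v (P *\<^sub>v y) - y) = 0\<^sub>v m"
      using c y Py by (simp add: mult_minus_distrib_mat_vec[OF P])
    then have "Q *\<^sub>v (P *\<^sub>v y) - y = 0\<^sub>v n" using inj[of "Q *\<^sub>v (P *\<^sub>v y) - y"] c y by simp
    then have "Q *\<^sub>v (P *\<^sub>v y) = y"
      using c y by (metis carrier_vecD eq_vecI index_minus_vec(1) index_zero_vec(1) right_minus_eq)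
    then show "Q * P *\<^sub>v y = 1\<^sub>m n *\<^sub>v y" using y assoc_mult_mat_vec[OF Q P y] by simp
  qed
  \<comment> \<open>PQ and QP are identity matrices of sizes m and n with the same trace.\<close>
  have "(of_nat n :: complex) = of_nat m"
    using mtrace_comm[OF P Q] by (simp add: PQ QP mtrace_one)
  then show nm: "n = m" by simp
  show "invertible_mat P" unfolding invertible_mat_def inverts_mat_def
    using P Q PQ QP nm by auto
qed

text \<open>For an eigenvalue c of P, the intertwiner P - c 1 kills a nonzero vector, so by the
  injectivity in \<open>schur_iso\<close> it is zero.\<close>

lemma schur_scalar:
  fixes \<rho> :: "('i \<Rightarrow> complex) \<Rightarrow> complex mat"
  assumes irr: "irreducible_rep n \<rho>" and car: "\<And>f. \<rho> f \<in> carrier_mat n n"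
    and P: "P \<in> carrier_mat n n" and inter: "\<And>f. \<rho> f * P = P * \<rho> f"
  obtains c where "P = c \<cdot>\<^sub>m 1\<^sub>m n"
proof -
  have "n \<noteq> 0" using irr by (simp add: irreducible_rep_def)
  then obtain c where "eigenvalue P c" using spectrum_non_empty[OF P] by (auto simp: spectrum_def)
  then obtain x where x: "x \<in> carrier_vec n" "x \<noteq> 0\<^sub>v n" "P *\<^sub>v x = c \<cdot>\<^sub>v x"
    using P unfolding eigenvalue_def eigenvector_def by auto
  define Q where "Q = P - c \<cdot>\<^sub>m 1\<^sub>m n"
  have c1: "c \<cdot>\<^sub>m 1\<^sub>m n \<in> carrier_mat n n" by simp
  have Q: "Q \<in> carrier_mat n n" unfolding Q_def by (rule minus_carrier_mat[OF c1])
  have "\<rho> f * Q = Q * \<rho> f" for f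
    unfolding Q_def mult_minus_distrib_mat[OF car P c1] minus_mult_distrib_mat[OF P c1 car]
      mult_smult_distrib[OF car one_carrier_mat] mult_smult_assoc_mat[OF one_carrier_mat car]
    using car[of f] by (simp add: inter)
  moreover have "Q *\<^sub>v x = 0\<^sub>v n"
  proof -
    have "c \<cdot>\<^sub>m 1\<^sub>m n *\<^sub>v x = c \<cdot>\<^sub>v x"
      by (rule eq_vecI) (use x in \<open>auto simp: scalar_prod_def if_distrib[of "\<lambda>z. _ * z"] if_distrib[of "\<lambda>z. z * _"] sum.delta' cong: if_cong\<close>)
    then show ?thesis unfolding Q_def minus_mult_distrib_mat_vec[OF P c1 x(1)] x(3) using x(1) by simp
  qed
  ultimately have Q0: "Q = 0\<^sub>m n n"
    using schur_iso(3)[OF irr irr car car Q, of x] x by blast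
  have "P = c \<cdot>\<^sub>m 1\<^sub>m n"
  proof (rule eq_matI)
    fix i j assume ij: "i < dim_row (c \<cdot>\<^sub>m 1\<^sub>m n)" "j < dim_col (c \<cdot>\<^sub>m 1\<^sub>m n)"
    have "Q $$ (i, j) = 0" using Q0 ij by simp
    then show "P $$ (i, j) = (c \<cdot>\<^sub>m 1\<^sub>m n) $$ (i, j)" unfolding Q_def using ij P by simp
  qed (use P in auto)
  then show thesis by (rule that)
qed

text \<open>Gaussian elimination by induction on K: \<open>r\<close> is the residue of the new row
  after removing its components along the old rows, and independence makes it nonzero.\<close>

lemma dual_family:
  fixes R :: "'k \<Rightarrow> ('i::finite \<Rightarrow> complex)"
  assumes "finite K" "\<And>c. (\<And>p. (\<Sum>k\<in>K. c k * R k p) = 0) \<Longrightarrow> (\<And>k. k \<in> K \<Longrightarrow> c k = 0)"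
  shows "\<exists>E. \<forall>k\<in>K. \<forall>k'\<in>K. (\<Sum>p\<in>UNIV. R k p * E k' p) = (if k = k' then 1 else 0)"
  using assms
proof (induction K)
  case empty
  then show ?case by simp
next
  case (insert k0 K)
  let ?P = "\<lambda>x y. \<Sum>p\<in>UNIV. x p * (y p :: complex)"
  have "\<exists>E. \<forall>k\<in>K. \<forall>k'\<in>K. ?P (R k) (E k') = (if k = k' then 1 else 0)"
  proof (rule insert.IH)
    fix c k assume c: "\<And>p. (\<Sum>k\<in>K. c k * R k p) = 0" and k: "k \<in> K"
    have "(\<Sum>k\<in>insert k0 K. (if k = k0 then 0 else c k) * R k p) = 0" for p
    proof -
      have "(\<Sum>k\<in>insert k0 K. (if k = k0 then 0 else c k) * R k p) = (\<Sum>k\<in>K. (if k = k0 then 0 else c k) * R k p)"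
        using insert.hyps by simp
      also have "\<dots> = (\<Sum>k\<in>K. c k * R k p)" using insert.hyps by (intro sum.cong) auto
      finally show ?thesis using c by simp
    qed
    then have "(if k = k0 then 0 else c k) = 0" using insert.prems[of "\<lambda>k. if k = k0 then 0 else c k" k] k by blast
    then show "c k = 0" using k insert.hyps by (auto split: if_splits)
  qed
  then obtain E where E: "\<And>k k'. k \<in> K \<Longrightarrow> k' \<in> K \<Longrightarrow> ?P (R k) (E k') = (if k = k' then 1 else 0)" by blast
  define r where "r p = R k0 p - (\<Sum>k\<in>K. ?P (R k0) (E k) * R k p)" for p
  have "\<exists>p. r p \<noteq> 0"
  proof (rule ccontr)
    assume a: "\<not> (\<exists>p. r p \<noteq> 0)"
    define c where "c k = (if k = k0 then 1 else - ?P (R k0) (E k))" for k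
    have "(\<Sum>k\<in>insert k0 K. c k * R k p) = 0" for p
    proof -
      have "(\<Sum>k\<in>insert k0 K. c k * R k p) = R k0 p + (\<Sum>k\<in>K. c k * R k p)" using insert.hyps by (simp add: c_def)
      also have "(\<Sum>k\<in>K. c k * R k p) = (\<Sum>k\<in>K. - (?P (R k0) (E k) * R k p))"
        using insert.hyps by (intro sum.cong) (auto simp: c_def)
      moreover have "r p = 0" using a by blast
      ultimately show ?thesis unfolding r_def by (simp add: sum_negf)
    qed
    from insert.prems[OF this, of k0] show False by (simp add: c_def)
  qed
  then obtain p where p: "r p \<noteq> 0" by blast
  \<comment> \<open>At a coordinate p where the residue is nonzero, \<open>bas p\<close> is made
    orthogonal to the old rows and scaled to pair to 1 with the new row.\<close>
  define E0 where "E0 q = (bas p q - (\<Sum>k\<in>K. R k p * E k q)) / r p" for q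
  have PE0: "?P x E0 = (x p - (\<Sum>k\<in>K. R k p * ?P x (E k))) / r p" for x
  proof -
    have "?P x E0 = (\<Sum>q\<in>UNIV. x q * bas p q - (\<Sum>k\<in>K. R k p * (x q * E k q))) / r p"
      unfolding E0_def sum_divide_distrib by (intro sum.cong) (auto simp: algebra_simps sum_distrib_left diff_divide_distrib)
    also have "(\<Sum>q\<in>UNIV. x q * bas p q - (\<Sum>k\<in>K. R k p * (x q * E k q))) = x p - (\<Sum>k\<in>K. R k p * ?P x (E k))"
      unfolding sum_subtractf sum_distrib_left by (subst sum.swap) simp
    finally show ?thesis .
  qed
  have E0K: "?P (R k) E0 = 0" if "k \<in> K" for k
  proof -
    have "(\<Sum>k'\<in>K. R k' p * ?P (R k) (E k')) = (\<Sum>k'\<in>K. if k = k' then R k p else 0)"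
      using E that by (intro sum.cong) auto
    then show ?thesis unfolding PE0 using that insert.hyps by simp
  qed
  have E00: "?P (R k0) E0 = 1"
    unfolding PE0 using p by (simp add: r_def mult.commute)
  define E' where "E' k = (if k = k0 then E0 else (\<lambda>q. E k q - ?P (R k0) (E k) * E0 q))" for k
  have PE': "?P x (E' k) = (if k = k0 then ?P x E0 else ?P x (E k) - ?P (R k0) (E k) * ?P x E0)" for x k
  proof -
    have "(\<Sum>p\<in>UNIV. x p * (E k p - c * E0 p)) = ?P x (E k) - c * ?P x E0" for c
      by (simp add: right_diff_distrib sum_subtractf sum_distrib_left mult.left_commute)
    then show ?thesis by (simp add: E'_def)
  qed
  show ?case
    by (rule exI[of _ E']) (use E E0K E00 insert.hyps in \<open>auto simp: PE'\<close>)
qed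

section \<open>Subspaces of coordinate space\<close>

definition lsub :: "('i \<Rightarrow> complex) set \<Rightarrow> bool" where
  "lsub L \<longleftrightarrow> (\<lambda>_. 0) \<in> L \<and> (\<forall>x\<in>L. \<forall>y\<in>L. (\<lambda>i. x i + y i) \<in> L) \<and> (\<forall>c. \<forall>x\<in>L. (\<lambda>i. c * x i) \<in> L)"

lemma lsub_add: "lsub L \<Longrightarrow> x \<in> L \<Longrightarrow> y \<in> L \<Longrightarrow> (\<lambda>i. x i + y i) \<in> L"
  by (simp add: lsub_def)
lemma lsub_scale: "lsub L \<Longrightarrow> x \<in> L \<Longrightarrow> (\<lambda>i. c * x i) \<in> L"
  by (simp add: lsub_def)

lemma lsub_sum:
  assumes "lsub L" "finite K" "\<And>k. k \<in> K \<Longrightarrow> x k \<in> L"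
  shows "(\<lambda>i. \<Sum>k\<in>K. c k * x k i) \<in> L"
  using assms(2,3)
proof (induction K)
  case empty
  then show ?case using assms(1) by (simp add: lsub_def)
next
  case (insert k K)
  then have "(\<lambda>i. c k * x k i) \<in> L" "(\<lambda>i. \<Sum>k\<in>K. c k * x k i) \<in> L" using lsub_scale[OF assms(1)] by auto
  from lsub_add[OF assms(1) this] show ?case using insert.hyps by simp
qed

lemma pairing_sum: "(\<Sum>p\<in>A. (\<Sum>i\<in>K. c i * b i p) * y p) = (\<Sum>i\<in>K. c i * (\<Sum>p\<in>A. b i p * y p))" for c :: "_ \<Rightarrow> complex"
  by (simp add: sum_distrib_left sum_distrib_right mult.assoc) (rule sum.swap)

text \<open>A basis b of L together with functionals E that are dual to it but given on the whole
  coordinate space; these provide matrix coordinates on L.\<close>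

definition frame :: "('i::finite \<Rightarrow> complex) set \<Rightarrow> nat \<Rightarrow> (nat \<Rightarrow> 'i \<Rightarrow> complex) \<Rightarrow> (nat \<Rightarrow> 'i \<Rightarrow> complex) \<Rightarrow> bool" where
  "frame L m b E \<longleftrightarrow> (\<forall>j<m. b j \<in> L) \<and>
     (\<forall>i<m. \<forall>j<m. (\<Sum>p\<in>UNIV. b i p * E j p) = (if i = j then 1 else 0)) \<and>
     (\<forall>x\<in>L. x = (\<lambda>q. \<Sum>j<m. (\<Sum>p\<in>UNIV. x p * E j p) * b j q))"

text \<open>Induction on a set C of coordinates outside which L vanishes: imposing
  \<open>x p = 0\<close> removes p from C and costs at most one basis vector.\<close>

lemma lsub_frame:
  fixes L :: "('i::finite \<Rightarrow> complex) set"
  assumes "lsub L"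
  shows "\<exists>m b E. frame L m b E"
proof -
  let ?P = "\<lambda>x y. \<Sum>p\<in>UNIV. x p * (y p :: complex)"
  have "lsub L \<Longrightarrow> \<forall>x\<in>L. \<forall>p. p \<notin> C \<longrightarrow> x p = 0 \<Longrightarrow> \<exists>m b E. frame L m b E" if "finite C" for C :: "'i set" and L
    using that
  proof (induction C arbitrary: L)
    case empty
    then have "x = (\<lambda>_. 0)" if "x \<in> L" for x using that by auto
    then show ?case by (intro exI[of _ "0::nat"]) (simp add: frame_def)
  next
    case (insert p C)
    define L' where "L' = {x \<in> L. x p = 0}"
    have "lsub L'" using insert.prems(1) by (auto simp: lsub_def L'_def)
    moreover have "\<forall>x\<in>L'. \<forall>q. q \<notin> C \<longrightarrow> x q = 0" using insert.prems(2) by (auto simp: L'_def)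
    ultimately obtain m b E where fr: "frame L' m b E" using insert.IH[of L'] by blast
    then have b: "\<And>j. j < m \<Longrightarrow> b j \<in> L'"
      and E: "\<And>i j. i < m \<Longrightarrow> j < m \<Longrightarrow> ?P (b i) (E j) = (if i = j then 1 else 0)"
      and ex: "\<And>x. x \<in> L' \<Longrightarrow> x = (\<lambda>q. \<Sum>j<m. ?P x (E j) * b j q)"
      unfolding frame_def by blast+
    show ?case
    proof (cases "L' = L")
      case True
      then show ?thesis using fr by blast
    next
      case False
      then obtain x0 where x0: "x0 \<in> L" "x0 p \<noteq> 0" by (auto simp: L'_def)
      define x1 where "x1 = (\<lambda>q. inverse (x0 p) * x0 q)"
      have x1: "x1 \<in> L" "x1 p = 1" using x0 insert.prems(1) by (auto simp: x1_def lsub_def)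
      define s where "s = (\<lambda>q. \<Sum>j<m. ?P x1 (E j) * b j q)"
      have s: "s \<in> L" unfolding s_def
        by (rule lsub_sum[OF insert.prems(1)]) (use b in \<open>auto simp: L'_def\<close>)
      \<comment> \<open>Subtracting the component along the old basis makes the old functionals
        vanish on \<open>b0\<close>; since its coordinate at p stays 1, \<open>bas p\<close> serves
        as the new functional.\<close>
      define b0 where "b0 = (\<lambda>q. x1 q + (-1) * s q)"
      have b0: "b0 \<in> L" unfolding b0_def by (rule lsub_add[OF insert.prems(1) x1(1) lsub_scale[OF insert.prems(1) s]])
      have "s p = 0" unfolding s_def using b by (intro sum.neutral) (auto simp: L'_def)
      then have b0p: "b0 p = 1" by (simp add: b0_def x1)
      have sE: "?P s (E j) = ?P x1 (E j)" if "j < m" for j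
      proof -
        have "?P s (E j) = (\<Sum>i<m. ?P x1 (E i) * ?P (b i) (E j))"
          unfolding s_def by (rule pairing_sum)
        also have "\<dots> = (\<Sum>i<m. if i = j then ?P x1 (E j) else 0)"
          using that E by (intro sum.cong) auto
        finally show ?thesis using that by simp
      qed
      have b0E: "?P b0 (E j) = 0" if "j < m" for j
        using sE[OF that] by (simp add: b0_def left_diff_distrib sum_subtractf)
      have bp: "?P x (bas p) = x p" for x :: "'i \<Rightarrow> complex" by simp
      let ?b = "b(m := b0)" and ?E = "E(m := bas p)"
      have "x = (\<lambda>q. \<Sum>j<Suc m. ?P x (?E j) * ?b j q)" if x: "x \<in> L" for x
      proof -
        define y where "y = (\<lambda>q. x q + (- x p) * b0 q)"
        have "y \<in> L" unfolding y_def by (rule lsub_add[OF insert.prems(1) x lsub_scale[OF insert.prems(1) b0]])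
        then have "y \<in> L'" by (simp add: L'_def y_def b0p)
        then have y: "y q = (\<Sum>j<m. ?P y (E j) * b j q)" for q by (rule fun_cong[OF ex])
        have yE: "?P y (E j) = ?P x (E j)" if "j < m" for j
        proof -
          have "?P y (E j) = ?P x (E j) - x p * ?P b0 (E j)"
            by (simp add: y_def left_diff_distrib sum_subtractf sum_distrib_left mult.assoc)
          then show ?thesis using b0E[OF that] by simp
        qed
        have e1: "x q = y q + x p * b0 q" for q by (simp add: y_def)
        have e2: "y q = (\<Sum>j<m. ?P x (E j) * b j q)" for q
          unfolding y[of q] by (intro sum.cong refl) (simp add: yE)
        show ?thesis
        proof
          fix q
          have "(\<Sum>j<Suc m. ?P x (?E j) * ?b j q) = (\<Sum>j<m. ?P x (E j) * b j q) + x p * b0 q" by simp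
          then show "x q = (\<Sum>j<Suc m. ?P x (?E j) * ?b j q)" using e1[of q] e2[of q] by presburger
        qed
      qed
      moreover have "\<forall>i<Suc m. \<forall>j<Suc m. ?P (?b i) (?E j) = (if i = j then 1 else 0)"
        using E b0E b0p b by (auto simp: less_Suc_eq L'_def)
      moreover have "\<forall>j<Suc m. ?b j \<in> L" using b b0 by (auto simp: less_Suc_eq L'_def)
      ultimately have "frame L (Suc m) ?b ?E" unfolding frame_def by blast
      then show ?thesis by blast
    qed
  qed
  from this[of UNIV L] assms show ?thesis by simp
qed

text \<open>Take an L of least dimension: an included subspace of the same dimension is all of
  L.\<close>

lemma minimal_lsub:
  fixes L0 :: "('i::finite \<Rightarrow> complex) set"
  assumes "Q L0" "\<And>L. Q L \<Longrightarrow> lsub L"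
  obtains L where "Q L" "\<And>L'. Q L' \<Longrightarrow> L' \<subseteq> L \<Longrightarrow> L' = L"
proof -
  let ?s = "\<lambda>(c::complex) (f::'i \<Rightarrow> complex) i. c * f i"
  interpret v: vector_space ?s
    by unfold_locales (auto simp: fun_eq_iff algebra_simps)
  have apply_sum: "(\<Sum>k\<in>K. g k) i = (\<Sum>k\<in>K. g k i)" for K and g :: "'k \<Rightarrow> 'i \<Rightarrow> complex" and i
    by (induction K rule: infinite_finite_induct) auto
  have inj: "inj (bas :: 'i \<Rightarrow> _)" by (rule injI) (metis bas_def zero_neq_one)
  interpret f: finite_dimensional_vector_space ?s "range bas"
  proof
    show "finite (range (bas :: 'i \<Rightarrow> _))" by simp
    show "v.independent (range bas)"
    proof (rule v.independent_if_scalars_zero)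
      fix f and x :: "'i \<Rightarrow> complex" assume a: "(\<Sum>x\<in>range bas. ?s (f x) x) = 0" and x: "x \<in> range bas"
      from x obtain j where j: "x = bas j" by auto
      have "(\<Sum>i\<in>UNIV. ?s (f (bas i)) (bas i)) = 0" using a by (simp add: sum.reindex[OF inj])
      then have "(\<Sum>i\<in>UNIV. f (bas i) * bas i j) = 0" by (metis (no_types, lifting) apply_sum sum.cong zero_fun_apply)
      then show "f x = 0" by (simp add: j)
    qed simp
    show "v.span (range bas) = UNIV"
    proof -
      have "x \<in> v.span (range bas)" for x :: "'i \<Rightarrow> complex"
      proof -
        have "(\<Sum>i\<in>UNIV. ?s (x i) (bas i)) \<in> v.span (range bas)"
          by (intro v.span_sum v.span_scale v.span_base) simp
        moreover have "(\<Sum>i\<in>UNIV. ?s (x i) (bas i)) = x" by (rule ext) (simp add: apply_sum)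
        ultimately show ?thesis by simp
      qed
      then show ?thesis by blast
    qed
  qed
  have sub: "v.subspace L" if "Q L" for L
    using assms(2)[OF that] unfolding v.subspace_def lsub_def plus_fun_def zero_fun_def by auto
  obtain L where L: "Q L" "\<And>L'. Q L' \<Longrightarrow> v.dim L \<le> v.dim L'"
    using ex_has_least_nat[of Q L0 v.dim] assms(1) by blast
  show thesis
  proof (rule that[OF L(1)])
    fix L' assume "Q L'" "L' \<subseteq> L"
    then show "L' = L" using f.subspace_dim_equal[OF sub sub] L by simp
  qed
qed

section \<open>Independence of matrix coefficients\<close>

lemma mult_zero_vec: "A \<in> carrier_mat m n \<Longrightarrow> A *\<^sub>v 0\<^sub>v n = (0\<^sub>v m :: complex vec)"
  by (rule eq_vecI) auto

lemma is_repD: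
  assumes "is_rep H n \<rho>"
  shows "\<rho> f \<in> carrier_mat n n" "\<rho> (\<lambda>i. f i + g i) = \<rho> f + \<rho> g" "\<rho> (\<lambda>i. c * f i) = c \<cdot>\<^sub>m \<rho> f"
    "\<rho> (dmul H f g) = \<rho> f * \<rho> g" "\<rho> (ep H) = 1\<^sub>m n"
  using assms unfolding is_rep_def by auto

context
  fixes H :: "('i::finite) wha" and nd :: "'r::finite \<Rightarrow> nat" and \<psi> :: "'r \<Rightarrow> ('i \<Rightarrow> complex) \<Rightarrow> complex mat"
  assumes wha: "weak_hopf_algebra H" and irr: "irreps H nd \<psi>"
begin

lemma psi_rep: "is_rep H (nd a) (\<psi> a)" and psi_irr: "irreducible_rep (nd a) (\<psi> a)"
  using irr by (auto simp: irreps_def)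

lemmas psi = is_repD[OF psi_rep]

lemma psi_dim [simp]: "dim_row (\<psi> a f) = nd a" "dim_col (\<psi> a f) = nd a"
  using psi(1)[of a f] by auto

lemma psi_lin:
  assumes "i < nd a" "j < nd a"
  shows "lin (\<lambda>f. \<psi> a f $$ (i, j))"
  by (rule linI) (use assms in \<open>simp_all add: psi(2,3)\<close>)

lemma psi_intertwiner_zero:
  assumes "a \<noteq> b" "P \<in> carrier_mat (nd b) (nd a)" "\<And>f. \<psi> b f * P = P * \<psi> a f"
  shows "P = 0\<^sub>m (nd b) (nd a)"
proof (rule ccontr)
  assume "P \<noteq> 0\<^sub>m (nd b) (nd a)"
  from schur_iso[OF psi_irr psi_irr psi(1) psi(1) assms(2,3) this]
  have "iso_rep (nd b) (\<psi> b) (nd a) (\<psi> a)"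
    using assms unfolding iso_rep_def by auto
  then show False using irr assms(1) unfolding irreps_def by blast
qed

text \<open>The relations among a minimal family of matrix coefficients form a module that projects isomorphically
onto each of its factors, so by Schur's lemma all factors are scalar multiples of a single one.\<close>

lemma coefficient_relation:
  assumes "finite K" "\<And>k. k \<in> K \<Longrightarrow> snd k < nd (fst k)" "\<And>k. X k \<in> carrier_vec (nd (fst k))"
    "\<And>f. (\<Sum>k\<in>K. (\<psi> (fst k) f *\<^sub>v X k) $ snd k) = 0"
  shows "\<forall>k\<in>K. X k = 0\<^sub>v (nd (fst k))"
  using assms
proof (induction K arbitrary: X rule: finite_psubset_induct)
  case (psubset K)
  show ?case
  proof (rule ccontr)
    assume "\<not> ?case"
    then obtain k0 where k0: "k0 \<in> K" "X k0 \<noteq> 0\<^sub>v (nd (fst k0))" by blast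
    define a where "a = fst k0"
    \<comment> \<open>The module of all relations with index set K. An index is a pair of a
      representation and a row.\<close>
    define R where "R = {X. (\<forall>k. X k \<in> carrier_vec (nd (fst k))) \<and> (\<forall>f. (\<Sum>k\<in>K. (\<psi> (fst k) f *\<^sub>v X k) $ snd k) = 0)}"
    have RI: "Y \<in> R" if "\<And>k. Y k \<in> carrier_vec (nd (fst k))" "\<And>f. (\<Sum>k\<in>K. (\<psi> (fst k) f *\<^sub>v Y k) $ snd k) = 0" for Y
      unfolding R_def using that by blast
    have Rcar: "Y k \<in> carrier_vec (nd (fst k))" if "Y \<in> R" for Y k using that unfolding R_def by blast
    have Rdim: "dim_vec (Y k) = nd (fst k)" if "Y \<in> R" for Y k using Rcar[OF that, of k] by simp
    have Rrel: "(\<Sum>k\<in>K. (\<psi> (fst k) f *\<^sub>v Y k) $ snd k) = 0" if "Y \<in> R" for Y f using that unfolding R_def by blast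
    have XR: "X \<in> R" using psubset.prems by (intro RI)
    have idx: "snd k < nd (fst k)" if "k \<in> K" for k using psubset.prems(1) that .
    have Radd: "(\<lambda>k. Y k + Z k) \<in> R" if "Y \<in> R" "Z \<in> R" for Y Z
    proof -
      have "(\<psi> (fst k) f *\<^sub>v (Y k + Z k)) $ snd k = (\<psi> (fst k) f *\<^sub>v Y k) $ snd k + (\<psi> (fst k) f *\<^sub>v Z k) $ snd k" if "k \<in> K" for k f
        using idx[OF that] by (simp add: mult_add_distrib_mat_vec[OF psi(1) Rcar Rcar] \<open>Y \<in> R\<close> \<open>Z \<in> R\<close>)
      then show ?thesis using that by (intro RI) (simp_all add: Rcar Rrel sum.distrib)
    qed
    have Rsmult: "(\<lambda>k. c \<cdot>\<^sub>v Y k) \<in> R" if "Y \<in> R" for Y c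
    proof -
      have "(\<psi> (fst k) f *\<^sub>v (c \<cdot>\<^sub>v Y k)) $ snd k = c * (\<psi> (fst k) f *\<^sub>v Y k) $ snd k" if "k \<in> K" for k f
        using idx[OF that] by (simp add: mult_mat_vec[OF psi(1) Rcar] \<open>Y \<in> R\<close>)
      then show ?thesis using that by (intro RI) (simp_all add: Rcar Rrel flip: sum_distrib_left)
    qed
    have Ract: "(\<lambda>k. \<psi> (fst k) g *\<^sub>v Y k) \<in> R" if "Y \<in> R" for Y g
    proof -
      have "\<psi> (fst k) f *\<^sub>v (\<psi> (fst k) g *\<^sub>v Y k) = \<psi> (fst k) (dmul H f g) *\<^sub>v Y k" for k f
        unfolding psi(4) by (rule assoc_mult_mat_vec[OF psi(1) psi(1) Rcar[OF that], symmetric])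
      then show ?thesis using that by (intro RI mult_mat_vec_carrier[OF psi(1) Rcar[OF that]]) (simp add: Rrel)
    qed
    \<comment> \<open>A relation whose entry at k0 vanishes is a relation over the smaller index
      set, so the induction hypothesis applies.\<close>
    have uniq: "Y k = 0\<^sub>v (nd (fst k))" if Y: "Y \<in> R" "Y k0 = 0\<^sub>v (nd a)" and k: "k \<in> K" for Y k
    proof (cases "k = k0")
      case True then show ?thesis using Y by (simp add: a_def)
    next
      case False
      have "\<forall>k\<in>K - {k0}. Y k = 0\<^sub>v (nd (fst k))"
      proof (rule psubset.IH)
        show "K - {k0} \<subset> K" using k0 by blast
        fix f
        have "\<psi> a f *\<^sub>v Y k0 = 0\<^sub>v (nd a)"
          unfolding Y(2) by (rule mult_zero_vec[OF psi(1)])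
        then have "(\<psi> (fst k0) f *\<^sub>v Y k0) $ snd k0 = 0" using idx[OF k0(1)] by (simp add: a_def)
        moreover have "(\<Sum>k\<in>K. (\<psi> (fst k) f *\<^sub>v Y k) $ snd k) = 0" by (rule Rrel[OF Y(1)])
        ultimately show "(\<Sum>k\<in>K - {k0}. (\<psi> (fst k) f *\<^sub>v Y k) $ snd k) = 0"
          using k0(1) psubset.hyps by (simp add: sum.remove)
      qed (use Rcar[OF Y(1)] idx in auto)
      then show ?thesis using False k by blast
    qed
    have Rcar0: "Y k0 \<in> carrier_vec (nd a)" if "Y \<in> R" for Y using Rcar[OF that, of k0] by (simp add: a_def)
    \<comment> \<open>Taking the entry at k0 is a module map with nonzero image, so by
      irreducibility it is onto.\<close>
    have "(\<lambda>Y. Y k0) ` R = {0\<^sub>v (nd a)} \<or> (\<lambda>Y. Y k0) ` R = carrier_vec (nd a)"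
    proof (rule irreducible_repD[OF psi_irr])
      show "(\<lambda>Y. Y k0) ` R \<subseteq> carrier_vec (nd a)" using Rcar0 by blast
      have "0 \<cdot>\<^sub>v X k0 = 0\<^sub>v (nd a)" using Rcar0[OF XR] by (auto intro!: eq_vecI)
      then show "0\<^sub>v (nd a) \<in> (\<lambda>Y. Y k0) ` R" using Rsmult[OF XR, of 0] by (metis (no_types, lifting) imageI)
      show "\<And>x y. x \<in> (\<lambda>Y. Y k0) ` R \<Longrightarrow> y \<in> (\<lambda>Y. Y k0) ` R \<Longrightarrow> x + y \<in> (\<lambda>Y. Y k0) ` R"
        using Radd by (auto intro!: image_eqI)
      show "\<And>c x. x \<in> (\<lambda>Y. Y k0) ` R \<Longrightarrow> c \<cdot>\<^sub>v x \<in> (\<lambda>Y. Y k0) ` R"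
        using Rsmult by (auto intro!: image_eqI)
      show "\<And>f x. x \<in> (\<lambda>Y. Y k0) ` R \<Longrightarrow> \<psi> a f *\<^sub>v x \<in> (\<lambda>Y. Y k0) ` R"
        using Ract by (auto simp: a_def intro!: image_eqI)
    qed
    moreover have "(\<lambda>Y. Y k0) ` R \<noteq> {0\<^sub>v (nd a)}" using XR k0 by (auto simp: a_def)
    ultimately have full: "(\<lambda>Y. Y k0) ` R = carrier_vec (nd a)" by blast
    have "\<exists>Y. y \<in> carrier_vec (nd a) \<longrightarrow> Y \<in> R \<and> Y k0 = y" for y
    proof (cases "y \<in> carrier_vec (nd a)")
      case True
      then have "y \<in> (\<lambda>Y. Y k0) ` R" by (simp add: full)
      then show ?thesis by auto
    qed simp
    then obtain Y where Y: "\<And>y. y \<in> carrier_vec (nd a) \<Longrightarrow> Y y \<in> R" "\<And>y. y \<in> carrier_vec (nd a) \<Longrightarrow> Y y k0 = y"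
      by metis
    have eqR: "U k = V k" if "U \<in> R" "V \<in> R" "U k0 = V k0" "k \<in> K" for U V k
    proof -
      have "(\<lambda>k. U k + (-1) \<cdot>\<^sub>v V k) \<in> R" using Radd[OF that(1) Rsmult[OF that(2)]] .
      moreover have "U k0 + (-1) \<cdot>\<^sub>v V k0 = 0\<^sub>v (nd a)" using that(3) Rcar0[OF that(2)] by (auto intro!: eq_vecI)
      ultimately have z: "U k + (-1) \<cdot>\<^sub>v V k = 0\<^sub>v (nd (fst k))" using uniq[of "\<lambda>k. U k + (-1) \<cdot>\<^sub>v V k" k] that(4) by blast
      show ?thesis
      proof (rule eq_vecI)
        fix i assume i: "i < dim_vec (V k)"
        have "(U k + (-1) \<cdot>\<^sub>v V k) $ i = 0" unfolding z using i Rcar[OF that(2), of k] by simp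
        then show "U k $ i = V k $ i" using i by simp
      qed (use Rcar[OF that(1), of k] Rcar[OF that(2), of k] in auto)
    qed
    \<comment> \<open>By uniqueness, the entry at k of a relation is a linear function of its entry
      at k0, given by a matrix \<open>P k\<close>, which is then an intertwiner.\<close>
    have "\<exists>P. P \<in> carrier_mat (nd (fst k)) (nd a) \<and> (\<forall>y\<in>carrier_vec (nd a). P *\<^sub>v y = Y y k)" if k: "k \<in> K" for k
    proof (rule linear_map_mat[of "nd a" "\<lambda>y. Y y k" "nd (fst k)"])
      fix y :: "complex vec" assume y: "y \<in> carrier_vec (nd a)"
      show "Y y k \<in> carrier_vec (nd (fst k))" by (rule Rcar[OF Y(1)[OF y]])
      show "Y (c \<cdot>\<^sub>v y) k = c \<cdot>\<^sub>v Y y k" for c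
        by (rule eqR[OF _ Rsmult[OF Y(1)[OF y]] _ k]) (use Y y in auto)
      fix z :: "complex vec" assume z: "z \<in> carrier_vec (nd a)"
      show "Y (y + z) k = Y y k + Y z k"
        by (rule eqR[OF _ Radd[OF Y(1)[OF y] Y(1)[OF z]] _ k]) (use Y y z in auto)
    qed blast
    then obtain P where P: "\<And>k. k \<in> K \<Longrightarrow> P k \<in> carrier_mat (nd (fst k)) (nd a)"
      and PY: "\<And>k y. k \<in> K \<Longrightarrow> y \<in> carrier_vec (nd a) \<Longrightarrow> P k *\<^sub>v y = Y y k" by metis
    have inter: "\<psi> (fst k) f * P k = P k * \<psi> a f" if k: "k \<in> K" for k f
    proof (rule eq_mat_on_vecs)
      show "\<psi> (fst k) f * P k \<in> carrier_mat (nd (fst k)) (nd a)" "P k * \<psi> a f \<in> carrier_mat (nd (fst k)) (nd a)"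
        using P[OF k] psi(1) by (auto intro: mult_carrier_mat)
      fix y :: "complex vec" assume y: "y \<in> carrier_vec (nd a)"
      have fy: "\<psi> a f *\<^sub>v y \<in> carrier_vec (nd a)" using y psi(1) by (auto intro: mult_mat_vec_carrier)
      have "\<psi> (fst k) f *\<^sub>v Y y k = Y (\<psi> a f *\<^sub>v y) k"
        by (rule eqR[OF Ract[OF Y(1)[OF y]] Y(1)[OF fy] _ k]) (use Y(2) y fy in \<open>simp add: a_def\<close>)
      then show "\<psi> (fst k) f * P k *\<^sub>v y = P k * \<psi> a f *\<^sub>v y"
        using assoc_mult_mat_vec[OF psi(1) P[OF k] y] assoc_mult_mat_vec[OF P[OF k] psi(1) y] PY[OF k] y fy by simp
    qed
    \<comment> \<open>The relation with the unit vector of row \<open>snd k0\<close> as its entry at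
      k0 is evaluated at \<open>ep H\<close>. Every other index contributes 0: either its
      intertwiner vanishes, or it is scalar and a different row is read off. This leaves 1 =
      0.\<close>
    define y :: "complex vec" where "y = unit_vec (nd a) (snd k0)"
    have y: "y \<in> carrier_vec (nd a)" by (simp add: y_def)
    have val: "(P k *\<^sub>v y) $ snd k = (if k = k0 then 1 else 0)" if k: "k \<in> K" for k
    proof (cases "k = k0")
      case True
      then show ?thesis using PY[OF k y] Y(2)[OF y] idx[OF k] by (simp add: y_def a_def)
    next
      case False
      show ?thesis
      proof (cases "fst k = a")
        case True
        then have "P k \<in> carrier_mat (nd a) (nd a)" "\<And>f. \<psi> a f * P k = P k * \<psi> a f"
          using P[OF k] inter[OF k] by auto
        then obtain c where c: "P k = c \<cdot>\<^sub>m 1\<^sub>m (nd a)" using schur_scalar[OF psi_irr psi(1)] by metis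
        have "snd k \<noteq> snd k0" using False True by (auto simp: a_def prod_eq_iff)
        then have "(P k *\<^sub>v y) $ snd k = 0"
          using idx[OF k] idx[OF k0(1)] True unfolding y_def
          by (subst mult_unit_vec[OF P[OF k]]) (auto simp: a_def c)
        then show ?thesis using False by simp
      next
        case neq: False
        then have "P k = 0\<^sub>m (nd (fst k)) (nd a)" using psi_intertwiner_zero[of a "fst k", OF _ P[OF k] inter[OF k]] by auto
        then show ?thesis using False y idx[OF k] by simp
      qed
    qed
    have "(\<Sum>k\<in>K. (\<psi> (fst k) (ep H) *\<^sub>v Y y k) $ snd k) = 0" by (rule Rrel[OF Y(1)[OF y]])
    moreover have "\<psi> (fst k) (ep H) *\<^sub>v Y y k = P k *\<^sub>v y" if "k \<in> K" for k
      using PY[OF that y] Rcar[OF Y(1)[OF y], of k] by (simp add: psi(5))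
    ultimately have "(\<Sum>k\<in>K. if k = k0 then 1 else (0::complex)) = 0" using val by simp
    then show False using k0(1) psubset.hyps by simp
  qed
qed

lemma coefficients_independent:
  assumes "\<And>f. (\<Sum>a\<in>UNIV. \<Sum>i<nd a. \<Sum>j<nd a. M a i j * \<psi> a f $$ (i, j)) = 0" "i < nd a" "j < nd a"
  shows "M a i j = 0"
proof -
  let ?K = "SIGMA a:UNIV. {..<nd a}"
  define X where "X k = vec (nd (fst k)) (\<lambda>j. M (fst k) (snd k) j)" for k
  have "\<forall>k\<in>?K. X k = 0\<^sub>v (nd (fst k))"
  proof (rule coefficient_relation)
    fix f
    have "(\<Sum>k\<in>?K. (\<psi> (fst k) f *\<^sub>v X k) $ snd k) = (\<Sum>a\<in>UNIV. \<Sum>i<nd a. (\<psi> a f *\<^sub>v X (a, i)) $ i)"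
      by (subst sum.Sigma) (auto intro!: sum.cong)
    also have "\<dots> = (\<Sum>a\<in>UNIV. \<Sum>i<nd a. \<Sum>j<nd a. M a i j * \<psi> a f $$ (i, j))"
      by (intro sum.cong refl) (auto simp: X_def scalar_prod_def atLeast0LessThan mult.commute intro!: sum.cong)
    finally show "(\<Sum>k\<in>?K. (\<psi> (fst k) f *\<^sub>v X k) $ snd k) = 0" using assms(1) by simp
  qed (auto simp: X_def)
  then have "X (a, i) $ j = 0" using assms(2,3) by simp
  then show ?thesis using assms(2,3) by (simp add: X_def)
qed

end

section \<open>Joint faithfulness of the irreducible representations and matrix units\<close>

context
  fixes H :: "('i::finite) wha" and nd :: "'r::finite \<Rightarrow> nat" and \<psi> :: "'r \<Rightarrow> ('i \<Rightarrow> complex) \<Rightarrow> complex mat"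
  assumes wha: "weak_hopf_algebra H" and ss: "dual_semisimple H" and irr: "irreps H nd \<psi>"
begin

lemmas psi_rules = is_repD[OF psi_rep[OF wha irr]]

lemma dmul_add_left: "dmul H (\<lambda>i. x i + y i) z = (\<lambda>i. dmul H x z i + dmul H y z i)"
  using lin_add[OF lin_coord_comp[OF dmul_lin1[OF wha]]] by (intro ext)
lemma dmul_scale_left: "dmul H (\<lambda>i. c * x i) z = (\<lambda>i. c * dmul H x z i)"
  using lin_scale[OF lin_coord_comp[OF dmul_lin1[OF wha]]] by (intro ext)
lemma dmul_zero_left: "dmul H (\<lambda>i. 0) z = (\<lambda>i. 0)"
  using lin_zero[OF lin_coord_comp[OF dmul_lin1[OF wha]]] by (intro ext)
lemma dmul_add_right: "dmul H z (\<lambda>i. x i + y i) = (\<lambda>i. dmul H z x i + dmul H z y i)"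
  using lin_add[OF lin_coord_comp[OF dmul_lin2[OF wha]]] by (intro ext)
lemma dmul_scale_right: "dmul H z (\<lambda>i. c * x i) = (\<lambda>i. c * dmul H z x i)"
  using lin_scale[OF lin_coord_comp[OF dmul_lin2[OF wha]]] by (intro ext)
lemma dmul_zero_right: "dmul H z (\<lambda>i. 0) = (\<lambda>i. 0)"
  using lin_zero[OF lin_coord_comp[OF dmul_lin2[OF wha]]] by (intro ext)
lemma dmul_sum_right: "dmul H z (\<lambda>i. \<Sum>k\<in>K. c k * x k i) = (\<lambda>i. \<Sum>k\<in>K. c k * dmul H z (x k) i)"
proof
  fix i
  have l: "lin (\<lambda>y. dmul H z y i)" by (rule lin_coord_comp[OF dmul_lin2[OF wha]])
  show "dmul H z (\<lambda>i. \<Sum>k\<in>K. c k * x k i) i = (\<Sum>k\<in>K. c k * dmul H z (x k) i)"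
    using lin_sum[OF l, where x="\<lambda>k i. c k * x k i" and K=K] by (simp add: dmul_scale_right)
qed

definition left_ideal :: "('i \<Rightarrow> complex) set \<Rightarrow> bool" where
  "left_ideal L \<longleftrightarrow> lsub L \<and> (\<forall>f. \<forall>x\<in>L. dmul H f x \<in> L)"

text \<open>A minimal left ideal carries an irreducible representation, hence one isomorphic to some
  \<psi>_a, and there f acts as zero.\<close>

lemma minimal_left_ideal_killed:
  assumes L: "left_ideal L" and nz: "L \<noteq> {\<lambda>_. 0}"
    and min: "\<And>L'. left_ideal L' \<Longrightarrow> L' \<noteq> {\<lambda>_. 0} \<Longrightarrow> L' \<subseteq> L \<Longrightarrow> L' = L"
    and f: "\<And>a. \<psi> a f = 0\<^sub>m (nd a) (nd a)" and x: "x \<in> L"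
  shows "dmul H f x = (\<lambda>_. 0)"
proof -
  let ?P = "\<lambda>x y. \<Sum>p\<in>UNIV. x p * (y p :: complex)"
  have ls: "lsub L" and act: "\<And>f x. x \<in> L \<Longrightarrow> dmul H f x \<in> L" using L by (auto simp: left_ideal_def)
  obtain m b E where fr: "frame L m b E" using lsub_frame[OF ls] by blast
  have b: "\<And>j. j < m \<Longrightarrow> b j \<in> L"
    and E: "\<And>i j. i < m \<Longrightarrow> j < m \<Longrightarrow> ?P (b i) (E j) = (if i = j then 1 else 0)"
    and ex: "\<And>x. x \<in> L \<Longrightarrow> x = (\<lambda>q. \<Sum>j<m. ?P x (E j) * b j q)"
    using fr unfolding frame_def by blast+
  \<comment> \<open>The action on L in the coordinates of the frame; \<open>emb\<close> goes back
    from coordinates to elements of L and carries invariant subspaces to left ideals.\<close>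
  define \<rho> where "\<rho> f = mat m m (\<lambda>(i, j). ?P (dmul H f (b j)) (E i))" for f
  define emb where "emb x = (\<lambda>q. \<Sum>j<m. x $ j * b j q)" for x
  have embL: "emb x \<in> L" for x unfolding emb_def by (rule lsub_sum[OF ls]) (use b in auto)
  have embE: "?P (emb x) (E i) = x $ i" if "i < m" for x i
  proof -
    have "?P (emb x) (E i) = (\<Sum>j<m. x $ j * ?P (b j) (E i))" unfolding emb_def by (rule pairing_sum)
    also have "\<dots> = (\<Sum>j<m. if j = i then x $ i else 0)" using E that by (intro sum.cong) auto
    finally show ?thesis using that by simp
  qed
  have emb_inj: "x = y" if "x \<in> carrier_vec m" "y \<in> carrier_vec m" "emb x = emb y" for x y
  proof (rule eq_vecI)
    fix i assume "i < dim_vec y"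
    then show "x $ i = y $ i" using embE[of i x] embE[of i y] that by simp
  qed (use that in auto)
  have emb_act: "emb (\<rho> f *\<^sub>v x) = dmul H f (emb x)" if x: "x \<in> carrier_vec m" for f x
  proof -
    have 1: "dmul H f (emb x) = (\<lambda>q. \<Sum>j<m. x $ j * dmul H f (b j) q)" unfolding emb_def by (rule dmul_sum_right)
    have "?P (dmul H f (emb x)) (E i) = (\<rho> f *\<^sub>v x) $ i" if i: "i < m" for i
    proof -
      have "?P (dmul H f (emb x)) (E i) = (\<Sum>j<m. x $ j * ?P (dmul H f (b j)) (E i))" unfolding 1 by (rule pairing_sum)
      also have "\<dots> = (\<rho> f *\<^sub>v x) $ i" using i x
        by (auto simp: \<rho>_def scalar_prod_def atLeast0LessThan mult.commute intro!: sum.cong)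
      finally show ?thesis .
    qed
    then have "(\<Sum>i<m. ?P (dmul H f (emb x)) (E i) * b i q) = emb (\<rho> f *\<^sub>v x) q" for q
      unfolding emb_def[of "\<rho> f *\<^sub>v x"] by (intro sum.cong refl) simp
    then show ?thesis using fun_cong[OF ex[OF act[OF embL, of f x]]] by (intro ext) metis
  qed
  have rc: "\<rho> f \<in> carrier_mat m m" for f by (simp add: \<rho>_def)
  have rep: "is_rep H m \<rho>" unfolding is_rep_def
  proof (intro conjI allI)
    fix f g :: "'i \<Rightarrow> complex" and c :: complex
    show "\<rho> f \<in> carrier_mat m m" by (rule rc)
    show "\<rho> (\<lambda>i. f i + g i) = \<rho> f + \<rho> g"
      by (rule eq_matI) (auto simp: \<rho>_def dmul_add_left distrib_right sum.distrib)
    show "\<rho> (\<lambda>i. c * f i) = c \<cdot>\<^sub>m \<rho> f"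
      by (rule eq_matI) (auto simp: \<rho>_def dmul_scale_left sum_distrib_left mult.assoc)
    show "\<rho> (dmul H f g) = \<rho> f * \<rho> g"
    proof (rule eq_mat_on_vecs[OF rc mult_carrier_mat[OF rc rc]])
      fix y :: "complex vec" assume y: "y \<in> carrier_vec m"
      have gy: "\<rho> g *\<^sub>v y \<in> carrier_vec m" by (rule mult_mat_vec_carrier[OF rc y])
      have "emb (\<rho> (dmul H f g) *\<^sub>v y) = emb (\<rho> f *\<^sub>v (\<rho> g *\<^sub>v y))"
        using y gy by (simp add: emb_act dmul_assoc[OF wha])
      then have "\<rho> (dmul H f g) *\<^sub>v y = \<rho> f *\<^sub>v (\<rho> g *\<^sub>v y)"
        by (rule emb_inj[OF mult_mat_vec_carrier[OF rc y] mult_mat_vec_carrier[OF rc gy]])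
      then show "\<rho> (dmul H f g) *\<^sub>v y = \<rho> f * \<rho> g *\<^sub>v y" using assoc_mult_mat_vec[OF rc rc y] by simp
    qed
    show "\<rho> (ep H) = 1\<^sub>m m"
      by (rule eq_matI) (auto simp: \<rho>_def dmul_one_left[OF wha] E)
  qed
  have irr_rho: "irreducible_rep m \<rho>" unfolding irreducible_rep_def
  proof (intro conjI allI impI)
    show "m > 0"
    proof (rule ccontr)
      assume "\<not> m > 0"
      then have "x = (\<lambda>_. 0)" if "x \<in> L" for x using ex[OF that] by simp
      then show False using nz ls unfolding lsub_def by blast
    qed
    fix U assume U: "U \<subseteq> carrier_vec m" and inv: "0\<^sub>v m \<in> U \<and> (\<forall>x\<in>U. \<forall>y\<in>U. x + y \<in> U) \<and> (\<forall>c. \<forall>x\<in>U. c \<cdot>\<^sub>v x \<in> U) \<and>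
         (\<forall>f. \<forall>x\<in>U. \<rho> f *\<^sub>v x \<in> U)"
    have emb0: "emb (0\<^sub>v m) = (\<lambda>_. 0)" by (simp add: emb_def)
    have "left_ideal (emb ` U)"
      unfolding left_ideal_def lsub_def
    proof (intro conjI ballI allI)
      show "(\<lambda>_. 0) \<in> emb ` U" using inv emb0 by (metis imageI)
    next
      fix x y assume "x \<in> emb ` U" "y \<in> emb ` U"
      then obtain x' y' where xy: "x = emb x'" "y = emb y'" "x' \<in> U" "y' \<in> U" by blast
      then have c: "x' \<in> carrier_vec m" "y' \<in> carrier_vec m" using U by auto
      have "(\<lambda>i. x i + y i) = emb (x' + y')"
        unfolding xy(1,2) emb_def by (intro ext) (use c in \<open>simp add: distrib_right sum.distrib\<close>)
      then show "(\<lambda>i. x i + y i) \<in> emb ` U" using inv xy by simp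
    next
      fix c x assume "x \<in> emb ` U"
      then obtain x' where xy: "x = emb x'" "x' \<in> U" by blast
      then have x': "x' \<in> carrier_vec m" using U by auto
      have "(\<lambda>i. c * x i) = emb (c \<cdot>\<^sub>v x')"
        unfolding xy(1) emb_def by (intro ext) (use x' in \<open>simp add: sum_distrib_left mult.assoc\<close>)
      then show "(\<lambda>i. c * x i) \<in> emb ` U" using inv xy by simp
    next
      fix f x assume "x \<in> emb ` U"
      then obtain x' where xy: "x = emb x'" "x' \<in> U" by blast
      then have "dmul H f x = emb (\<rho> f *\<^sub>v x')" using U by (simp add: emb_act subset_iff)
      then show "dmul H f x \<in> emb ` U" using inv xy by simp
    qed
    moreover have "emb ` U \<subseteq> L" using embL by blast
    ultimately have d: "emb ` U = {\<lambda>_. 0} \<or> emb ` U = L" using min by blast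
    show "U = {0\<^sub>v m} \<or> U = carrier_vec m"
    proof (cases "emb ` U = {\<lambda>_. 0}")
      case True
      have "x = 0\<^sub>v m" if "x \<in> U" for x
      proof -
        have "emb x = emb (0\<^sub>v m)" using True that emb0 by auto
        then show ?thesis using emb_inj[of x "0\<^sub>v m"] U that by auto
      qed
      then show ?thesis using inv by blast
    next
      case False
      then have eq: "emb ` U = L" using d by blast
      have "y \<in> U" if "y \<in> carrier_vec m" for y
      proof -
        have "emb y \<in> emb ` U" unfolding eq by (rule embL)
        then obtain x where "x \<in> U" "emb y = emb x" by blast
        then show ?thesis using emb_inj[OF that, of x] U by auto
      qed
      then show ?thesis using U by blast
    qed
  qed
  obtain a where "iso_rep m \<rho> (nd a) (\<psi> a)" using irr rep irr_rho unfolding irreps_def by blast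
  then obtain P where m: "m = nd a" and P: "P \<in> carrier_mat m m" "invertible_mat P" "\<And>f. \<rho> f * P = P * \<psi> a f"
    unfolding iso_rep_def by blast
  obtain Q where Q: "P * Q = 1\<^sub>m m" "Q \<in> carrier_mat m m"
  proof -
    obtain Q where "inverts_mat P Q" "inverts_mat Q P" using P(2) unfolding invertible_mat_def by blast
    then have "P * Q = 1\<^sub>m m" "Q * P = 1\<^sub>m (dim_row Q)" using P(1) by (auto simp: inverts_mat_def)
    moreover have "dim_col Q = m" using arg_cong[OF calculation(1), of dim_col] by simp
    moreover have "dim_row Q = m" using arg_cong[OF calculation(2), of dim_col] P(1) by simp
    ultimately show thesis using that by auto
  qed
  have "\<rho> f * P = 0\<^sub>m m m" unfolding P(3) f using P(1) m by simp
  then have "\<rho> f * (P * Q) = 0\<^sub>m m m" using assoc_mult_mat[OF rc[of f] P(1) Q(2)] Q(2) by simp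
  then have rf: "\<rho> f = 0\<^sub>m m m" using rc[of f] by (simp add: Q(1))
  have "x = emb (vec m (\<lambda>j. ?P x (E j)))" using ex[OF x] unfolding emb_def by simp
  then have "dmul H f x = emb (\<rho> f *\<^sub>v vec m (\<lambda>j. ?P x (E j)))" by (subst emb_act) auto
  also have "\<dots> = (\<lambda>_. 0)" unfolding rf emb_def by simp
  finally show ?thesis .
qed

text \<open>The common kernel $J$ of the irreducible representations kills every minimal left ideal contained in it,
so $\{x \in J.\ Jx = 0\}$ is nonzero if $J$ is; but this ideal squares to zero.\<close>

lemma psi_jointly_injective:
  assumes f: "\<And>a. \<psi> a f = 0\<^sub>m (nd a) (nd a)"
  shows "f = (\<lambda>_. 0)"
proof (rule ccontr)
  assume fnz: "f \<noteq> (\<lambda>_. 0)"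
  define J where "J = {f. \<forall>a. \<psi> a f = 0\<^sub>m (nd a) (nd a)}"
  have psi0: "\<psi> a (\<lambda>_. 0) = 0\<^sub>m (nd a) (nd a)" for a
  proof -
    have "0 \<cdot>\<^sub>m \<psi> a (\<lambda>_. 0) = 0\<^sub>m (nd a) (nd a)" using psi_rules(1)[of a "\<lambda>_. 0"] by (auto intro!: eq_matI)
    then show ?thesis using psi_rules(3)[of a 0 "\<lambda>_. 0"] by simp
  qed
  have J0: "(\<lambda>_. 0) \<in> J" using psi0 by (simp add: J_def)
  have Jadd: "x \<in> J \<Longrightarrow> y \<in> J \<Longrightarrow> (\<lambda>i. x i + y i) \<in> J" for x y by (simp add: J_def psi_rules(2))
  have Jsc: "x \<in> J \<Longrightarrow> (\<lambda>i. c * x i) \<in> J" for x c by (auto simp: J_def psi_rules(3) intro!: eq_matI)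
  have Jl: "x \<in> J \<Longrightarrow> dmul H y x \<in> J" for x y by (simp add: J_def psi_rules(4) right_mult_zero_mat[OF psi_rules(1)])
  have Jr: "x \<in> J \<Longrightarrow> dmul H x y \<in> J" for x y by (simp add: J_def psi_rules(4) left_mult_zero_mat[OF psi_rules(1)])
  \<comment> \<open>The containment in J passes to subsets, so a minimal L of this kind is minimal
    among all nonzero left ideals.\<close>
  define Q where "Q L \<longleftrightarrow> left_ideal L \<and> L \<noteq> {\<lambda>_. 0} \<and> L \<subseteq> J" for L
  have "Q J" unfolding Q_def left_ideal_def lsub_def using J0 Jadd Jsc Jl fnz f by (auto simp: J_def)
  then obtain L where L: "Q L" and min: "\<And>L'. Q L' \<Longrightarrow> L' \<subseteq> L \<Longrightarrow> L' = L"
    by (rule minimal_lsub) (auto simp: Q_def left_ideal_def)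
  define I where "I = {x \<in> J. \<forall>g\<in>J. dmul H g x = (\<lambda>_. 0)}"
  have "L \<subseteq> I"
  proof
    fix x assume x: "x \<in> L"
    have "dmul H g x = (\<lambda>_. 0)" if "g \<in> J" for g
    proof (rule minimal_left_ideal_killed[of L])
      fix L' assume "left_ideal L'" "L' \<noteq> {\<lambda>_. 0}" "L' \<subseteq> L"
      then show "L' = L" using L min[of L'] by (auto simp: Q_def)
    qed (use L x that in \<open>auto simp: Q_def J_def\<close>)
    then show "x \<in> I" using x L by (auto simp: I_def Q_def)
  qed
  moreover have "I = {\<lambda>_. 0}"
  proof -
    have "alg_ideal (dmul H) I" unfolding alg_ideal_def
    proof (intro conjI ballI allI)
      show "(\<lambda>_. 0) \<in> I" using J0 by (simp add: I_def dmul_zero_right)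
      fix x assume x: "x \<in> I"
      show "(\<lambda>i. c * x i) \<in> I" for c using x Jsc by (simp add: I_def dmul_scale_right)
      show "dmul H x y \<in> I" for y using x Jr by (simp add: I_def dmul_assoc[OF wha, symmetric] dmul_zero_left)
      show "dmul H y x \<in> I" for y using x Jl Jr by (simp add: I_def dmul_assoc[OF wha, symmetric])
      fix y assume y: "y \<in> I"
      show "(\<lambda>i. x i + y i) \<in> I" using x y Jadd by (simp add: I_def dmul_add_right)
    qed
    moreover have "nilpotent_ideal (dmul H) (ep H) I" unfolding nilpotent_ideal_def
    \<comment> \<open>Exponent 2 suffices: in a product of two elements of I, the left factor lies
      in J and the right factor is killed by J.\<close>
    proof (intro exI[of _ 2] conjI allI impI)
      fix xs :: "('i \<Rightarrow> complex) list" assume xs: "length xs = 2 \<and> set xs \<subseteq> I"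
      then obtain x y where "xs = [x, y]" by (auto simp: numeral_2_eq_2 length_Suc_conv)
      then show "prodl (dmul H) (ep H) xs = (\<lambda>_. 0)" using xs by (auto simp: dmul_one_right[OF wha] I_def)
    qed simp
    ultimately show ?thesis using ss unfolding dual_semisimple_def semisimple_alg_def by blast
  qed
  moreover have "(\<lambda>_. 0) \<in> L" using L by (simp add: Q_def left_ideal_def lsub_def)
  ultimately have "L = {\<lambda>_. 0}" by blast
  then show False using L by (simp add: Q_def)
qed

text \<open>The matrix coefficients are independent functionals, and a family dual to them consists
  of matrix units.\<close>

lemma matrix_units_exist:
  "\<exists>E. \<forall>a i j b i' j'. i < nd a \<longrightarrow> j < nd a \<longrightarrow> i' < nd b \<longrightarrow> j' < nd b \<longrightarrow>
      \<psi> b (E a i j) $$ (i', j') = (if a = b \<and> i = i' \<and> j = j' then 1 else 0)"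
proof -
  let ?K = "SIGMA a:UNIV. {..<nd a} \<times> {..<nd a}"
  define R where "R k p = \<psi> (fst k) (bas p) $$ snd k" for k p
  have R: "(\<Sum>p\<in>UNIV. R (b, i, j) p * f p) = \<psi> b f $$ (i, j)" if "i < nd b" "j < nd b" for b i j f
    using linD[OF psi_lin[OF wha irr that], of f] by (simp add: R_def mult.commute)
  have "\<exists>E. \<forall>k\<in>?K. \<forall>k'\<in>?K. (\<Sum>p\<in>UNIV. R k p * E k' p) = (if k = k' then 1 else 0)"
  proof (rule dual_family)
    show "finite ?K" by auto
    fix c k assume c: "\<And>p. (\<Sum>k\<in>?K. c k * R k p) = 0" and k: "k \<in> ?K"
    obtain a i j where kk: "k = (a, i, j)" by (cases k)
    have "(\<Sum>a\<in>UNIV. \<Sum>i<nd a. \<Sum>j<nd a. c (a, i, j) * \<psi> a f $$ (i, j)) = 0" for f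
    proof -
      have "(\<Sum>a\<in>UNIV. \<Sum>i<nd a. \<Sum>j<nd a. c (a, i, j) * \<psi> a f $$ (i, j)) =
        (\<Sum>a\<in>UNIV. \<Sum>ij\<in>{..<nd a} \<times> {..<nd a}. c (a, ij) * \<psi> a f $$ ij)"
        by (simp add: sum.cartesian_product split_def)
      also have "\<dots> = (\<Sum>k\<in>?K. c k * \<psi> (fst k) f $$ snd k)"
        by (subst sum.Sigma) (auto intro!: sum.cong)
      also have "\<dots> = (\<Sum>k\<in>?K. c k * (\<Sum>p\<in>UNIV. R k p * f p))"
        by (intro sum.cong refl) (auto simp: R)
      also have "\<dots> = (\<Sum>p\<in>UNIV. (\<Sum>k\<in>?K. c k * R k p) * f p)" by (rule pairing_sum[symmetric])
      finally show ?thesis by (simp add: c)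
    qed
    from coefficients_independent[OF wha irr this, of i a j] show "c k = 0" using k by (simp add: kk)
  qed
  then obtain E where E: "\<And>k k'. k \<in> ?K \<Longrightarrow> k' \<in> ?K \<Longrightarrow> (\<Sum>p\<in>UNIV. R k p * E k' p) = (if k = k' then 1 else 0)" by blast
  have "\<psi> b (E (a, i, j)) $$ (i', j') = (if a = b \<and> i = i' \<and> j = j' then 1 else 0)"
    if "i < nd a" "j < nd a" "i' < nd b" "j' < nd b" for a i j b i' j'
    using E[of "(b, i', j')" "(a, i, j)"] R[OF that(3,4), of "E (a, i, j)"] that by auto
  then show ?thesis by (intro exI[of _ "\<lambda>a i j. E (a, i, j)"]) blast
qed

end

section \<open>Fusion and conjugation data\<close>

lemma sum_mul_lt:
  fixes g :: "nat \<Rightarrow> complex"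
  shows "(\<Sum>t<m * n. g t) = (\<Sum>i<m. \<Sum>j<n. g (i * n + j))"
proof -
  have "(\<Sum>t<m * n. g t) = (\<Sum>i<m. sum g {i * n..<i * n + n})"
    by (simp add: sum.nat_group)
  also have "\<dots> = (\<Sum>i<m. \<Sum>j<n. g (i * n + j))"
  proof (rule sum.cong[OF refl])
    fix i show "sum g {i * n..<i * n + n} = (\<Sum>j<n. g (i * n + j))"
      using sum.shift_bounds_nat_ivl[of g 0 "i * n" n] by (simp add: atLeast0LessThan add.commute)
  qed
  finally show ?thesis .
qed

lemma index_lt: "i < m \<Longrightarrow> j < n \<Longrightarrow> i * n + j < m * (n::nat)"
proof -
  assume "i < m" "j < n"
  then have "i * n + j < Suc i * n" by simp
  also have "\<dots> \<le> m * n" using \<open>i < m\<close> by (intro mult_le_mono1) simp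
  finally show ?thesis .
qed

lemma tens_rep_entry:
  fixes H :: "('i::finite) wha" and nd :: "'r::finite \<Rightarrow> nat"
  assumes irr: "irreps H nd \<psi>" and wha: "weak_hopf_algebra H"
    and "i < nd a" "j < nd a" "i' < nd b" "j' < nd b"
  shows "tens_rep H nd \<psi> a b f $$ (i * nd b + i', j * nd b + j') =
      dsw H f (\<lambda>p q. \<psi> a p $$ (i, j) * \<psi> b q $$ (i', j'))"
  using assms(3-) index_lt[of i "nd a" i' "nd b"] index_lt[of j "nd a" j' "nd b"]
  by (simp add: tens_rep_def swd_def kron_def psi_dim[OF wha irr])

lemma fusion_entry:
  assumes irr: "irreps H nd \<psi>" and wha: "weak_hopf_algebra H" and fus: "fusion H nd \<psi> N V W"
    and "i < nd a" "j < nd a" "i' < nd b" "j' < nd b"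
  shows "dsw H f (\<lambda>p q. \<psi> a p $$ (i, j) * \<psi> b q $$ (i', j')) =
     (\<Sum>c\<in>UNIV. \<Sum>\<mu><N a b c. (V a b c \<mu> * \<psi> c f * W a b c \<mu>) $$ (i * nd b + i', j * nd b + j'))"
proof -
  have "tens_rep H nd \<psi> a b f = mat (nd a * nd b) (nd a * nd b)
          (\<lambda>(r, s). \<Sum>c\<in>UNIV. \<Sum>\<mu><N a b c. (V a b c \<mu> * \<psi> c f * W a b c \<mu>) $$ (r, s))"
    using fus unfolding fusion_def by blast
  then show ?thesis
    using tens_rep_entry[OF irr wha assms(4-), of f] index_lt[of i "nd a" i' "nd b"] index_lt[of j "nd a" j' "nd b"] assms(4-)
    by simp
qed

lemma fusion_vanish:
  assumes irr: "irreps H nd \<psi>" and wha: "weak_hopf_algebra H" and fus: "fusion H nd \<psi> N V W"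
    and z: "\<And>c. N a b c \<noteq> 0 \<Longrightarrow> \<psi> c f = 0\<^sub>m (nd c) (nd c)"
    and ij: "i < nd a" "j < nd a" "i' < nd b" "j' < nd b"
  shows "dsw H f (\<lambda>p q. \<psi> a p $$ (i, j) * \<psi> b q $$ (i', j')) = 0"
  unfolding fusion_entry[OF irr wha fus ij]
proof (intro sum.neutral ballI)
  fix c \<mu> assume \<mu>: "\<mu> \<in> {..<N a b c}"
  then have V: "V a b c \<mu> \<in> carrier_mat (nd a * nd b) (nd c)" and W: "W a b c \<mu> \<in> carrier_mat (nd c) (nd a * nd b)"
    using fus unfolding fusion_def by auto
  have "V a b c \<mu> * \<psi> c f * W a b c \<mu> = 0\<^sub>m (nd a * nd b) (nd a * nd b)"
    using z[of c] \<mu> V W by (auto simp: right_mult_zero_mat[OF V] left_mult_zero_mat[OF W])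
  then show "(V a b c \<mu> * \<psi> c f * W a b c \<mu>) $$ (i * nd b + i', j * nd b + j') = 0"
    using index_lt[OF ij(1,3)] index_lt[OF ij(2,4)] by simp
qed

text \<open>By cyclicity of the trace and W V = 1, each summand V \<psi>_c(f) W has the trace of
  \<psi>_c(f).\<close>

lemma fusion_mtrace:
  assumes irr: "irreps H nd \<psi>" and wha: "weak_hopf_algebra H" and fus: "fusion H nd \<psi> N V W"
  shows "dsw H f (\<lambda>p q. (\<Sum>i<nd a. \<psi> a p $$ (i, i)) * (\<Sum>i<nd b. \<psi> b q $$ (i, i))) =
     (\<Sum>c\<in>UNIV. of_nat (N a b c) * (\<Sum>i<nd c. \<psi> c f $$ (i, i)))"
proof -
  let ?X = "\<lambda>c \<mu>. V a b c \<mu> * \<psi> c f * W a b c \<mu>"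
  have "dsw H f (\<lambda>p q. (\<Sum>i<nd a. \<psi> a p $$ (i, i)) * (\<Sum>i<nd b. \<psi> b q $$ (i, i))) =
     (\<Sum>i<nd a. \<Sum>i'<nd b. dsw H f (\<lambda>p q. \<psi> a p $$ (i, i) * \<psi> b q $$ (i', i')))"
    by (simp add: sum_product swd_sum)
  also have "\<dots> = (\<Sum>i<nd a. \<Sum>i'<nd b. \<Sum>c\<in>UNIV. \<Sum>\<mu><N a b c. ?X c \<mu> $$ (i * nd b + i', i * nd b + i'))"
    by (intro sum.cong refl) (simp add: fusion_entry[OF irr wha fus])
  also have "\<dots> = (\<Sum>c\<in>UNIV. \<Sum>\<mu><N a b c. \<Sum>i<nd a. \<Sum>i'<nd b. ?X c \<mu> $$ (i * nd b + i', i * nd b + i'))"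
    unfolding sum_mul_lt[symmetric, of "\<lambda>t. \<Sum>c\<in>UNIV. \<Sum>\<mu><N a b c. ?X c \<mu> $$ (t, t)"] sum_mul_lt[symmetric, of "\<lambda>t. ?X _ _ $$ (t, t)"]
    by (subst sum.swap, rule sum.cong[OF refl], rule sum.swap)
  also have "\<dots> = (\<Sum>c\<in>UNIV. \<Sum>\<mu><N a b c. \<Sum>i<nd c. \<psi> c f $$ (i, i))"
  proof (rule sum.cong[OF refl], rule sum.cong[OF refl])
    fix c \<mu> assume \<mu>: "\<mu> \<in> {..<N a b c}"
    then have V: "V a b c \<mu> \<in> carrier_mat (nd a * nd b) (nd c)" and W: "W a b c \<mu> \<in> carrier_mat (nd c) (nd a * nd b)"
      and WV: "W a b c \<mu> * V a b c \<mu> = 1\<^sub>m (nd c)"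
      using fus unfolding fusion_def by auto
    have P: "\<psi> c f \<in> carrier_mat (nd c) (nd c)" by (rule psi(1)[OF wha irr])
    have "(\<Sum>i<nd a. \<Sum>i'<nd b. ?X c \<mu> $$ (i * nd b + i', i * nd b + i')) = mtrace (?X c \<mu>)"
      using V by (simp add: mtrace_def sum_mul_lt)
    also have "\<dots> = mtrace (V a b c \<mu> * (\<psi> c f * W a b c \<mu>))" by (subst assoc_mult_mat[OF V P W]) simp
    also have "\<dots> = mtrace (\<psi> c f * W a b c \<mu> * V a b c \<mu>)"
      by (rule mtrace_comm[OF V mult_carrier_mat[OF P W]])
    also have "\<psi> c f * W a b c \<mu> * V a b c \<mu> = \<psi> c f"
      unfolding assoc_mult_mat[OF P W V] WV by (rule right_mult_one_mat[OF P])
    finally show "(\<Sum>i<nd a. \<Sum>i'<nd b. ?X c \<mu> $$ (i * nd b + i', i * nd b + i')) = (\<Sum>i<nd c. \<psi> c f $$ (i, i))"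
      using P by (simp add: mtrace_def)
  qed
  finally show ?thesis by simp
qed

section \<open>Traces of the conjugation data\<close>

lemma minv_props:
  assumes A: "A \<in> carrier_mat n m" and inv: "invertible_mat A"
  shows "n = m" "minv A \<in> carrier_mat n n" "A * minv A = 1\<^sub>m n" "minv A * A = 1\<^sub>m n"
proof -
  show nm: "n = m" using inv A by (simp add: invertible_mat_def)
  obtain B where B: "inverts_mat A B" "inverts_mat B A" using inv unfolding invertible_mat_def by blast
  have 1: "A * B = 1\<^sub>m n" and 2: "B * A = 1\<^sub>m (dim_row B)" using B A by (auto simp: inverts_mat_def)
  have "dim_col B = n" using arg_cong[OF 1, of dim_col] by simp
  moreover have "dim_row B = n" using arg_cong[OF 2, of dim_col] A nm by simp
  ultimately have Bc: "B \<in> carrier_mat n n" by auto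
  have A': "A \<in> carrier_mat n n" using A nm by simp
  have "minv A = B"
    unfolding minv_def
  proof (rule the_equality)
    show "B \<in> carrier_mat (dim_col A) (dim_row A) \<and> A * B = 1\<^sub>m (dim_row A) \<and> B * A = 1\<^sub>m (dim_col A)"
      using A' Bc 1 2 by auto
    fix C assume "C \<in> carrier_mat (dim_col A) (dim_row A) \<and> A * C = 1\<^sub>m (dim_row A) \<and> C * A = 1\<^sub>m (dim_col A)"
    then have C: "C \<in> carrier_mat n n" "C * A = 1\<^sub>m n" using A' by auto
    have "C = C * (A * B)" using C by (simp add: 1)
    also have "\<dots> = C * A * B" by (rule assoc_mult_mat[OF C(1) A' Bc, symmetric])
    finally show "C = B" using C Bc by simp
  qed
  then show "minv A \<in> carrier_mat n n" "A * minv A = 1\<^sub>m n" "minv A * A = 1\<^sub>m n" using Bc 1 2 by auto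
qed

lemma mtrace_transpose: "A \<in> carrier_mat n n \<Longrightarrow> mtrace (transpose_mat A) = mtrace A"
  by (simp add: mtrace_def)

lemma mtrace_smult: "mtrace (c \<cdot>\<^sub>m A) = c * mtrace A" if "A \<in> carrier_mat n n"
  using that by (auto simp: mtrace_def sum_distrib_left intro!: sum.cong)

lemma mtrace_transpose_mult:
  assumes "A \<in> carrier_mat n m" "B \<in> carrier_mat n m"
  shows "mtrace (transpose_mat A * B) = (\<Sum>p<m. \<Sum>q<n. A $$ (q, p) * B $$ (q, p))"
  using assms by (auto simp: mtrace_def scalar_prod_def atLeast0LessThan intro!: sum.cong)

text \<open>Put t = t' in the defining relation of w and sum over t. The left side becomes the
  trace, and W V = 1 reduces the pairing on the right to u(v).\<close>

lemma wdata_trace: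
  assumes wd: "wdata nd cb Z r V W u v w"
    and Z: "Z c \<in> carrier_mat n (nd (cb c))" and n: "n = nd c"
    and Zi: "minv (Z (cb c)) \<in> carrier_mat n (nd (cb c))"
    and V: "V (cb c) c (r c) 0 \<in> carrier_mat (nd (cb c) * nd c) (nd (r c))"
    and W: "W (cb c) c (r c) 0 \<in> carrier_mat (nd (r c)) (nd (cb c) * nd c)"
    and WV: "W (cb c) c (r c) 0 * V (cb c) c (r c) 0 = 1\<^sub>m (nd (r c))"
    and u: "u (r c) \<in> carrier_vec (nd (r c))" and v: "v (r c) \<in> carrier_vec (nd (r c))"
  shows "mtrace (transpose_mat (Z c) * minv (Z (cb c))) = w c * (u (r c) \<bullet> v (r c))"
proof -
  let ?M = "nd (cb c) * nd c"
  let ?uW = "transpose_mat (W (cb c) c (r c) 0) *\<^sub>v u (r c)" and ?Vv = "V (cb c) c (r c) 0 *\<^sub>v v (r c)"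
  have Vv: "?Vv \<in> carrier_vec ?M" by (rule mult_mat_vec_carrier[OF V v])
  have rel: "Z c $$ (t mod nd c, t div nd c) * minv (Z (cb c)) $$ (t' mod nd c, t' div nd c) = w c * (?uW $ t) * (?Vv $ t')"
    if "t < ?M" "t' < ?M" for t t'
    using wd that unfolding wdata_def Let_def by blast
  have "mtrace (transpose_mat (Z c) * minv (Z (cb c))) = (\<Sum>p<nd (cb c). \<Sum>q<n. Z c $$ (q, p) * minv (Z (cb c)) $$ (q, p))"
    by (rule mtrace_transpose_mult[OF Z Zi])
  also have "\<dots> = (\<Sum>t<?M. Z c $$ (t mod nd c, t div nd c) * minv (Z (cb c)) $$ (t mod nd c, t div nd c))"
    unfolding sum_mul_lt n by (intro sum.cong refl) simp
  also have "\<dots> = (\<Sum>t<?M. w c * (?uW $ t * ?Vv $ t))"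
    by (intro sum.cong refl) (simp add: rel)
  also have "\<dots> = w c * (?uW \<bullet> ?Vv)"
    using V by (auto simp: scalar_prod_def sum_distrib_left atLeast0LessThan intro!: sum.cong)
  also have "?uW \<bullet> ?Vv = u (r c) \<bullet> (W (cb c) c (r c) 0 *\<^sub>v ?Vv)"
    by (rule transpose_vec_mult_scalar[OF W Vv u])
  also have "W (cb c) c (r c) 0 *\<^sub>v ?Vv = v (r c)"
    using v by (simp add: assoc_mult_mat_vec[OF W V v, symmetric] WV)
  finally show ?thesis .
qed

text \<open>Translation of the facts about the functional \<Omega> on the dual into structure
  constants of the given algebra, with \<open>Om\<close> the element that represents
  \<Omega>.\<close>

lemma dual_conclusion:
  fixes H :: "('i::finite) wha"
  assumes wha: "weak_hopf_algebra H"
    and lin: "lin \<Omega>" and comm: "\<And>f g. \<Omega> (dmul H f g) = \<Omega> (dmul H g f)"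
    and idem: "\<And>f. dsw H f (\<lambda>x y. \<Omega> x * \<Omega> y) = \<Omega> f"
    and shift: "\<And>G f g. lin G \<Longrightarrow> dsw H g (\<lambda>a b. G a * \<Omega> (dmul H f b)) =
       dsw H f (\<lambda>a b. G (dmul H (dant H a) k) * \<Omega> (dmul H b g))"
    and inv: "\<And>f. \<Omega> (dant H f) = \<Omega> f"
    and nondeg: "\<And>f. (\<And>g. \<Omega> (dmul H f g) = 0) \<Longrightarrow> f = (\<lambda>_. 0)"
    and ki: "dmul H k (dinv H k) = ep H"
    and S_m: "\<And>f g. dant H (dmul H f g) = dmul H (dant H g) (dant H f)"
    and Om: "Om = (\<lambda>i. \<Omega> (bas i))"
  shows "nondegenerate H Om \<and> cocommutative H Om \<and> mul H Om Om = Om \<and>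
    (\<exists>T. clinear T \<and>
       (\<forall>x. mul2 H (tn (un H) x) (cop H Om) = mul2 H (tn (T x) (un H)) (cop H Om)) \<and>
       (\<forall>x. cop H (T x) =
            (\<lambda>(p, q). \<Sum>i\<in>UNIV. \<Sum>j\<in>UNIV. \<Sum>h\<in>UNIV.
               cop2 H x (i, j, h) * dinv H k j * T (bas h) p * T (bas i) q)) \<and>
       (\<lambda>q. \<Sum>i\<in>UNIV. \<Sum>j\<in>UNIV. cop H Om (i, j) * T (bas i) q * dinv H k j) = ant H Om \<and>
       ant H Om = Om)"
proof -
  let ?m = "dmul H" and ?sw = "dsw H" and ?S = "dant H"
  note dl = dlins[OF wha] lin_comp[OF lin]
  have pairO: "(\<Sum>i\<in>UNIV. Om i * f i) = \<Omega> f" for f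
    unfolding Om using linD[OF lin, of f] by (simp add: mult.commute)
  have cop_pair: "cop H x (p, q) = (\<Sum>i\<in>UNIV. x i * ?m (bas p) (bas q) i)" for x p q
    by (simp add: cop_def dmul_bas[OF wha])
  have copO: "cop H Om (p, q) = \<Omega> (?m (bas p) (bas q))" for p q
    unfolding cop_pair pairO ..
  have coco: "cocommutative H Om"
    unfolding cocommutative_def by (auto simp: copO comm[of "bas _" "bas _"])
  have nond: "nondegenerate H Om"
  proof -
    \<comment> \<open>The Gram matrix of the form (f, g) -> \<Omega>(f g). Faithfulness makes its
      rows independent, so a dual family inverts it.\<close>
    define R where "R p q = \<Omega> (?m (bas p) (bas q))" for p q
    have Rs: "R p q = R q p" for p q unfolding R_def by (rule comm)
    have "\<exists>E. \<forall>k\<in>UNIV. \<forall>k'\<in>UNIV. (\<Sum>p\<in>UNIV. R k p * E k' p) = (if k = k' then 1 else 0)"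
    proof (rule dual_family)
      fix c k assume c: "\<And>p. (\<Sum>k\<in>UNIV. c k * R k p) = 0"
      have "\<Omega> (?m c g) = 0" for g
      proof (rule lin_ext[of "\<lambda>g. \<Omega> (?m c g)" "\<lambda>_. 0"])
        fix p
        have "lin (\<lambda>f. \<Omega> (?m f (bas p)))" by (intro dl)
        from linD[OF this, of c] show "\<Omega> (?m c (bas p)) = 0" using c[of p] by (simp add: R_def)
      qed (intro dl lin_const0)+
      then have "c = (\<lambda>_. 0)" by (rule nondeg)
      then show "c k = 0" by simp
    qed simp
    then obtain E where E: "\<And>k k'. (\<Sum>p\<in>UNIV. R k p * E k' p) = (if k = k' then 1 else 0)" by blast
    have sol: "(\<Sum>p\<in>UNIV. (\<Sum>k\<in>UNIV. y k * E k p) * R p q) = y q" for y q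
    proof -
      have "(\<Sum>p\<in>UNIV. (\<Sum>k\<in>UNIV. y k * E k p) * R p q) = (\<Sum>k\<in>UNIV. y k * (\<Sum>p\<in>UNIV. E k p * R p q))"
        by (rule pairing_sum)
      also have "\<dots> = (\<Sum>k\<in>UNIV. y k * (\<Sum>p\<in>UNIV. R q p * E k p))"
        by (simp add: Rs[of _ q] mult.commute)
      finally show ?thesis by (simp add: E if_distrib[of "\<lambda>z. _ * z"] cong: if_cong)
    qed
    have "range (\<lambda>f. (\<lambda>b. \<Sum>a\<in>UNIV. f a * cop H Om (a, b))) = UNIV"
    proof (intro equalityI subsetI UNIV_I)
      fix y show "y \<in> range (\<lambda>f. (\<lambda>b. \<Sum>a\<in>UNIV. f a * cop H Om (a, b)))"
        by (rule range_eqI[of _ _ "\<lambda>p. \<Sum>k\<in>UNIV. y k * E k p"]) (simp add: copO sol flip: R_def)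
    qed
    moreover have e: "(\<lambda>f. (\<lambda>a. \<Sum>b\<in>UNIV. cop H Om (a, b) * f b)) = (\<lambda>f. (\<lambda>b. \<Sum>a\<in>UNIV. f a * cop H Om (a, b)))"
      by (intro ext) (simp add: copO comm[of "bas _" "bas _"] mult.commute)
    ultimately show ?thesis unfolding nondegenerate_def e by blast
  qed
  have mulO: "mul H Om Om = Om"
  proof
    fix k
    have "mul H Om Om k = ?sw (bas k) (\<lambda>x y. \<Omega> x * \<Omega> y)"
      unfolding mul_def dsw_bas[OF wha] Om by (simp add: mult_ac)
    then show "mul H Om Om k = Om k" by (simp add: idem Om)
  qed
  define X where "X x f = (\<Sum>j\<in>UNIV. x j * f j)" for x f :: "'i \<Rightarrow> complex"
  have Xl: "lin (X x)" for x unfolding X_def by (intro lin_setsum lin_mult_left lin_coord)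
  have Xb: "X x (bas j) = x j" for x j by (simp add: X_def)
  \<comment> \<open>With x read as the functional \<open>X x\<close> on the dual, T is the transpose
    of f -> S(f) k; \<open>shift\<close> with G = \<open>X x\<close> is then the pulling-through
    identity.\<close>
  define T where "T x = (\<lambda>i. X x (?m (?S (bas i)) k))" for x
  have "clinear T" unfolding clinear_def T_def X_def
    by (simp add: distrib_right sum.distrib sum_distrib_left mult.assoc)
  moreover have "mul2 H (tn (un H) x) (cop H Om) = mul2 H (tn (T x) (un H)) (cop H Om)" for x
  proof
    fix pq :: "'i \<times> 'i"
    obtain p q where pq: "pq = (p, q)" by (cases pq)
    have "mul2 H (tn (un H) x) (cop H Om) (p, q) =
      (\<Sum>i\<in>UNIV. \<Sum>j\<in>UNIV. \<Sum>i'\<in>UNIV. \<Sum>j'\<in>UNIV. un H i * mu H i i' p * (x j * mu H j j' q * cop H Om (i', j')))"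
      by (simp add: mul2_def tn_def mult_ac)
    also have "\<dots> = (\<Sum>j\<in>UNIV. \<Sum>j'\<in>UNIV. \<Sum>i'\<in>UNIV. \<Sum>i\<in>UNIV. un H i * mu H i i' p * (x j * mu H j j' q * cop H Om (i', j')))"
      by (rule sum4_perm)
    also have "\<dots> = (\<Sum>j\<in>UNIV. \<Sum>j'\<in>UNIV. mu H j j' q * (x j * \<Omega> (?m (bas p) (bas j'))))"
      by (simp only: sum_distrib_right[symmetric] mu_one_left[OF wha] sum_bas' copO) (simp add: mult_ac)
    also have "\<dots> = ?sw (bas q) (\<lambda>a b. X x a * \<Omega> (?m (bas p) b))"
      by (simp add: dsw_bas[OF wha] Xb)
    also have "\<dots> = ?sw (bas p) (\<lambda>a b. X x (?m (?S a) k) * \<Omega> (?m b (bas q)))"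
      by (rule shift[OF Xl])
    also have "\<dots> = (\<Sum>i\<in>UNIV. \<Sum>i'\<in>UNIV. mu H i i' p * (T x i * \<Omega> (?m (bas i') (bas q))))"
      by (simp add: dsw_bas[OF wha] T_def)
    also have "\<dots> = (\<Sum>i\<in>UNIV. \<Sum>i'\<in>UNIV. \<Sum>j'\<in>UNIV. (\<Sum>j\<in>UNIV. un H j * mu H j j' q) * (mu H i i' p * (T x i * cop H Om (i', j'))))"
      by (simp only: mu_one_left[OF wha] sum_bas' copO)
    also have "\<dots> = (\<Sum>i\<in>UNIV. \<Sum>j\<in>UNIV. \<Sum>i'\<in>UNIV. \<Sum>j'\<in>UNIV. un H j * mu H j j' q * (mu H i i' p * (T x i * cop H Om (i', j'))))"
      unfolding sum_distrib_right by (rule sum.cong[OF refl], rule sum3_front)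
    also have "\<dots> = mul2 H (tn (T x) (un H)) (cop H Om) (p, q)"
      by (simp add: mul2_def tn_def mult_ac)
    finally show "mul2 H (tn (un H) x) (cop H Om) pq = mul2 H (tn (T x) (un H)) (cop H Om) pq" by (simp add: pq)
  qed
  moreover have "cop H (T x) = (\<lambda>(p, q). \<Sum>i\<in>UNIV. \<Sum>j\<in>UNIV. \<Sum>h\<in>UNIV.
               cop2 H x (i, j, h) * dinv H k j * T (bas h) p * T (bas i) q)" for x
  proof
    fix pq :: "'i \<times> 'i"
    obtain p q where pq: "pq = (p, q)" by (cases pq)
    have Tb: "T (bas h) p = ?m (?S (bas p)) k h" for h p by (simp add: T_def X_def)
    have "lin (\<lambda>f. X x (?m (?S f) k))" by (intro dl lin_comp[OF Xl])
    from linD[OF this, of "?m (bas p) (bas q)"]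
    have "cop H (T x) (p, q) = X x (?m (?S (?m (bas p) (bas q))) k)"
      by (simp add: cop_pair T_def mult.commute)
    \<comment> \<open>S(f g) k = (S(g) k) k^-1 (S(f) k). Reversal of the product by S explains the
      exchanged outer legs, and the inserted k^-1 is the middle factor.\<close>
    also have "\<dots> = X x (?m (?m (?m (?S (bas q)) k) (dinv H k)) (?m (?S (bas p)) k))"
      by (simp add: S_m dmul_assoc[OF wha] ki dmul_one_right[OF wha])
    also have "\<dots> = (\<Sum>i\<in>UNIV. \<Sum>j\<in>UNIV. \<Sum>h\<in>UNIV. X x (?m (?m (bas i) (bas j)) (bas h)) *
        (?m (?S (bas q)) k i * (dinv H k j * ?m (?S (bas p)) k h)))"
      by (rule trilin_coords[of "\<lambda>a b c. X x (?m (?m a b) c)"]) (intro dl lin_comp[OF Xl])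
    also have "\<dots> = (\<Sum>i\<in>UNIV. \<Sum>j\<in>UNIV. \<Sum>h\<in>UNIV. cop2 H x (i, j, h) * dinv H k j * T (bas h) p * T (bas i) q)"
    proof -
      have "X x (?m (?m (bas i) (bas j)) (bas h)) = cop2 H x (i, j, h)" for i j h
      proof -
        have "X x (?m (?m (bas i) (bas j)) (bas h)) = (\<Sum>t\<in>UNIV. \<Sum>s\<in>UNIV. x t * de H t s h * de H s i j)"
          unfolding X_def dmul_right_bas[OF wha, of _ h] dmul_bas[OF wha] by (simp add: sum_distrib_left mult.assoc)
        also have "\<dots> = cop2 H x (i, j, h)"
          by (subst sum.swap) (simp add: cop2_def cop_l_def cop_def sum_distrib_right)
        finally show ?thesis .
      qed
      then show ?thesis by (simp add: Tb mult_ac)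
    qed
    finally show "cop H (T x) pq = (case pq of (p, q) \<Rightarrow> \<Sum>i\<in>UNIV. \<Sum>j\<in>UNIV. \<Sum>h\<in>UNIV.
               cop2 H x (i, j, h) * dinv H k j * T (bas h) p * T (bas i) q)" by (simp add: pq)
  qed
  moreover have antO: "ant H Om q = \<Omega> (?S (bas q))" for q
    unfolding pairO[symmetric] by (simp add: ant_def dant_bas[OF wha])
  moreover have "(\<lambda>q. \<Sum>i\<in>UNIV. \<Sum>j\<in>UNIV. cop H Om (i, j) * T (bas i) q * dinv H k j) = ant H Om"
  proof
    fix q
    have Tb: "T (bas h) p = ?m (?S (bas p)) k h" for h p by (simp add: T_def X_def)
    have "(\<Sum>i\<in>UNIV. \<Sum>j\<in>UNIV. cop H Om (i, j) * T (bas i) q * dinv H k j) =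
       (\<Sum>i\<in>UNIV. \<Sum>j\<in>UNIV. \<Omega> (?m (bas i) (bas j)) * (?m (?S (bas q)) k i * dinv H k j))"
      by (simp add: copO Tb mult.assoc)
    \<comment> \<open>Contracting the coproduct of \<open>Om\<close> with these two functionals
      reassembles a product in the dual, in which k then cancels.\<close>
    also have "\<dots> = \<Omega> (?m (?m (?S (bas q)) k) (dinv H k))"
      by (rule bilin_coords[symmetric]) (intro dl)
    also have "\<dots> = ant H Om q" by (simp add: dmul_assoc[OF wha] ki dmul_one_right[OF wha] antO)
    finally show "(\<Sum>i\<in>UNIV. \<Sum>j\<in>UNIV. cop H Om (i, j) * T (bas i) q * dinv H k j) = ant H Om q" .
  qed
  moreover have "ant H Om = Om"
    by (rule ext) (simp add: antO inv, simp add: Om)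
  ultimately show ?thesis using nond coco mulO by blast
qed

section \<open>The hypotheses of the theorem in the abstract setting\<close>

lemma dmul2_tn_left:
  "dmul2 H (tn x y) (dcop H g) (i, j) = dsw H g (\<lambda>a b. dmul H x a i * dmul H y b j)"
  if wha: "weak_hopf_algebra H" for H :: "('i::finite) wha"
proof -
  have "dmul2 H (tn x y) (dcop H g) (i, j) =
      (\<Sum>a\<in>UNIV. \<Sum>b\<in>UNIV. \<Sum>c\<in>UNIV. \<Sum>d\<in>UNIV. de H i a b * de H j c d * (x a * y c) * dcop H g (b, d))"
    by (simp add: dmul2_def tn_def)
  also have "\<dots> = (\<Sum>b\<in>UNIV. \<Sum>d\<in>UNIV. \<Sum>c\<in>UNIV. \<Sum>a\<in>UNIV. de H i a b * de H j c d * (x a * y c) * dcop H g (b, d))"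
    by (rule sum4_perm)
  also have "\<dots> = (\<Sum>b\<in>UNIV. \<Sum>d\<in>UNIV. \<Sum>a\<in>UNIV. \<Sum>c\<in>UNIV. de H i a b * de H j c d * (x a * y c) * dcop H g (b, d))"
    by (rule sum.cong[OF refl], rule sum.cong[OF refl], rule sum.swap)
  also have "\<dots> = dsw H g (\<lambda>a b. dmul H x a i * dmul H y b j)"
    unfolding swd_def dmul_right_bas[OF wha] sum_product
    by (simp add: sum_distrib_left mult_ac)
  finally show ?thesis .
qed

lemma dmul2_tn_right:
  "dmul2 H (dcop H g) (tn x y) (i, j) = dsw H g (\<lambda>a b. dmul H a x i * dmul H b y j)"
  if wha: "weak_hopf_algebra H" for H :: "('i::finite) wha"
proof -
  have "dmul2 H (dcop H g) (tn x y) (i, j) =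
      (\<Sum>a\<in>UNIV. \<Sum>b\<in>UNIV. \<Sum>c\<in>UNIV. \<Sum>d\<in>UNIV. de H i a b * de H j c d * dcop H g (a, c) * (x b * y d))"
    by (simp add: dmul2_def tn_def)
  also have "\<dots> = (\<Sum>a\<in>UNIV. \<Sum>c\<in>UNIV. \<Sum>b\<in>UNIV. \<Sum>d\<in>UNIV. de H i a b * de H j c d * dcop H g (a, c) * (x b * y d))"
    by (rule sum.cong[OF refl], rule sum.swap)
  also have "\<dots> = dsw H g (\<lambda>a b. dmul H a x i * dmul H b y j)"
    unfolding swd_def dmul_left_bas[OF wha] sum_product
    by (simp add: sum_distrib_left mult_ac)
  finally show ?thesis .
qed

text \<open>Group-likeness is stated in coordinates; bilinearity extends it to arbitrary K, the form
  in which \<open>pivotal_weak_hopf\<close> uses it.\<close>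

lemma dsw_transfer:
  assumes wha: "weak_hopf_algebra H"
    and D: "\<And>i j. dcop H x (i, j) = dsw H y (\<lambda>a b. A a i * B b j)" and K: "bilin K"
  shows "dsw H x K = dsw H y (\<lambda>a b. K (A a) (B b))"
proof -
  have "dsw H x K = (\<Sum>i\<in>UNIV. \<Sum>j\<in>UNIV. K (bas i) (bas j) * dsw H y (\<lambda>a b. A a i * B b j))"
    unfolding D[symmetric] by (simp add: swd_def mult.commute)
  also have "\<dots> = dsw H y (\<lambda>a b. K (A a) (B b))"
    unfolding swd_mult_left[symmetric] swd_sum[symmetric]
    by (intro swd_cong bilin_coords[OF K, symmetric])
  finally show ?thesis .
qed

lemma dinv_props:
  assumes wha: "weak_hopf_algebra H" and inv: "dinvertible H k"
  shows "dmul H k (dinv H k) = ep H" "dmul H (dinv H k) k = ep H"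
proof -
  obtain h where h: "dmul H k h = ep H" "dmul H h k = ep H" using inv by (auto simp: dinvertible_def)
  have "dinv H k = h" unfolding dinv_def
  proof (rule the_equality)
    fix h' assume h': "dmul H k h' = ep H \<and> dmul H h' k = ep H"
    have "h' = dmul H h' (dmul H k h)" by (simp add: h dmul_one_right[OF wha])
    also have "\<dots> = dmul H (dmul H h' k) h" by (rule dmul_assoc[OF wha, symmetric])
    finally show "h' = h" using h' by (simp add: dmul_one_left[OF wha])
  qed (use h in simp)
  then show "dmul H k (dinv H k) = ep H" "dmul H (dinv H k) k = ep H" using h by auto
qed

lemma counit_coefficients:
  assumes wha: "weak_hopf_algebra H" and irr: "irreps H nd \<psi>" and vac: "vacuum H nd \<psi> b" and uv: "vac_vectors nd b u v"
  shows "ev f (un H) = (\<Sum>e\<in>vacE nd b. \<Sum>i<nd e. \<Sum>j<nd e. u e $ i * \<psi> e f $$ (i, j) * v e $ j)"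
proof -
  have "ev f (un H) = (\<Sum>a\<in>UNIV. mtrace (b a * \<psi> a f))" using vac unfolding vacuum_def by blast
  also have "\<dots> = (\<Sum>a\<in>vacE nd b. mtrace (b a * \<psi> a f))"
  proof (rule sum.mono_neutral_right)
    show "\<forall>i\<in>UNIV - vacE nd b. mtrace (b i * \<psi> i f) = 0"
      by (auto simp: vacE_def left_mult_zero_mat[OF psi(1)[OF wha irr]] mtrace_def)
  qed auto
  also have "\<dots> = (\<Sum>e\<in>vacE nd b. \<Sum>i<nd e. \<Sum>j<nd e. u e $ i * \<psi> e f $$ (i, j) * v e $ j)"
  proof (rule sum.cong[OF refl])
    fix e assume "e \<in> vacE nd b"
    then have e: "v e \<in> carrier_vec (nd e)" "u e \<in> carrier_vec (nd e)" "b e = outer (v e) (u e)"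
      using uv by (auto simp: vac_vectors_def)
    have "mtrace (b e * \<psi> e f) = (\<Sum>j<nd e. \<Sum>i<nd e. u e $ i * \<psi> e f $$ (i, j) * v e $ j)"
      unfolding e(3) using e(1,2) psi(1)[OF wha irr, of e f]
      by (auto simp: mtrace_def outer_def scalar_prod_def atLeast0LessThan mult_ac intro!: sum.cong)
    then show "mtrace (b e * \<psi> e f) = (\<Sum>i<nd e. \<Sum>j<nd e. u e $ i * \<psi> e f $$ (i, j) * v e $ j)"
      by (subst sum.swap)
  qed
  finally show ?thesis .
qed

lemma triple_product_entry:
  fixes A B C :: "complex mat"
  assumes "A \<in> carrier_mat n m" "B \<in> carrier_mat m m'" "C \<in> carrier_mat m' n'" "i < n" "j < n'"
  shows "(A * B * C) $$ (i, j) = (\<Sum>s<m. \<Sum>t<m'. A $$ (i, s) * C $$ (t, j) * B $$ (s, t))"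
proof -
  have "(A * B * C) $$ (i, j) = (\<Sum>s<m. A $$ (i, s) * (\<Sum>t<m'. B $$ (s, t) * C $$ (t, j)))"
    using assms by (auto simp: scalar_prod_def atLeast0LessThan intro!: sum.cong)
  then show ?thesis by (simp add: sum_distrib_left mult_ac)
qed

theorem theorem5p15:
  fixes H :: "('i::finite) wha"
    and nd :: "('r::finite) \<Rightarrow> nat"
    and \<psi> :: "'r \<Rightarrow> ('i \<Rightarrow> complex) \<Rightarrow> complex mat"
    and N :: "'r \<Rightarrow> 'r \<Rightarrow> 'r \<Rightarrow> nat"
    and V W :: "'r \<Rightarrow> 'r \<Rightarrow> 'r \<Rightarrow> nat \<Rightarrow> complex mat"
    and b :: "'r \<Rightarrow> complex mat"
    and u v :: "'r \<Rightarrow> complex vec"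
    and l r cb :: "'r \<Rightarrow> 'r"
    and Z :: "'r \<Rightarrow> complex mat"
    and w d \<xi> :: "'r \<Rightarrow> complex"
    and g k :: "'i \<Rightarrow> complex"
  assumes wha: "weak_hopf_algebra H"
    and ss: "dual_semisimple H"
    and irr: "irreps H nd \<psi>"
    and fus: "fusion H nd \<psi> N V W"
    and vac: "vacuum H nd \<psi> b"
    and uv: "vac_vectors nd b u v"
    and lr: "left_right nd b N l r"
    and conj: "conjugation H nd \<psi> cb Z"
    and wd: "wdata nd cb Z r V W u v w"
    and dd: "ddata cb w d"
    and gd: "gdata \<psi> cb Z w d g"
    and sph: "spherical_element H nd \<psi> b u v l r k"
    and xi: "\<forall>a. \<psi> a k = \<xi> a \<cdot>\<^sub>m \<psi> a g"
  shows "nondegenerate H (Omega_el \<psi> l d \<xi>) \<and> cocommutative H (Omega_el \<psi> l d \<xi>) \<and>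
    mul H (Omega_el \<psi> l d \<xi>) (Omega_el \<psi> l d \<xi>) = Omega_el \<psi> l d \<xi> \<and>
    (\<exists>T. clinear T \<and>
       (\<forall>x. mul2 H (tn (un H) x) (cop H (Omega_el \<psi> l d \<xi>)) =
            mul2 H (tn (T x) (un H)) (cop H (Omega_el \<psi> l d \<xi>))) \<and>
       (\<forall>x. cop H (T x) =
            (\<lambda>(p, q). \<Sum>i\<in>UNIV. \<Sum>j\<in>UNIV. \<Sum>h\<in>UNIV.
               cop2 H x (i, j, h) * dinv H k j * T (bas h) p * T (bas i) q)) \<and>
       (\<lambda>q. \<Sum>i\<in>UNIV. \<Sum>j\<in>UNIV. cop H (Omega_el \<psi> l d \<xi>) (i, j) * T (bas i) q * dinv H k j)
          = ant H (Omega_el \<psi> l d \<xi>) \<and>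
       ant H (Omega_el \<psi> l d \<xi>) = Omega_el \<psi> l d \<xi>)"
proof -
  note psi = psi[OF wha irr]
  note [simp] = psi_dim[OF wha irr]
  have n_pos: "nd a > 0" for a using psi_irr[OF wha irr, of a] by (simp add: irreducible_rep_def)
  \<comment> \<open>Matrix entries outside the index range are junk and need not depend linearly on the matrix.\<close>
  define \<rho> where "\<rho> a i j f = (if i < nd a \<and> j < nd a then \<psi> a f $$ (i, j) else 0)" for a i j f
  have rho: "i < nd a \<Longrightarrow> j < nd a \<Longrightarrow> \<rho> a i j f = \<psi> a f $$ (i, j)" for a i j f by (simp add: \<rho>_def)
  have rho_lin: "lin (\<rho> a i j)" for a i j
  proof (cases "i < nd a \<and> j < nd a")
    case True then show ?thesis using psi_lin[OF wha irr, of i a j] by (simp add: \<rho>_def[abs_def])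
  next
    case False
    then have "\<rho> a i j = (\<lambda>_. 0)" by (intro ext) (simp only: \<rho>_def if_False)
    then show ?thesis by (simp add: lin_const0)
  qed
  obtain E where E: "\<And>a i j b i' j'. i < nd a \<Longrightarrow> j < nd a \<Longrightarrow> i' < nd b \<Longrightarrow> j' < nd b \<Longrightarrow>
      \<psi> b (E a i j) $$ (i', j') = (if a = b \<and> i = i' \<and> j = j' then 1 else 0)"
    using matrix_units_exist[OF wha ss irr] by metis
  have rtr: "(\<Sum>i<nd a. \<rho> a i i f) = mtrace (\<psi> a f)" for a f by (simp add: mtrace_def rho)
  interpret B: block_weak_hopf "dmul H" "ep H" "dcop H" "dcu H" "dant H" "dsw H" nd \<rho> E N "vacE nd b"
    "\<lambda>e i. u e $ i" "\<lambda>e i. v e $ i" l r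
  proof (intro block_weak_hopf.intro weak_hopf_dual[OF wha], unfold_locales)
    show "nd a > 0" for a by (rule n_pos)
    show "lin (\<rho> a i j)" for a i j by (rule rho_lin)
    show "\<rho> a i j (dmul H f g) = (\<Sum>h<nd a. \<rho> a i h f * \<rho> a h j g)" if "i < nd a" "j < nd a" for i j a f g
      using that by (simp add: rho psi(4) scalar_prod_def atLeast0LessThan)
    show "\<rho> a i j (ep H) = (if i = j then 1 else 0)" if "i < nd a" "j < nd a" for i j a
      using that by (simp add: rho psi(5))
    show "\<rho> b i' j' (E a i j) = (if a = b \<and> i = i' \<and> j = j' then 1 else 0)"
      if "i < nd a" "j < nd a" "i' < nd b" "j' < nd b" for i a j i' b j'
      using that by (simp add: rho E)
    show "f = g" if eq: "\<And>a i j. i < nd a \<Longrightarrow> j < nd a \<Longrightarrow> \<rho> a i j f = \<rho> a i j g" for f g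
    proof -
      have "\<psi> a (\<lambda>i. f i + (-1) * g i) = 0\<^sub>m (nd a) (nd a)" for a
        unfolding psi(2)[of a f "\<lambda>i. (-1) * g i"] psi(3) using eq[of _ a] by (auto simp: rho intro!: eq_matI)
      then have "(\<lambda>i. f i + (-1) * g i) = (\<lambda>_. 0)" by (rule psi_jointly_injective[OF wha ss irr])
      then show ?thesis by (auto simp: fun_eq_iff)
    qed
    show "ev f (un H) = (\<Sum>e\<in>vacE nd b. \<Sum>i<nd e. \<Sum>j<nd e. u e $ i * \<rho> e i j f * v e $ j)" for f
      unfolding counit_coefficients[OF wha irr vac uv] by (simp add: rho)
    show "dsw H f (\<lambda>p q. \<rho> a i j p * \<rho> b i' j' q) = 0"
      if z: "\<And>c i j. N a b c \<noteq> 0 \<Longrightarrow> i < nd c \<Longrightarrow> j < nd c \<Longrightarrow> \<rho> c i j f = 0"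
        and ij: "i < nd a" "j < nd a" "i' < nd b" "j' < nd b" for a b f i j i' j'
    proof -
      have "\<psi> c f = 0\<^sub>m (nd c) (nd c)" if "N a b c \<noteq> 0" for c
        by (rule eq_matI) (use z[OF that] in \<open>auto simp: rho\<close>)
      from fusion_vanish[OF irr wha fus this ij] show ?thesis using ij by (simp add: rho)
    qed
    show "dsw H f (\<lambda>p q. (\<Sum>i<nd a. \<rho> a i i p) * (\<Sum>i<nd b. \<rho> b i i q)) =
        (\<Sum>c\<in>UNIV. of_nat (N a b c) * (\<Sum>i<nd c. \<rho> c i i f))" for f a b
      using fusion_mtrace[OF irr wha fus, of f a b] by (simp add: rho)
    show "l a \<in> vacE nd b" "r a \<in> vacE nd b" for a using lr by (auto simp: left_right_def)
    show "N e a c = (if e = l a \<and> a = c then 1 else 0)" if "e \<in> vacE nd b" for e a c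
      using lr that unfolding left_right_def by blast
    show "N a e c = (if e = r a \<and> a = c then 1 else 0)" if "e \<in> vacE nd b" for e a c
      using lr that unfolding left_right_def by blast
  qed
  have tr: "B.tr a f = mtrace (\<psi> a f)" for a f by (simp add: B.tr_def rtr)
  have piv: "pivotal H k" using sph by (simp add: spherical_element_def)
  have dk: "dmul H k (dinv H k) = ep H" "dmul H (dinv H k) k = ep H"
    using dinv_props[OF wha] piv by (auto simp: pivotal_def)
  have gl: "dcop H k = dmul2 H (tn k k) (dcop H (ep H))" "dcop H k = dmul2 H (dcop H (ep H)) (tn k k)"
    using piv by (auto simp: pivotal_def group_like_def)
  interpret P: pivotal_weak_hopf "dmul H" "ep H" "dcop H" "dcu H" "dant H" "dsw H" k "dinv H k"
  proof unfold_locales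
    show "dmul H k (dinv H k) = ep H" "dmul H (dinv H k) k = ep H" by (fact dk)+
    show "dsw H k K = dsw H (ep H) (\<lambda>a b. K (dmul H k a) (dmul H k b))" if "bilin K" for K
      by (rule dsw_transfer[OF wha _ that]) (unfold gl(1) dmul2_tn_left[OF wha], rule refl)
    show "dsw H k K = dsw H (ep H) (\<lambda>a b. K (dmul H a k) (dmul H b k))" if "bilin K" for K
      by (rule dsw_transfer[OF wha _ that]) (unfold gl(2) dmul2_tn_right[OF wha], rule refl)
    show "dant H (dant H f) = dmul H (dmul H k f) (dinv H k)" for f using piv by (simp add: pivotal_def)
  qed
  have Zc: "Z a \<in> carrier_mat (nd a) (nd (cb a))" and Zinv: "invertible_mat (Z a)"
    and Zconj: "transpose_mat (\<psi> a (dant H f)) = Z a * \<psi> (cb a) f * minv (Z a)" for a f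
    using conj by (auto simp: conjugation_def)
  have nd_cb: "nd (cb a) = nd a" for a using minv_props(1)[OF Zc Zinv, of a] by simp
  have Z: "Z a \<in> carrier_mat (nd a) (nd a)" for a using Zc[of a] by (simp add: nd_cb)
  have Zi: "minv (Z a) \<in> carrier_mat (nd a) (nd a)" "Z a * minv (Z a) = 1\<^sub>m (nd a)" "minv (Z a) * Z a = 1\<^sub>m (nd a)" for a
    using minv_props[OF Zc Zinv, of a] by auto
  have psi_cb: "\<psi> (cb a) f \<in> carrier_mat (nd a) (nd a)" for a f using psi(1)[of "cb a" f] by (simp add: nd_cb)
  have tr_cb: "B.tr (cb a) f = B.tr a (dant H f)" for a f
  proof -
    have "mtrace (\<psi> a (dant H f)) = mtrace (transpose_mat (\<psi> a (dant H f)))"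
      by (rule mtrace_transpose[symmetric, OF psi(1)])
    also have "\<dots> = mtrace (Z a * (\<psi> (cb a) f * minv (Z a)))"
      unfolding Zconj by (subst assoc_mult_mat[OF Z psi_cb Zi(1)]) simp
    also have "\<dots> = mtrace (\<psi> (cb a) f * minv (Z a) * Z a)"
      by (rule mtrace_comm[OF Z mult_carrier_mat[OF psi_cb Zi(1)]])
    also have "\<psi> (cb a) f * minv (Z a) * Z a = \<psi> (cb a) f"
      unfolding assoc_mult_mat[OF psi_cb Zi(1) Z] Zi(3) by (rule right_mult_one_mat[OF psi_cb])
    finally show ?thesis by (simp add: tr)
  qed
  \<comment> \<open>The character of the double conjugate of a is f -> Tr \<psi>_a(S^2 f), and S^2
    is conjugation by k, so it equals that of a; block projectors separate the characters.\<close>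
  have cb_cb: "cb (cb a) = a" for a
  proof -
    have "B.tr (cb (cb a)) (B.blk a) = B.tr a (B.blk a)"
      unfolding tr_cb P.S_S by (subst B.tr_commute) (simp add: B.m_assoc[symmetric] P.ki_inv B.one_left)
    then show ?thesis using n_pos[of a] by (simp add: B.scalar_on_tr[OF B.scalar_blk] split: if_splits)
  qed
  have l_cb: "l (cb a) = r a" and r_cb: "r (cb a) = l a" for a
    using B.l_conj[OF tr_cb, of a] B.l_conj[OF tr_cb, of "cb a"] by (simp_all add: cb_cb)
  \<comment> \<open>The multiplicity index 0 in \<open>wdata\<close> is meaningful only if this
    multiplicity is positive; only then does \<open>fusion\<close> constrain the matrices V and W
    used there.\<close>
  have Npos: "N (cb c) c (r c) \<noteq> 0" for c
  proof (rule B.fusion_conj_pos)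
    fix i j f assume ij: "i < nd c" "j < nd c"
    have "\<rho> c i j (dant H f) = transpose_mat (\<psi> c (dant H f)) $$ (j, i)" using ij by (simp add: rho)
    also have "\<dots> = (\<Sum>s<nd c. \<Sum>t<nd c. Z c $$ (j, s) * minv (Z c) $$ (t, i) * \<psi> (cb c) f $$ (s, t))"
      unfolding Zconj by (rule triple_product_entry[OF Z psi_cb Zi(1) ij(2,1)])
    finally show "\<rho> c i j (dant H f) = (\<Sum>s<nd (cb c). \<Sum>t<nd (cb c). Z c $$ (j, s) * minv (Z c) $$ (t, i) * \<rho> (cb c) s t f)"
      by (simp add: rho nd_cb)
  qed
  have uvc: "u e \<in> carrier_vec (nd e)" "v e \<in> carrier_vec (nd e)" if "e \<in> vacE nd b" for e
    using uv that by (auto simp: vac_vectors_def)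
  have wtr: "mtrace (transpose_mat (Z c) * minv (Z (cb c))) = w c * (u (r c) \<bullet> v (r c))" for c
  proof (rule wdata_trace[OF wd Zc])
    have "0 < N (cb c) c (r c)" using Npos[of c] by simp
    then show "V (cb c) c (r c) 0 \<in> carrier_mat (nd (cb c) * nd c) (nd (r c))"
      "W (cb c) c (r c) 0 \<in> carrier_mat (nd (r c)) (nd (cb c) * nd c)"
      "W (cb c) c (r c) 0 * V (cb c) c (r c) 0 = 1\<^sub>m (nd (r c))"
      using fus unfolding fusion_def by auto
  qed (use uvc[OF B.r_vac] Zi(1)[of "cb c"] in \<open>auto simp: nd_cb\<close>)
  define \<theta> where "\<theta> e = u e \<bullet> v e" for e
  have cu_blk: "ev (B.blk e) (un H) = \<theta> e" if e: "e \<in> vacE nd b" for e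
  proof -
    have "ev (B.blk e) (un H) = (\<Sum>i<nd e. \<Sum>j<nd e. u e $ i * \<rho> e i j (ep H) * v e $ j)"
      using B.cu_blk[of e "ep H"] e by (simp add: B.one_right)
    also have "\<dots> = \<theta> e" using uvc[OF e]
      by (simp add: B.rho_one \<theta>_def scalar_prod_def atLeast0LessThan if_distrib[of "\<lambda>z. _ * z"] if_distrib[of "\<lambda>z. z * _"] cong: if_cong)
    finally show ?thesis .
  qed
  have \<theta>: "\<theta> e \<noteq> 0" if "e \<in> vacE nd b" for e using sph that by (auto simp: spherical_element_def \<theta>_def)
  have sphe: "mtrace (\<psi> a k) / \<theta> (l a) = mtrace (\<psi> a (dinv H k)) / \<theta> (r a)" for a
    using sph by (simp add: spherical_element_def \<theta>_def)
  have w_nz: "w a \<noteq> 0" for a using wd by (auto simp: wdata_def)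
  have d2: "(d a)\<^sup>2 = w a * w (cb a)" for a using dd by (simp add: ddata_def)
  have d_nz: "d a \<noteq> 0" for a using d2[of a] w_nz[of a] w_nz[of "cb a"] by auto
  define s where "s a = \<xi> a * (d a / w (cb a))" for a
  have psik: "\<psi> a k = s a \<cdot>\<^sub>m (transpose_mat (minv (Z a)) * Z (cb a))" for a
  proof -
    have "\<psi> a k = \<xi> a \<cdot>\<^sub>m ((d a / w (cb a)) \<cdot>\<^sub>m (transpose_mat (minv (Z a)) * Z (cb a)))"
      using xi gd by (simp add: gdata_def)
    then show ?thesis unfolding s_def by (auto intro!: eq_matI)
  qed
  have Zb: "Z (cb a) \<in> carrier_mat (nd a) (nd a)" "minv (Z (cb a)) \<in> carrier_mat (nd a) (nd a)"
    "Z (cb a) * minv (Z (cb a)) = 1\<^sub>m (nd a)" for a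
    using Z[of "cb a"] Zi[of "cb a"] by (simp_all add: nd_cb)
  \<comment> \<open>The w-relation is used for bar a, whose right vacuum is \<open>l a\<close>; its
    factor w_(bar a) cancels the denominator in g.\<close>
  have trk: "mtrace (\<psi> a k) = \<xi> a * d a * \<theta> (l a)" for a
  proof -
    have "mtrace (\<psi> a k) = s a * mtrace (transpose_mat (minv (Z a)) * Z (cb a))"
      unfolding psik by (rule mtrace_smult[of _ "nd a"]) (use Zi(1)[of a] Zb(1)[of a] in auto)
    also have "mtrace (transpose_mat (minv (Z a)) * Z (cb a)) = mtrace (transpose_mat (Z (cb a)) * minv (Z a))"
      by (simp add: mtrace_transpose_mult[OF Zi(1) Zb(1)] mtrace_transpose_mult[OF Zb(1) Zi(1)] mult.commute)
    also have "\<dots> = w (cb a) * \<theta> (l a)" using wtr[of "cb a"] by (simp add: cb_cb r_cb \<theta>_def)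
    finally show ?thesis using w_nz[of "cb a"] by (simp add: s_def)
  qed
  \<comment> \<open>\<psi>_a(k) is \<open>s a\<close> times \<open>?X\<close>, and \<open>?X\<close>
    has the explicit inverse \<open>?Y\<close>. The factor \<open>s a\<close> is kept on the left
    because its nonvanishing, and hence that of \<xi>_a, is deduced from this identity.\<close>
  have trki: "s a * mtrace (\<psi> a (dinv H k)) = w a * \<theta> (r a)" for a
  proof -
    let ?X = "transpose_mat (minv (Z a)) * Z (cb a)" and ?Y = "minv (Z (cb a)) * transpose_mat (Z a)"
    let ?Q = "\<psi> a (dinv H k)"
    have tZ: "transpose_mat (minv (Z a)) \<in> carrier_mat (nd a) (nd a)" "transpose_mat (Z a) \<in> carrier_mat (nd a) (nd a)"
      using Zi(1)[of a] Z[of a] by auto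
    have X: "?X \<in> carrier_mat (nd a) (nd a)" by (rule mult_carrier_mat[OF tZ(1) Zb(1)])
    have Y: "?Y \<in> carrier_mat (nd a) (nd a)" by (rule mult_carrier_mat[OF Zb(2) tZ(2)])
    have "?X * ?Y = transpose_mat (minv (Z a)) * (Z (cb a) * ?Y)" by (rule assoc_mult_mat[OF tZ(1) Zb(1) Y])
    also have "Z (cb a) * ?Y = transpose_mat (Z a)"
      unfolding assoc_mult_mat[OF Zb(1,2) tZ(2), symmetric] Zb(3) by (rule left_mult_one_mat[OF tZ(2)])
    also have "transpose_mat (minv (Z a)) * transpose_mat (Z a) = 1\<^sub>m (nd a)"
      by (simp add: transpose_mult[OF Z Zi(1), symmetric] Zi(2))
    finally have XY: "?X * ?Y = 1\<^sub>m (nd a)" .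
    have "?Q * (s a \<cdot>\<^sub>m ?X) = 1\<^sub>m (nd a)"
      unfolding psik[symmetric] psi(4)[symmetric] dk psi(5) ..
    then have QX: "s a \<cdot>\<^sub>m (?Q * ?X) = 1\<^sub>m (nd a)" using mult_smult_distrib[OF psi(1) X] by simp
    have "s a \<cdot>\<^sub>m ?Q = s a \<cdot>\<^sub>m (?Q * (?X * ?Y))" unfolding XY by (simp add: right_mult_one_mat[OF psi(1)])
    also have "\<dots> = s a \<cdot>\<^sub>m (?Q * ?X) * ?Y"
      unfolding assoc_mult_mat[OF psi(1) X Y, symmetric] by (rule mult_smult_assoc_mat[symmetric, OF mult_carrier_mat[OF psi(1) X] Y])
    also have "\<dots> = ?Y" unfolding QX by (rule left_mult_one_mat[OF Y])
    finally have "s a * mtrace ?Q = mtrace ?Y" using mtrace_smult[OF psi(1)] by metis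
    also have "\<dots> = mtrace (transpose_mat (Z a) * minv (Z (cb a)))" by (rule mtrace_comm[OF Zb(2) tZ(2)])
    also have "\<dots> = w a * \<theta> (r a)" by (simp add: wtr \<theta>_def)
    finally show ?thesis .
  qed
  have xi_nz: "\<xi> a \<noteq> 0" for a
    using trki[of a] w_nz[of a] \<theta>[OF B.r_vac[of a]] by (auto simp: s_def)
  have p1: "mtrace (\<psi> a k) / \<theta> (l a) = \<xi> a * d a" for a
    using trk[of a] \<theta>[OF B.l_vac[of a]] by simp
  \<comment> \<open>Sphericity replaces the trace of k by that of its inverse, whose value comes
    from the w-relation for a itself.\<close>
  have p2: "mtrace (\<psi> a k) / \<theta> (l a) = d a / \<xi> a" for a
  proof -
    have "\<xi> a * d a * mtrace (\<psi> a (dinv H k)) = (d a)\<^sup>2 * \<theta> (r a)"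
      using trki[of a] w_nz[of "cb a"] by (simp add: s_def d2 field_simps)
    then have "mtrace (\<psi> a (dinv H k)) = d a / \<xi> a * \<theta> (r a)"
      using xi_nz[of a] d_nz[of a] by (simp add: field_simps power2_eq_square)
    then show ?thesis unfolding sphe using \<theta>[OF B.r_vac[of a]] by simp
  qed
  interpret Q: spherical_weak_hopf "dmul H" "ep H" "dcop H" "dcu H" "dant H" "dsw H" nd \<rho> E N "vacE nd b"
    "\<lambda>e i. u e $ i" "\<lambda>e i. v e $ i" l r k "dinv H k" cb
  proof unfold_locales
    show "ev (B.blk e) (un H) \<noteq> 0" if "e \<in> vacE nd b" for e using cu_blk[OF that] \<theta>[OF that] by simp
    show "B.tr a k / ev (B.blk (l a)) (un H) = B.tr a (dinv H k) / ev (B.blk (r a)) (un H)" for a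
      by (simp add: cu_blk B.l_vac B.r_vac tr sphe)
    show "B.tr a k \<noteq> 0" for a using trk[of a] xi_nz[of a] d_nz[of a] \<theta>[OF B.l_vac[of a]] by (simp add: tr)
    show "B.tr (cb a) f = B.tr a (dant H f)" for a f by (rule tr_cb)
    show "cb (cb a) = a" for a by (rule cb_cb)
  qed
  have p: "Q.p a = d a / \<xi> a" for a unfolding Q.p_def by (simp add: tr cu_blk B.l_vac p2)
  \<comment> \<open>Multiply the two expressions for p: (\<xi> d)(d / \<xi>) = d^2.\<close>
  have p_sq: "(Q.p a)\<^sup>2 = (d a)\<^sup>2" for a
  proof -
    have "Q.p a = \<xi> a * d a" unfolding Q.p_def by (simp add: tr cu_blk B.l_vac p1)
    then have "(Q.p a)\<^sup>2 = (\<xi> a * d a) * (d a / \<xi> a)" using p[of a] by (simp add: power2_eq_square)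
    then show ?thesis using xi_nz[of a] by (simp add: power2_eq_square)
  qed
  have Om: "Omega_el \<psi> l d \<xi> = (\<lambda>i. Q.\<Omega> (bas i))"
    unfolding Omega_el_def Q.\<Omega>_def p_sq unfolding p tr ..
  show ?thesis
  proof (rule dual_conclusion[OF wha])
    show "lin Q.\<Omega>" using Q.Omega_comp[OF lin_id] .
    show "Q.\<Omega> (dmul H f g) = Q.\<Omega> (dmul H g f)" for f g by (rule Q.Omega_commute)
    show "dsw H f (\<lambda>x y. Q.\<Omega> x * Q.\<Omega> y) = Q.\<Omega> f" for f by (rule Q.Omega_idem)
    show "dsw H g (\<lambda>a b. G a * Q.\<Omega> (dmul H f b)) =
       dsw H f (\<lambda>a b. G (dmul H (dant H a) k) * Q.\<Omega> (dmul H b g))" if "lin G" for G f g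
      by (rule Q.Omega_shift[OF that])
    show "Q.\<Omega> (dant H f) = Q.\<Omega> f" for f by (rule Q.Omega_S)
    show "f = (\<lambda>_. 0)" if "\<And>g. Q.\<Omega> (dmul H f g) = 0" for f by (rule Q.Omega_nondegenerate[OF that])
    show "dmul H k (dinv H k) = ep H" by (rule dk)
    show "dant H (dmul H f g) = dmul H (dant H g) (dant H f)" for f g by (rule B.S_mult)
    show "Omega_el \<psi> l d \<xi> = (\<lambda>i. Q.\<Omega> (bas i))" by (rule Om)
  qed
qed

end
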